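(* Let $u$ be the global Oleinik's solution of the steady Prandtl system with outer flow $U\equiv 1$ described in the context. Assume in addition that the initial datum satisfies $$|u_0(y)-1|\le C_4e^{-C_5y^2}\quad\text{for all }y\ge0$$ for some positive constants $C_4,C_5$ with $C_5>C_1$, where $C_1$ is the constant in the Gaussian asymptotics of the Blasius profile (see context). Then there exist positive constants $C$ and $c$ such that for all $(x,y)\in\mathbb{R}_+\times\mathbb{R}_+$, $$|u(x,y)-\bar u(x,y)|\le \frac{C}{\sqrt{x+1}}\ln(x+e)\,e^{-c\frac{y^2}{x+1}}.$$
   Context: Steady Prandtl system on $\mathbb{R}_+\times\mathbb{R}_+$ with zero pressure gradient (outer flow $U\equiv1$): $u\partial_xu+v\partial_yu-\partial_y^2u=0$, $\partial_xu+\partial_yv=0$, $u(0,y)=u_0(y)$, $u(x,0)=v(x,0)=0$, $\lim_{y\to\infty}u(x,y)=1$. The datum satisfies Oleinik's conditions: $u_0\in C_b^{2,\alpha}([0,\infty))$ for some $\alpha>0$, $u_0(0)=0$, $u_0'(0)>0$, $u_0(y)>0$ for $y>0$, $u_0''(y)=O(y^2)$ as $y\to0$, and $u_0(y)\to1$ as $y\to\infty$. An Oleinik's solution is the (unique) global-in-$x$ solution $u\in C^1(\mathbb{R}_+\times\mathbb{R}_+)$ such that for every $X>0$: $u$ is bounded and continuous on $[0,X]\times\mathbb{R}_+$; $u(x,y)>0$ for $y>0$; $u_y,u_{yy}$ are bounded and continuous on $[0,X]\times\mathbb{R}_+$; $v,v_y,u_x$ are locally bounded and continuous on $[0,X]\times\mathbb{R}_+$.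 The Blasius profile $f$ is the solution of $\frac12ff''+f'''=0$ on $[0,\infty)$, $f(0)=f'(0)=0$, $f'(\zeta)\to1$ as $\zeta\to\infty$; it satisfies $0\le f'\le1$, $f''\ge0$, $f''(0)>0$, $f'''(\zeta)<0$ for $\zeta>0$, $f(\zeta)/\zeta\to1$, and there are positive constants $C_1,C_2$ with $1-f'(\zeta)\sim\zeta^{-1}e^{-C_1\zeta^2-C_2\zeta}$ and $f''(\zeta)\sim e^{-C_1\zeta^2-C_2\zeta}$ as $\zeta\to\infty$. The Blasius solution is $\bar u(x,y)=f'\big(y/\sqrt{x+1}\big)$. *)

theory Defs
  imports "HOL-Analysis.Analysis" "HOL-Library.Landau_Symbols"
begin

definition quadrant :: "(real \<times> real) set" where
  "quadrant = {0..} \<times> {0..}"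

definition blasius_profile :: "(real \<Rightarrow> real) \<Rightarrow> (real \<Rightarrow> real) \<Rightarrow> (real \<Rightarrow> real) \<Rightarrow> bool" where
  "blasius_profile f f1 f2 \<longleftrightarrow>
     (\<forall>z\<ge>0. (f has_real_derivative f1 z) (at z within {0..})
          \<and> (f1 has_real_derivative f2 z) (at z within {0..})
          \<and> (f2 has_real_derivative (- (1/2) * f z * f2 z)) (at z within {0..}))
     \<and> f 0 = 0 \<and> f1 0 = 0 \<and> (f1 \<longlongrightarrow> 1) at_top"

definition blasius_gauss_rate :: "(real \<Rightarrow> real) \<Rightarrow> (real \<Rightarrow> real) \<Rightarrow> real \<Rightarrow> bool" where
  "blasius_gauss_rate f1 f2 C1 \<longleftrightarrow>
     (\<exists>C2::real.
        (\<lambda>z. 1 - f1 z) \<in> \<Theta>[at_top](\<lambda>z. exp (- C1 * z\<^sup>2 - C2 * z) / z)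
      \<and> f2 \<in> \<Theta>[at_top](\<lambda>z. exp (- C1 * z\<^sup>2 - C2 * z)))"

definition oleinik_datum :: "(real \<Rightarrow> real) \<Rightarrow> (real \<Rightarrow> real) \<Rightarrow> (real \<Rightarrow> real) \<Rightarrow> bool" where
  "oleinik_datum u0 d1 d2 \<longleftrightarrow>
     (\<forall>y\<ge>0. (u0 has_real_derivative d1 y) (at y within {0..})
          \<and> (d1 has_real_derivative d2 y) (at y within {0..}))
     \<and> continuous_on {0..} d2
     \<and> bounded (u0 ` {0..}) \<and> bounded (d1 ` {0..}) \<and> bounded (d2 ` {0..})
     \<and> (\<exists>\<alpha>>0. \<exists>H. \<forall>y\<ge>0. \<forall>z\<ge>0. \<bar>d2 y - d2 z\<bar> \<le> H * \<bar>y - z\<bar> powr \<alpha>)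
     \<and> u0 0 = 0 \<and> d1 0 > 0 \<and> (\<forall>y>0. u0 y > 0)
     \<and> (\<exists>K \<delta>. \<delta> > 0 \<and> (\<forall>y. 0 \<le> y \<and> y \<le> \<delta> \<longrightarrow> \<bar>d2 y\<bar> \<le> K * y\<^sup>2))
     \<and> (u0 \<longlongrightarrow> 1) at_top"

definition oleinik_solution ::
  "(real \<Rightarrow> real) \<Rightarrow> (real \<Rightarrow> real \<Rightarrow> real) \<Rightarrow> (real \<Rightarrow> real \<Rightarrow> real) \<Rightarrow>
   (real \<Rightarrow> real \<Rightarrow> real) \<Rightarrow> (real \<Rightarrow> real \<Rightarrow> real) \<Rightarrow> (real \<Rightarrow> real \<Rightarrow> real) \<Rightarrow>
   (real \<Rightarrow> real \<Rightarrow> real) \<Rightarrow> bool" where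
  "oleinik_solution u0 u v ux uy uyy vy \<longleftrightarrow>
     (\<forall>x\<ge>0. \<forall>y\<ge>0.
        ((\<lambda>s. u s y) has_real_derivative ux x y) (at x within {0..})
      \<and> ((\<lambda>t. u x t) has_real_derivative uy x y) (at y within {0..})
      \<and> ((\<lambda>t. uy x t) has_real_derivative uyy x y) (at y within {0..})
      \<and> ((\<lambda>t. v x t) has_real_derivative vy x y) (at y within {0..}))
     \<and> continuous_on quadrant (\<lambda>p. u (fst p) (snd p))
     \<and> continuous_on quadrant (\<lambda>p. ux (fst p) (snd p))
     \<and> continuous_on quadrant (\<lambda>p. uy (fst p) (snd p))
     \<and> continuous_on quadrant (\<lambda>p. uyy (fst p) (snd p))
     \<and> continuous_on quadrant (\<lambda>p. v (fst p) (snd p))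
     \<and> continuous_on quadrant (\<lambda>p. vy (fst p) (snd p))
     \<and> (\<forall>X>0. bounded ((\<lambda>p. u (fst p) (snd p)) ` ({0..X} \<times> {0..}))
             \<and> bounded ((\<lambda>p. uy (fst p) (snd p)) ` ({0..X} \<times> {0..}))
             \<and> bounded ((\<lambda>p. uyy (fst p) (snd p)) ` ({0..X} \<times> {0..})))
     \<and> (\<forall>x>0. \<forall>y>0. u x y * ux x y + v x y * uy x y - uyy x y = 0 \<and> ux x y + vy x y = 0)
     \<and> (\<forall>y\<ge>0. u 0 y = u0 y)
     \<and> (\<forall>x\<ge>0. u x 0 = 0 \<and> v x 0 = 0)
     \<and> (\<forall>x\<ge>0. ((\<lambda>y. u x y) \<longlongrightarrow> 1) at_top)
     \<and> (\<forall>x\<ge>0. \<forall>y>0. u x y > 0)"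

end

theory Submission
  imports Defs
begin

text \<open>
  Write \<open>\<psi>\<close> for the stream function. In von Mises variables \<open>(x, \<psi>)\<close> the quantity \<open>w = u\<^sup>2\<close> solves the
  degenerate parabolic equation \<open>w\<^sub>x = \<surd>w w\<^sub>\<psi>\<^sub>\<psi>\<close>, and the Blasius solutions become \<open>F (\<psi> / \<surd>(x + b))\<close> with \<open>F\<close>
  increasing and concave. The maximum principle then traps \<open>w\<close>.

  From below, \<open>F (\<psi> / \<surd>(x + a)) \<le> w\<close> for \<open>a\<close> large; the comparison of the streamlines turns this into
  \<open>u \<ge> f' (y / \<surd>(x + a))\<close>, which differs from the Blasius solution by \<open>O (1 / (x + 1))\<close>.

  From above, put \<open>\<eta> = \<psi> / \<surd>(x + 1)\<close>. Since \<open>F\<close> is concave, \<open>F \<eta> + g\<close> is a supersolution as soon as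
  \<open>g\<^sub>x \<ge> u g\<^sub>\<psi>\<^sub>\<psi>\<close>. A first barrier \<open>g = K (x + 1)\<^sup>-\<^sup>s\<^sup>/\<^sup>2 \<eta>\<^sup>s exp (- c \<eta>\<^sup>2)\<close> with small \<open>s\<close> shows
  that the excess of \<open>w\<close> over \<open>F\<close> becomes small. Once it is small, \<open>\<eta> F' \<eta>\<close> (the derivative of the Blasius solution
  with respect to a shift in \<open>x\<close>) yields a barrier decaying like \<open>(x + 1)\<^sup>-\<^sup>1\<^sup>/\<^sup>2\<close>, the margin coming from
  \<open>2 f f'' \<le> f'\<^sup>2\<close>. This bounds the displacement of the streamlines by a constant, and hence
  \<open>u - f' (y / \<surd>(x + 1))\<close> by \<open>C (x + 1)\<^sup>-\<^sup>1\<^sup>/\<^sup>2\<close> with a Gaussian factor.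
\<close>

subsection \<open>Calculus on the half line\<close>

text \<open>The diffusion coefficient in the equation for \<open>w\<close> is \<open>u\<close>
  itself, not \<open>\<surd>F\<close>. Above the profile the concavity of \<open>F\<close> gives
  this mismatch a favourable sign; dropping it leaves a linear inequality for \<open>g\<close>,
  still with the unknown coefficient \<open>u\<close>. Dropping it has a price: the shift mode,
  which decays like \<open>1 / (x + 1)\<close> in the linearised problem, is no supersolution at
  that rate any more. At the rate \<open>(x + 1) powr (-1/2)\<close> a positive margin survives, but
  only while \<open>u\<close> is close to the profile. Hence the two barriers: the first one only
  has to bring the solution into the range of the second, so its tiny exponent \<open>s\<close> does
  no harm.

  A bound for \<open>w\<close> at fixed \<open>\<psi>\<close> says nothing about \<open>u\<close> at
  fixed \<open>y\<close> until the streamlines are compared. Their displacement is an integral over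
  all heights below \<open>y\<close>, which could grow with \<open>y\<close>. The Gaussian factor in
  the barrier makes the relative excess integrable with weight \<open>1 / (1 + q^2)\<close> in the
  similarity variable \<open>q\<close>, so the displacement stays bounded and no logarithm is
  produced.\<close>

lemma integral_has_real_derivative_halfline:
  fixes g :: "real \<Rightarrow> real"
  assumes g: "continuous_on {0..} g" and y: "y \<ge> 0"
  shows "((\<lambda>t. integral {0..t} g) has_real_derivative g y) (at y within {0..})"
proof -
  have "((\<lambda>t. integral {0..t} g) has_real_derivative g y) (at y within {0..y+1})"
    using y by (intro integral_has_real_derivative continuous_on_subset[OF g]) auto
  moreover have "at y within {0..y+1} = at y within {0..}"
    by (rule at_within_nhd[of _ "{..<y+1}"]) auto
  ultimately show ?thesis by simp
qed

lemma has_real_derivative_at_of_halfline: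
  fixes g :: "real \<Rightarrow> real"
  assumes "(g has_real_derivative D) (at y within {0..})" "y > 0"
  shows "(g has_real_derivative D) (at y)"
proof -
  have "at y within {0..} = at y" using assms(2) by (intro at_within_interior) auto
  with assms(1) show ?thesis by simp
qed

lemma halfline_continuous_on:
  fixes g g' :: "real \<Rightarrow> real"
  assumes "\<And>z. z \<ge> 0 \<Longrightarrow> (g has_real_derivative g' z) (at z within {0..})"
  shows "continuous_on {0..} g"
  by (rule DERIV_continuous_on[where D = g']) (use assms in simp)

lemma halfline_MVT:
  fixes g g' :: "real \<Rightarrow> real"
  assumes d: "\<And>z. z \<ge> 0 \<Longrightarrow> (g has_real_derivative g' z) (at z within {0..})"
    and ab: "0 \<le> a" "a < b"
  obtains z where "a < z" "z < b" "g b - g a = (b - a) * g' z"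
proof -
  have "\<exists>l z. a < z \<and> z < b \<and> DERIV g z :> l \<and> g b - g a = (b - a) * l"
  proof (rule MVT[OF \<open>a < b\<close>])
    show "continuous_on {a..b} g"
      using halfline_continuous_on[of g g'] d ab by (auto intro: continuous_on_subset)
    show "g differentiable at x" if "a < x" "x < b" for x
      using has_real_derivative_at_of_halfline[OF d, of x] that ab
      by (auto simp: real_differentiable_def)
  qed
  then obtain l z where z: "a < z" "z < b" "DERIV g z :> l" "g b - g a = (b - a) * l" by blast
  have "DERIV g z :> g' z"
    using has_real_derivative_at_of_halfline[OF d, of z] z ab by auto
  then show thesis using z DERIV_unique that by metis
qed

lemma halfline_mono:
  fixes g g' :: "real \<Rightarrow> real"
  assumes d: "\<And>z. z \<ge> 0 \<Longrightarrow> (g has_real_derivative g' z) (at z within {0..})"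
    and pos: "\<And>z. z > 0 \<Longrightarrow> g' z \<ge> 0"
    and ab: "0 \<le> a" "a \<le> b"
  shows "g a \<le> g b"
proof (cases "a = b")
  case False
  then obtain z where "a < z" "z < b" "g b - g a = (b - a) * g' z"
    using halfline_MVT[OF d, of a b] ab by auto
  then show ?thesis using pos[of z] ab by (smt (verit) mult_nonneg_nonneg)
qed simp

lemma halfline_strict_mono:
  fixes g g' :: "real \<Rightarrow> real"
  assumes d: "\<And>z. z \<ge> 0 \<Longrightarrow> (g has_real_derivative g' z) (at z within {0..})"
    and pos: "\<And>z. z > 0 \<Longrightarrow> g' z > 0"
    and ab: "0 \<le> a" "a < b"
  shows "g a < g b"
proof -
  obtain z where "a < z" "z < b" "g b - g a = (b - a) * g' z"
    using halfline_MVT[OF d, of a b] ab by auto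
  then show ?thesis using pos[of z] ab by (smt (verit) mult_pos_pos)
qed

subsection \<open>The Blasius profile\<close>

locale blasius =
  fixes f f1 f2 :: "real \<Rightarrow> real"
  assumes profile: "blasius_profile f f1 f2"
begin

lemma deriv_f: "z \<ge> 0 \<Longrightarrow> (f has_real_derivative f1 z) (at z within {0..})"
  and deriv_f1: "z \<ge> 0 \<Longrightarrow> (f1 has_real_derivative f2 z) (at z within {0..})"
  and deriv_f2: "z \<ge> 0 \<Longrightarrow> (f2 has_real_derivative (- (1/2) * f z * f2 z)) (at z within {0..})"
  and f_0 [simp]: "f 0 = 0"
  and f1_0 [simp]: "f1 0 = 0"
  and f1_lim: "(f1 \<longlongrightarrow> 1) at_top"
  using profile unfolding blasius_profile_def by blast+

text \<open>\<open>f2' = - f f2 / 2\<close> is linear in \<open>f2\<close>, so an integrating factor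
  solves it. What matters is that \<open>f2\<close> keeps the sign of \<open>f2 0\<close>.\<close>

lemma f2_eq: "z \<ge> 0 \<Longrightarrow> f2 z = f2 0 * exp (- integral {0..z} f / 2)"
proof -
  assume z: "z \<ge> 0"
  let ?I = "\<lambda>z. integral {0..z} f"
  have d: "((\<lambda>z. f2 z * exp (?I z / 2)) has_real_derivative 0) (at x within {0..})" if "x \<in> {0..}" for x
  proof -
    have "(?I has_real_derivative f x) (at x within {0..})"
      using integral_has_real_derivative_halfline halfline_continuous_on[OF deriv_f] that by auto
    with deriv_f2 that show ?thesis
      by (auto intro!: derivative_eq_intros simp: field_simps)
  qed
  obtain c where c: "\<And>x. x \<in> {0..} \<Longrightarrow> f2 x * exp (?I x / 2) = c"
    using has_field_derivative_zero_constant[OF _ d] by auto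
  have "c = f2 0" using c[of 0] by simp
  then show ?thesis using c[of z] z by (auto simp: exp_minus field_simps)
qed

text \<open>If \<open>f2 0\<close> were nonpositive, \<open>f1\<close> would stay nonpositive and
  could not tend to 1.\<close>

lemma f2_pos: "z \<ge> 0 \<Longrightarrow> f2 z > 0"
proof -
  assume z: "z \<ge> 0"
  have "f2 0 > 0"
  proof (rule ccontr)
    assume a: "\<not> f2 0 > 0"
    have np: "f2 z \<le> 0" if "z \<ge> 0" for z
      using f2_eq[OF that] a by (simp add: mult_le_0_iff)
    have "f1 z \<le> 0" if "z \<ge> 0" for z
      using halfline_mono[of "\<lambda>z. - f1 z" "\<lambda>z. - f2 z" 0 z] np that
        DERIV_minus[OF deriv_f1] by auto
    then have "eventually (\<lambda>z. f1 z \<le> 0) at_top"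
      using eventually_ge_at_top[of 0] by (rule eventually_mono[rotated])
    then have "1 \<le> (0::real)" by (intro tendsto_upperbound[OF f1_lim]) auto
    then show False by simp
  qed
  then show ?thesis using f2_eq[OF z] by simp
qed

lemma f1_strict_mono: "0 \<le> a \<Longrightarrow> a < b \<Longrightarrow> f1 a < f1 b"
  by (rule halfline_strict_mono[OF deriv_f1]) (auto intro: f2_pos)

lemma f1_mono: "0 \<le> a \<Longrightarrow> a \<le> b \<Longrightarrow> f1 a \<le> f1 b"
  using f1_strict_mono[of a b] by (cases "a = b") auto

lemma f1_pos: "z > 0 \<Longrightarrow> f1 z > 0"
  using f1_strict_mono[of 0 z] by simp

lemma f1_nonneg: "z \<ge> 0 \<Longrightarrow> f1 z \<ge> 0"
  using f1_mono[of 0 z] by simp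

lemma f1_less_1: "z \<ge> 0 \<Longrightarrow> f1 z < 1"
proof -
  assume z: "z \<ge> 0"
  have "eventually (\<lambda>w. f1 (z+1) \<le> f1 w) at_top"
    using eventually_ge_at_top[of "z+1"] by eventually_elim (use z f1_mono in auto)
  then have "f1 (z+1) \<le> 1" by (intro tendsto_lowerbound[OF f1_lim]) auto
  then show ?thesis using f1_strict_mono[of z "z+1"] z by simp
qed

lemma f_strict_mono: "0 \<le> a \<Longrightarrow> a < b \<Longrightarrow> f a < f b"
  by (rule halfline_strict_mono[OF deriv_f]) (auto intro: f1_pos)

lemma f_mono: "0 \<le> a \<Longrightarrow> a \<le> b \<Longrightarrow> f a \<le> f b"
  using f_strict_mono[of a b] by (cases "a = b") auto

lemma f_nonneg: "z \<ge> 0 \<Longrightarrow> f z \<ge> 0"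
  using f_mono[of 0 z] by simp

lemma f2_antimono: "0 \<le> a \<Longrightarrow> a \<le> b \<Longrightarrow> f2 b \<le> f2 a"
  using halfline_mono[of "\<lambda>z. - f2 z" "\<lambda>z. - (- (1/2) * f z * f2 z)" a b]
    DERIV_minus[OF deriv_f2] f2_pos f_nonneg by (auto simp: less_imp_le)

lemma f_le_mult_f1: "z \<ge> 0 \<Longrightarrow> f z \<le> z * f1 z"
proof -
  assume z: "z \<ge> 0"
  show ?thesis
  proof (cases "z = 0")
    case False
    then obtain w where "0 < w" "w < z" "f z - f 0 = (z - 0) * f1 w"
      using halfline_MVT[OF deriv_f, of 0 z] z by auto
    then show ?thesis using f1_mono[of w z] z by (auto intro!: mult_left_mono)
  qed simp
qed

lemma f_le_self: "z \<ge> 0 \<Longrightarrow> f z \<le> z"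
  using f_le_mult_f1[of z] f1_less_1[of z] mult_left_mono[of "f1 z" 1 z] by auto

text \<open>Beyond \<open>z = 1\<close> the slope is at least \<open>f1 1\<close>. This linear
  growth makes \<open>f\<close> onto and keeps its inverse \<open>Z\<close> at most linear.\<close>

lemma f_lower: "z \<ge> 0 \<Longrightarrow> f1 1 * (z - 1) \<le> f z"
proof -
  assume z: "z \<ge> 0"
  show ?thesis
  proof (cases "z \<le> 1")
    case True
    then have "f1 1 * (z - 1) \<le> 0" using f1_pos[of 1] by (simp add: mult_nonneg_nonpos)
    then show ?thesis using f_nonneg[OF z] by simp
  next
    case False
    then obtain w where w: "1 < w" "w < z" "f z - f 1 = (z - 1) * f1 w"
      using halfline_MVT[OF deriv_f, of 1 z] by auto
    then have "(z - 1) * f1 1 \<le> (z - 1) * f1 w" using f1_mono[of 1 w] by (intro mult_left_mono) auto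
    then show ?thesis using w f_nonneg[of 1] mult.commute[of "f1 1" "z - 1"] by linarith
  qed
qed

text \<open>In the derivative of the difference the terms \<open>f1 f2\<close> cancel and
  \<open>f^2 f2\<close> remains. In von Mises variables the statement reads
  \<open>\<eta> F' \<le> F\<close>, as it must for a concave \<open>F\<close> with
  \<open>F 0 = 0\<close>.\<close>

lemma f_f2_le: "z \<ge> 0 \<Longrightarrow> 2 * f z * f2 z \<le> (f1 z)\<^sup>2"
proof -
  assume z: "z \<ge> 0"
  have "((\<lambda>z. (f1 z)\<^sup>2 - 2 * f z * f2 z) has_real_derivative (f w)\<^sup>2 * f2 w) (at w within {0..})"
    if "w \<ge> 0" for w
    using deriv_f[OF that] deriv_f1[OF that] deriv_f2[OF that]
    by (auto intro!: derivative_eq_intros simp: power2_eq_square algebra_simps)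
  then have "(f1 0)\<^sup>2 - 2 * f 0 * f2 0 \<le> (f1 z)\<^sup>2 - 2 * f z * f2 z"
    by (rule halfline_mono) (use z f2_pos in \<open>auto simp: less_imp_le\<close>)
  then show ?thesis by simp
qed

section \<open>The inverse profile and the Blasius solution in von Mises variables\<close>

definition Z :: "real \<Rightarrow> real" where
  "Z \<eta> = (if \<eta> < 0 then \<eta> else inv_into {0..} f \<eta>)"

lemma f_surj: "\<eta> \<ge> 0 \<Longrightarrow> \<exists>z\<ge>0. f z = \<eta>"
proof -
  assume e: "\<eta> \<ge> 0"
  define b where "b = 1 + \<eta> / f1 1"
  have b: "b \<ge> 0" using e f1_pos[of 1] by (simp add: b_def)
  have "\<eta> \<le> f b" using f_lower[OF b] f1_pos[of 1] by (simp add: b_def)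
  moreover have "continuous_on {0..b} f"
    by (rule continuous_on_subset[OF halfline_continuous_on[OF deriv_f]]) auto
  ultimately show ?thesis using IVT'[of f 0 \<eta> b] e b by auto
qed

lemma f_inj: "inj_on f {0..}"
  by (rule linorder_inj_onI') (use f_strict_mono in force)

lemma Z_f [simp]: "z \<ge> 0 \<Longrightarrow> Z (f z) = z"
  using f_inj f_nonneg[of z] by (simp add: Z_def)

lemma f_Z [simp]: "\<eta> \<ge> 0 \<Longrightarrow> f (Z \<eta>) = \<eta>"
  using f_surj[of \<eta>] Z_f by metis

lemma Z_nonneg: "\<eta> \<ge> 0 \<Longrightarrow> Z \<eta> \<ge> 0"
  using f_surj[of \<eta>] Z_f by metis

lemma Z_0 [simp]: "Z 0 = 0"
  using Z_f[of 0] by simp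

lemma Z_strict_mono: "0 \<le> a \<Longrightarrow> a < b \<Longrightarrow> Z a < Z b"
  using f_mono[of "Z b" "Z a"] Z_nonneg[of a] Z_nonneg[of b] by force

lemma Z_mono: "0 \<le> a \<Longrightarrow> a \<le> b \<Longrightarrow> Z a \<le> Z b"
  using Z_strict_mono[of a b] by (cases "a = b") auto

lemma Z_pos: "\<eta> > 0 \<Longrightarrow> Z \<eta> > 0"
  using Z_strict_mono[of 0 \<eta>] by simp

text \<open>The extension of \<open>Z\<close> by the identity below 0 makes it monotone with the
  whole line as range; a monotone map with open range is continuous.\<close>

lemma continuous_Z: "continuous_on UNIV Z"
proof (rule continuous_onI_mono)
  have "\<exists>x. Z x = y" for y
  proof (cases "y < 0")
    case True
    then show ?thesis by (intro exI[of _ y]) (simp add: Z_def)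
  next
    case False
    then show ?thesis by (intro exI[of _ "f y"]) simp
  qed
  then have "range Z = UNIV" by (metis UNIV_eq_I rangeI)
  then show "open (range Z)" by simp
  fix x y :: real assume "x \<le> y"
  then show "Z x \<le> Z y"
    using Z_mono[of x y] Z_nonneg[of y] Z_def[of x] Z_def[of y] by (smt (verit))
qed

lemma deriv_Z: "\<eta> > 0 \<Longrightarrow> (Z has_real_derivative inverse (f1 (Z \<eta>))) (at \<eta>)"
proof (rule DERIV_inverse_function[where f=f and a=0 and b="\<eta>+1"])
  assume e: "\<eta> > 0"
  show "(f has_real_derivative f1 (Z \<eta>)) (at (Z \<eta>))"
    using Z_pos[OF e] by (intro has_real_derivative_at_of_halfline deriv_f) auto
  show "f1 (Z \<eta>) \<noteq> 0" using f1_pos[OF Z_pos[OF e]] by simp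
  show "isCont Z \<eta>" using continuous_Z by (simp add: continuous_on_eq_continuous_at)
qed auto

lemma deriv_f1_Z: "\<eta> > 0 \<Longrightarrow> ((\<lambda>\<eta>. f1 (Z \<eta>)) has_real_derivative f2 (Z \<eta>) / f1 (Z \<eta>)) (at \<eta>)"
proof -
  assume e: "\<eta> > 0"
  have "(f1 has_real_derivative f2 (Z \<eta>)) (at (Z \<eta>))"
    by (rule has_real_derivative_at_of_halfline[OF deriv_f1]) (use Z_pos[OF e] in auto)
  from DERIV_chain2[OF this deriv_Z[OF e]] show ?thesis by (simp only: divide_inverse)
qed

lemma deriv_f2_Z:
  "\<eta> > 0 \<Longrightarrow> ((\<lambda>\<eta>. f2 (Z \<eta>)) has_real_derivative - (1/2) * \<eta> * f2 (Z \<eta>) / f1 (Z \<eta>)) (at \<eta>)"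
proof -
  assume e: "\<eta> > 0"
  have "(f2 has_real_derivative - (1/2) * f (Z \<eta>) * f2 (Z \<eta>)) (at (Z \<eta>))"
    by (rule has_real_derivative_at_of_halfline[OF deriv_f2]) (use Z_pos[OF e] in auto)
  from DERIV_chain2[OF this deriv_Z[OF e]] show ?thesis using e by (simp only: divide_inverse f_Z less_imp_le)
qed

lemma continuous_f1_Z: "continuous_on {0..} (\<lambda>\<eta>. f1 (Z \<eta>))"
  by (rule continuous_on_compose2[OF halfline_continuous_on[OF deriv_f1] continuous_on_subset[OF continuous_Z]])
    (auto simp: Z_nonneg)

lemma continuous_f2_Z: "continuous_on {0..} (\<lambda>\<eta>. f2 (Z \<eta>))"
  by (rule continuous_on_compose2[OF halfline_continuous_on[OF deriv_f2] continuous_on_subset[OF continuous_Z]])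
    (auto simp: Z_nonneg)

text \<open>The Blasius solution in von Mises variables: \<open>u\<^sup>2\<close> as a function of the scaled stream function.\<close>

definition F :: "real \<Rightarrow> real" where "F \<eta> = (f1 (Z \<eta>))\<^sup>2"

definition dF :: "real \<Rightarrow> real" where "dF \<eta> = 2 * f2 (Z \<eta>)"

definition ddF :: "real \<Rightarrow> real" where "ddF \<eta> = - \<eta> * f2 (Z \<eta>) / f1 (Z \<eta>)"

lemma f1_Z_pos: "\<eta> > 0 \<Longrightarrow> f1 (Z \<eta>) > 0"
  by (simp add: Z_pos f1_pos)

lemma f1_Z_nonneg: "\<eta> \<ge> 0 \<Longrightarrow> f1 (Z \<eta>) \<ge> 0"
  by (simp add: Z_nonneg f1_nonneg)

lemma f2_Z_pos: "\<eta> \<ge> 0 \<Longrightarrow> f2 (Z \<eta>) > 0"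
  by (simp add: Z_nonneg f2_pos)

lemma f1_Z_less_1: "\<eta> \<ge> 0 \<Longrightarrow> f1 (Z \<eta>) < 1"
  by (simp add: Z_nonneg f1_less_1)

lemma deriv_F: "\<eta> > 0 \<Longrightarrow> (F has_real_derivative dF \<eta>) (at \<eta>)"
  unfolding F_def[abs_def] dF_def using deriv_f1_Z[of \<eta>] f1_Z_pos[of \<eta>]
  by (auto intro!: derivative_eq_intros)

lemma deriv_dF: "\<eta> > 0 \<Longrightarrow> (dF has_real_derivative ddF \<eta>) (at \<eta>)"
  unfolding dF_def[abs_def] ddF_def using deriv_f2_Z[of \<eta>] f1_Z_pos[of \<eta>]
  by (auto intro!: derivative_eq_intros)

lemma continuous_F: "continuous_on {0..} F"
  unfolding F_def[abs_def] by (intro continuous_intros continuous_f1_Z)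

lemma F_nonneg: "F \<eta> \<ge> 0"
  by (simp add: F_def)

lemma F_0 [simp]: "F 0 = 0"
  by (simp add: F_def)

lemma F_less_1: "\<eta> \<ge> 0 \<Longrightarrow> F \<eta> < 1"
  using f1_Z_less_1[of \<eta>] f1_Z_nonneg[of \<eta>] by (simp add: F_def power_less_one_iff)

text \<open>\<open>F \<ge> \<eta> F'\<close> by \<open>f_f2_le\<close>, and
  \<open>F' = 2 f2 (Z \<eta>)\<close> decreases. The linear vanishing of \<open>F\<close> at the
  wall measures how the diffusion degenerates there.\<close>

lemma F_lower: "0 \<le> \<eta> \<Longrightarrow> \<eta> \<le> R \<Longrightarrow> 2 * f2 (Z R) * \<eta> \<le> F \<eta>"
proof -
  assume a: "0 \<le> \<eta>" "\<eta> \<le> R"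
  have "2 * \<eta> * f2 (Z R) \<le> 2 * \<eta> * f2 (Z \<eta>)"
    using a f2_antimono[of "Z \<eta>" "Z R"] Z_mono[of \<eta> R] Z_nonneg by (intro mult_left_mono) auto
  also have "\<dots> \<le> F \<eta>" using f_f2_le[of "Z \<eta>"] a Z_nonneg by (simp add: F_def)
  finally show ?thesis by (simp add: mult_ac)
qed

lemma F_upper: "\<eta> \<ge> 0 \<Longrightarrow> F \<eta> \<le> 2 * f2 0 * \<eta>"
proof (cases "\<eta> = 0")
  case False
  assume "\<eta> \<ge> 0"
  with False have e: "\<eta> > 0" by simp
  obtain z where z: "0 < z" "z < \<eta>" "F \<eta> - F 0 = (\<eta> - 0) * dF z"
  proof -
    have "\<exists>l z. 0 < z \<and> z < \<eta> \<and> DERIV F z :> l \<and> F \<eta> - F 0 = (\<eta> - 0) * l"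
      using e deriv_F by (intro MVT continuous_on_subset[OF continuous_F])
        (auto simp: real_differentiable_def)
    then show thesis using that deriv_F DERIV_unique by metis
  qed
  have "dF z \<le> 2 * f2 0" using f2_antimono[of 0 "Z z"] Z_nonneg[of z] z by (simp add: dF_def)
  then have "\<eta> * dF z \<le> \<eta> * (2 * f2 0)" using e by (intro mult_left_mono) auto
  then show ?thesis using z by (simp add: mult_ac)
qed simp

end

text \<open>If \<open>D > 0\<close>, then \<open>g1\<close> is positive just to the right of its
  zero \<open>y\<close>, and the mean value theorem lifts \<open>g\<close> above its maximum. The
  second derivative has to exist at the single point \<open>y\<close> only.\<close>

lemma local_max_second_derivative:
  fixes g g1 :: "real \<Rightarrow> real"
  assumes d: "d > 0"
    and g: "\<And>t. \<bar>y - t\<bar> < d \<Longrightarrow> (g has_real_derivative g1 t) (at t)"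
    and g1: "(g1 has_real_derivative D) (at y)"
    and mx: "\<And>t. \<bar>y - t\<bar> < d \<Longrightarrow> g t \<le> g y"
  shows "g1 y = 0" "D \<le> 0"
proof -
  show 0: "g1 y = 0"
    using DERIV_local_max[OF g[of y] d] mx d by auto
  show "D \<le> 0"
  proof (rule ccontr)
    assume "\<not> D \<le> 0"
    then obtain e where e: "e > 0" "\<And>h. h > 0 \<Longrightarrow> h < e \<Longrightarrow> g1 y < g1 (y + h)"
      using DERIV_pos_inc_right[OF g1] by auto
    define h where "h = min d e / 2"
    have h: "h > 0" "h < d" "h < e" using d e(1) by (auto simp: h_def)
    have "\<exists>z>y. z < y + h \<and> g (y + h) - g y = (y + h - y) * g1 z"
      using h by (intro MVT2 g) auto
    then obtain z where z: "y < z" "z < y + h" "g (y + h) - g y = h * g1 z" by auto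
    have "g1 z > 0" using e(2)[of "z - y"] z h 0 by auto
    then have "g (y + h) > g y" using z h by (smt (verit) mult_pos_pos)
    then show False using mx[of "y + h"] h by auto
  qed
qed

subsection \<open>Stream function and comparison principle\<close>

locale prandtl =
  fixes u0 :: "real \<Rightarrow> real" and u v ux uy uyy vy :: "real \<Rightarrow> real \<Rightarrow> real"
  assumes solution: "oleinik_solution u0 u v ux uy uyy vy"
begin

lemmas solution_unfolded = solution[unfolded oleinik_solution_def quadrant_def]

lemma u_has_derivative:
  assumes "x \<ge> 0" "y \<ge> 0"
  shows deriv_u_x: "((\<lambda>s. u s y) has_real_derivative ux x y) (at x within {0..})"
    and deriv_u_y: "((\<lambda>t. u x t) has_real_derivative uy x y) (at y within {0..})"
    and deriv_uy: "((\<lambda>t. uy x t) has_real_derivative uyy x y) (at y within {0..})"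
    and deriv_v: "((\<lambda>t. v x t) has_real_derivative vy x y) (at y within {0..})"
  using conjunct1[OF solution_unfolded, rule_format, OF assms] by simp_all

lemma continuous_u: "continuous_on ({0..} \<times> {0..}) (\<lambda>p. u (fst p) (snd p))"
  using solution_unfolded by (elim conjE)

lemma continuous_ux: "continuous_on ({0..} \<times> {0..}) (\<lambda>p. ux (fst p) (snd p))"
  using solution_unfolded by (elim conjE)

lemma prandtl_system:
  "\<forall>x>0. \<forall>y>0. u x y * ux x y + v x y * uy x y - uyy x y = 0 \<and> ux x y + vy x y = 0"
  using solution_unfolded by (elim conjE)

lemma momentum: "x > 0 \<Longrightarrow> y > 0 \<Longrightarrow> u x y * ux x y + v x y * uy x y = uyy x y"
  and divergence_free: "x > 0 \<Longrightarrow> y > 0 \<Longrightarrow> vy x y = - ux x y"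
  using prandtl_system[rule_format, of x y] by linarith+

lemma boundary_values:
  "(\<forall>y\<ge>0. u 0 y = u0 y) \<and> (\<forall>x\<ge>0. u x 0 = 0 \<and> v x 0 = 0)
    \<and> (\<forall>x\<ge>0. ((\<lambda>y. u x y) \<longlongrightarrow> 1) at_top) \<and> (\<forall>x\<ge>0. \<forall>y>0. u x y > 0)"
  using solution_unfolded by (elim conjE) (intro conjI)

lemma u_initial: "y \<ge> 0 \<Longrightarrow> u 0 y = u0 y"
  and u_wall [simp]: "x \<ge> 0 \<Longrightarrow> u x 0 = 0"
  and v_wall: "x \<ge> 0 \<Longrightarrow> v x 0 = 0"
  and u_lim: "x \<ge> 0 \<Longrightarrow> ((\<lambda>y. u x y) \<longlongrightarrow> 1) at_top"
  and u_pos: "x \<ge> 0 \<Longrightarrow> y > 0 \<Longrightarrow> u x y > 0"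
  using boundary_values by simp_all

lemma u_nonneg: "x \<ge> 0 \<Longrightarrow> y \<ge> 0 \<Longrightarrow> u x y \<ge> 0"
  using u_pos[of x y] by (cases "y = 0") auto

lemma u_bounded: "X > 0 \<Longrightarrow> \<exists>M>0. \<forall>x y. 0 \<le> x \<and> x \<le> X \<and> 0 \<le> y \<longrightarrow> u x y \<le> M \<and> \<bar>uy x y\<bar> \<le> M"
proof -
  assume X: "X > 0"
  have "\<forall>X>0. bounded ((\<lambda>p. u (fst p) (snd p)) ` ({0..X} \<times> {0..}))
             \<and> bounded ((\<lambda>p. uy (fst p) (snd p)) ` ({0..X} \<times> {0..}))
             \<and> bounded ((\<lambda>p. uyy (fst p) (snd p)) ` ({0..X} \<times> {0..}))"
    using solution_unfolded by (elim conjE)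
  with X have "bounded ((\<lambda>p. u (fst p) (snd p)) ` ({0..X} \<times> {0..}))"
    "bounded ((\<lambda>p. uy (fst p) (snd p)) ` ({0..X} \<times> {0..}))"
    by simp_all
  then obtain A B where A: "\<And>p. p \<in> {0..X} \<times> {0..} \<Longrightarrow> \<bar>u (fst p) (snd p)\<bar> \<le> A"
    and B: "\<And>p. p \<in> {0..X} \<times> {0..} \<Longrightarrow> \<bar>uy (fst p) (snd p)\<bar> \<le> B"
    unfolding bounded_iff ball_simps real_norm_def by blast
  show ?thesis
  proof (intro exI[of _ "max 1 (max A B)"] conjI allI impI)
    fix x y :: real assume "0 \<le> x \<and> x \<le> X \<and> 0 \<le> y"
    then have "(x, y) \<in> {0..X} \<times> {0..}" by auto
    from A[OF this] B[OF this] show "u x y \<le> max 1 (max A B)" "\<bar>uy x y\<bar> \<le> max 1 (max A B)" by auto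
  qed auto
qed

lemma continuous_u_y: "x \<ge> 0 \<Longrightarrow> continuous_on {0..} (u x)"
  by (rule halfline_continuous_on[OF deriv_u_y])

definition \<psi> :: "real \<Rightarrow> real \<Rightarrow> real" where
  "\<psi> x y = integral {0..y} (u x)"

lemma psi_wall [simp]: "\<psi> x 0 = 0"
  by (simp add: \<psi>_def)

lemma deriv_psi_y: "x \<ge> 0 \<Longrightarrow> y \<ge> 0 \<Longrightarrow> (\<psi> x has_real_derivative u x y) (at y within {0..})"
  unfolding \<psi>_def[abs_def] by (rule integral_has_real_derivative_halfline[OF continuous_u_y])

text \<open>Differentiation under the integral sign gives the integral of \<open>ux\<close>, which
  the continuity equation and \<open>v = 0\<close> at the wall turn into \<open>- v\<close>.\<close>

lemma deriv_psi_x: "x > 0 \<Longrightarrow> y \<ge> 0 \<Longrightarrow> ((\<lambda>s. \<psi> s y) has_real_derivative - v x y) (at x)"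
  and continuous_psi_x: "y \<ge> 0 \<Longrightarrow> continuous_on {0..} (\<lambda>s. \<psi> s y)"
proof -
  have d: "((\<lambda>s. \<psi> s y) has_real_derivative integral {0..y} (ux x)) (at x within {0..})"
    if x: "x \<ge> 0" and y: "y \<ge> 0" for x y
  proof -
    have "((\<lambda>s. integral (cbox 0 y) (u s)) has_field_derivative integral (cbox 0 y) (ux x)) (at x within {0..})"
    proof (rule leibniz_rule_field_derivative)
      show "((\<lambda>s. u s t) has_real_derivative ux s t) (at s within {0..})"
        if "s \<in> {0..}" "t \<in> cbox 0 y" for s t using that by (auto intro: deriv_u_x)
      show "u s integrable_on cbox 0 y" if "s \<in> {0..}" for s
        using that by (intro integrable_continuous continuous_on_subset[OF continuous_u_y]) auto
      show "continuous_on ({0..} \<times> cbox 0 y) (\<lambda>(x, t). ux x t)"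
        unfolding split_beta by (rule continuous_on_subset[OF continuous_ux]) auto
    qed (use x in auto)
    then show ?thesis by (simp add: \<psi>_def)
  qed
  show "continuous_on {0..} (\<lambda>s. \<psi> s y)" if "y \<ge> 0"
    by (rule halfline_continuous_on[OF d]) (use that in auto)
  show "((\<lambda>s. \<psi> s y) has_real_derivative - v x y) (at x)" if x: "x > 0" and y: "y \<ge> 0"
  proof -
    have "(vy x has_integral (v x y - v x 0)) {0..y}"
    proof (rule fundamental_theorem_of_calculus[OF y])
      fix t assume "t \<in> {0..y}"
      then have "(v x has_real_derivative vy x t) (at t within {0..y})"
        using deriv_v[of x t] x by (auto intro: DERIV_subset)
      then show "(v x has_vector_derivative vy x t) (at t within {0..y})"
        by (simp add: has_real_derivative_iff_has_vector_derivative)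
    qed
    then have "((\<lambda>t. - vy x t) has_integral - v x y) {0..y}"
      using has_integral_neg[of "vy x" "v x y" "{0..y}"] v_wall[of x] x by simp
    then have "(ux x has_integral - v x y) {0..y}"
      \<comment> \<open>The continuity equation is available for \<open>t > 0\<close> only; the
        endpoint is discarded as a null set.\<close>
      by (rule has_integral_spike_finite[of "{0}", rotated 2]) (use divergence_free x in auto)
    then have "integral {0..y} (ux x) = - v x y" by (rule integral_unique)
    then show ?thesis using has_real_derivative_at_of_halfline[OF d[of x y] x] x y by simp
  qed
qed

lemma psi_mono: "x \<ge> 0 \<Longrightarrow> 0 \<le> a \<Longrightarrow> a \<le> b \<Longrightarrow> \<psi> x a \<le> \<psi> x b"
  by (rule halfline_mono[OF deriv_psi_y]) (auto intro: less_imp_le u_pos)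

lemma psi_strict_mono: "x \<ge> 0 \<Longrightarrow> 0 \<le> a \<Longrightarrow> a < b \<Longrightarrow> \<psi> x a < \<psi> x b"
  by (rule halfline_strict_mono[OF deriv_psi_y]) (auto intro: u_pos)

lemma psi_nonneg: "x \<ge> 0 \<Longrightarrow> y \<ge> 0 \<Longrightarrow> \<psi> x y \<ge> 0"
  using psi_mono[of x 0 y] by simp

lemma psi_pos: "x \<ge> 0 \<Longrightarrow> y > 0 \<Longrightarrow> \<psi> x y > 0"
  using psi_strict_mono[of x 0 y] by simp

lemma psi_diff_le:
  assumes "x \<ge> 0" "0 \<le> a" "a \<le> b" and M: "\<And>y. y \<ge> 0 \<Longrightarrow> u x y \<le> M"
  shows "\<psi> x b - \<psi> x a \<le> M * (b - a)"
proof (cases "a = b")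
  case False
  then obtain z where z: "a < z" "z < b" "\<psi> x b - \<psi> x a = (b - a) * u x z"
    using halfline_MVT[OF deriv_psi_y[OF \<open>x \<ge> 0\<close>], of a b] assms by auto
  then show ?thesis using M[of z] assms mult_left_mono[of "u x z" M "b - a"] by (auto simp: mult.commute)
qed simp

text \<open>The difference has derivative \<open>2 u (M - uy)\<close>. In von Mises variables this
  bounds \<open>u^2\<close> linearly at the wall, which matches the linear vanishing of
  \<open>F\<close>.\<close>

lemma u_square_le_psi:
  assumes "x \<ge> 0" "y \<ge> 0" and M: "\<And>y. y \<ge> 0 \<Longrightarrow> uy x y \<le> M"
  shows "(u x y)\<^sup>2 \<le> 2 * M * \<psi> x y"
proof -
  have d: "((\<lambda>t. 2 * M * \<psi> x t - (u x t)\<^sup>2) has_real_derivative 2 * u x t * (M - uy x t)) (at t within {0..})"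
    if "t \<ge> 0" for t
    using deriv_psi_y[OF \<open>x \<ge> 0\<close> that] deriv_u_y[OF \<open>x \<ge> 0\<close> that]
    by (auto intro!: derivative_eq_intros simp: algebra_simps)
  have "2 * M * \<psi> x 0 - (u x 0)\<^sup>2 \<le> 2 * M * \<psi> x y - (u x y)\<^sup>2"
    using assms by (intro halfline_mono[OF d]) (auto intro!: mult_nonneg_nonneg less_imp_le[OF u_pos])
  then show ?thesis using assms by simp
qed

lemma psi_unbounded: "x \<ge> 0 \<Longrightarrow> \<exists>y\<ge>0. \<psi> x y > N"
proof -
  assume x: "x \<ge> 0"
  have "eventually (\<lambda>y. u x y > 1/2) at_top"
    by (rule order_tendstoD(1)[OF u_lim[OF x]]) simp
  then obtain a where a: "\<And>y. y \<ge> a \<Longrightarrow> u x y > 1/2" by (auto simp: eventually_at_top_linorder)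
  define A where "A = max a 0"
  define b where "b = A + 2 * \<bar>N\<bar> + 2"
  have ab: "0 \<le> A" "A < b" by (auto simp: A_def b_def)
  obtain z where z: "A < z" "z < b" "\<psi> x b - \<psi> x A = (b - A) * u x z"
    using halfline_MVT[OF deriv_psi_y[OF x] ab] by auto
  have "(b - A) * (1/2) \<le> (b - A) * u x z"
    using a[of z] z ab by (intro mult_left_mono) (auto simp: A_def)
  moreover have "(b - A) * (1/2) = \<bar>N\<bar> + 1" by (simp add: b_def)
  ultimately have "\<psi> x b \<ge> \<bar>N\<bar> + 1" using z psi_nonneg[OF x ab(1)] by linarith
  then show ?thesis using ab by (intro exI[of _ b]) auto
qed

text \<open>A compactness argument in \<open>x\<close>: if the claim failed along heights
  \<open>n\<close>, a limit point \<open>l\<close> of the offending abscissae would have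
  \<open>\<psi> l\<close> bounded by \<open>N\<close>, because \<open>\<psi>\<close> is monotone in
  \<open>y\<close>. The comparison principle uses the uniformity to confine a penalised maximum to a
  rectangle.\<close>

lemma psi_coercive: "\<exists>Y\<ge>0. \<forall>x y. 0 \<le> x \<and> x \<le> X \<and> Y \<le> y \<longrightarrow> \<psi> x y > N"
proof (rule ccontr)
  assume neg: "\<not> ?thesis"
  have "\<exists>x. 0 \<le> x \<and> x \<le> X \<and> \<psi> x (real n) \<le> N" for n :: nat
  proof -
    obtain x y where "0 \<le> x" "x \<le> X" "real n \<le> y" "\<psi> x y \<le> N"
      using neg by (metis linorder_not_less of_nat_0_le_iff)
    then show ?thesis using psi_mono[of x "real n" y] by (intro exI[of _ x]) auto
  qed
  then obtain s where s: "\<And>n. 0 \<le> s n \<and> s n \<le> X \<and> \<psi> (s n) (real n) \<le> N" by metis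
  have "\<forall>n. s n \<in> {0..X}" using s by auto
  then obtain l r where l: "l \<in> {0..X}" and r: "strict_mono (r :: nat \<Rightarrow> nat)" and lim: "(s \<circ> r) \<longlonglongrightarrow> l"
    using compact_Icc[of 0 X] unfolding compact_def by blast
  obtain y where y: "y \<ge> 0" "\<psi> l y > N" using psi_unbounded[of l N] l by auto
  have "(\<lambda>n. \<psi> (s (r n)) y) \<longlonglongrightarrow> \<psi> l y"
    using continuous_on_tendsto_compose[OF continuous_psi_x[OF y(1)] lim] s l by (auto simp: o_def)
  then have "eventually (\<lambda>n. \<psi> (s (r n)) y > N) sequentially"
    using y(2) by (rule order_tendstoD(1))
  moreover have "eventually (\<lambda>n. real n \<ge> y) sequentially"
    by (meson eventually_at_top_linorder nat_ceiling_le_eq)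
  ultimately have "eventually (\<lambda>n. False) sequentially"
  proof eventually_elim
    case (elim n)
    have "real n \<le> real (r n)" using seq_suble[OF r, of n] by simp
    then have "\<psi> (s (r n)) y \<le> \<psi> (s (r n)) (real (r n))" using elim y s by (intro psi_mono) auto
    then show False using elim s[of "r n"] by auto
  qed
  then show False by simp
qed

text \<open>Continuity in \<open>x\<close> at a fixed height is combined with a Lipschitz bound in
  \<open>y\<close> that is uniform for bounded \<open>x\<close>.\<close>

lemma continuous_psi: "continuous_on ({0..} \<times> {0..}) (\<lambda>p. \<psi> (fst p) (snd p))"
  unfolding continuous_on_def
proof
  fix p :: "real \<times> real" assume p: "p \<in> {0..} \<times> {0..}"
  obtain x0 y0 where p0: "p = (x0, y0)" "x0 \<ge> 0" "y0 \<ge> 0" using p by (cases p) auto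
  obtain M where M: "M > 0" "\<And>x y. 0 \<le> x \<Longrightarrow> x \<le> x0 + 1 \<Longrightarrow> 0 \<le> y \<Longrightarrow> u x y \<le> M"
    using u_bounded[of "x0 + 1"] p0 by auto
  let ?F = "at p within {0..} \<times> {0..}"
  have fst: "(fst \<longlongrightarrow> x0) ?F" and snd: "(snd \<longlongrightarrow> y0) ?F"
    using tendsto_fst[OF tendsto_ident_at, of p] tendsto_snd[OF tendsto_ident_at, of p] p0 by auto
  have ev: "eventually (\<lambda>q. q \<in> {0..} \<times> {0..}) ?F"
    by (simp add: eventually_at_filter)
  have "((\<lambda>q. \<psi> (fst q) y0) \<longlongrightarrow> \<psi> x0 y0) ?F"
    by (rule continuous_on_tendsto_compose[OF continuous_psi_x[OF p0(3)] fst])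
      (use p0 ev in \<open>auto elim: eventually_mono\<close>)
  then have "((\<lambda>q. \<bar>\<psi> (fst q) y0 - \<psi> x0 y0\<bar> + M * \<bar>snd q - y0\<bar>) \<longlongrightarrow> \<bar>\<psi> x0 y0 - \<psi> x0 y0\<bar> + M * \<bar>y0 - y0\<bar>) ?F"
    by (intro tendsto_intros snd)
  then have lim: "((\<lambda>q. \<bar>\<psi> (fst q) y0 - \<psi> x0 y0\<bar> + M * \<bar>snd q - y0\<bar>) \<longlongrightarrow> 0) ?F" by simp
  have "eventually (\<lambda>q. fst q < x0 + 1) ?F" by (rule order_tendstoD(2)[OF fst]) simp
  with ev have "eventually (\<lambda>q. norm (\<psi> (fst q) (snd q) - \<psi> x0 y0) \<le> \<bar>\<psi> (fst q) y0 - \<psi> x0 y0\<bar> + M * \<bar>snd q - y0\<bar>) ?F"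
  proof eventually_elim
    case (elim q)
    have q: "fst q \<ge> 0" "snd q \<ge> 0" using elim by (auto simp: mem_Times_iff)
    have "\<bar>\<psi> (fst q) (snd q) - \<psi> (fst q) y0\<bar> \<le> M * \<bar>snd q - y0\<bar>"
    proof (cases "snd q \<le> y0")
      case True
      then show ?thesis
        using psi_diff_le[OF q(1) q(2) True M(2)[OF q(1)]] psi_mono[OF q True] elim by auto
    next
      case False
      then have F: "y0 \<le> snd q" by simp
      show ?thesis
        using psi_diff_le[OF q(1) p0(3) F M(2)[OF q(1)]] psi_mono[OF q(1) p0(3) F] elim F by auto
    qed
    then show ?case by simp
  qed
  then have "((\<lambda>q. \<psi> (fst q) (snd q) - \<psi> x0 y0) \<longlongrightarrow> 0) ?F"
    by (rule Lim_null_comparison[OF _ lim])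
  then show "((\<lambda>p. \<psi> (fst p) (snd p)) \<longlongrightarrow> \<psi> (fst p) (snd p)) ?F"
    using p0 by (simp add: LIM_zero_iff)
qed

end

section \<open>The comparison principle, carried out in the physical plane\<close>

context prandtl
begin

text \<open>Here \<open>\<Omega> x y = W x (\<psi> x y)\<close>, where \<open>A\<close>, \<open>B\<close>, \<open>D\<close> are the partial derivatives
  \<open>W\<^sub>x\<close>, \<open>W\<^sub>\<psi>\<close>, \<open>W\<^sub>\<psi>\<^sub>\<psi>\<close> evaluated at \<open>(x, \<psi> x y)\<close>. In von Mises variables
  the equation for \<open>u\<^sup>2\<close> is \<open>W\<^sub>x = u W\<^sub>\<psi>\<^sub>\<psi>\<close>, but the change of variables is never performed:
  one uses \<open>\<psi>\<^sub>x = - v\<close> and \<open>\<psi>\<^sub>y = u\<close> at a maximum in the physical plane.\<close>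

definition mises_derivs ::
  "(real \<Rightarrow> real \<Rightarrow> real) \<Rightarrow> (real \<Rightarrow> real \<Rightarrow> real) \<Rightarrow> (real \<Rightarrow> real \<Rightarrow> real) \<Rightarrow> (real \<Rightarrow> real \<Rightarrow> real) \<Rightarrow> bool" where
  "mises_derivs \<Omega> A B D \<longleftrightarrow> (\<forall>x>0. \<forall>y>0.
      ((\<lambda>s. \<Omega> s y) has_real_derivative A x y - v x y * B x y) (at x)
    \<and> (\<Omega> x has_real_derivative u x y * B x y) (at y)
    \<and> (B x has_real_derivative u x y * D x y) (at y))"

text \<open>The sign \<open>\<sigma>\<close> treats super- and subsolutions at once.\<close>

lemma comparison:
  fixes \<sigma> X0 :: real
  assumes X0: "X0 \<ge> 0"
    and derivs: "mises_derivs \<Omega> A B D"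
    and cont: "continuous_on ({X0..} \<times> {0..}) (\<lambda>p. \<Omega> (fst p) (snd p))"
    and bdd: "\<And>X. X > X0 \<Longrightarrow> \<exists>M. \<forall>x y. X0 \<le> x \<and> x \<le> X \<and> y \<ge> 0 \<longrightarrow> \<sigma> * ((u x y)\<^sup>2 - \<Omega> x y) \<le> M"
    and init: "\<And>y. y \<ge> 0 \<Longrightarrow> \<sigma> * ((u X0 y)\<^sup>2 - \<Omega> X0 y) \<le> 0"
    and wall: "\<And>x. x \<ge> X0 \<Longrightarrow> \<sigma> * (- \<Omega> x 0) \<le> 0"
    and super: "\<And>x y. x > X0 \<Longrightarrow> y > 0 \<Longrightarrow> \<sigma> * ((u x y)\<^sup>2 - \<Omega> x y) > 0 \<Longrightarrow>
       \<sigma> * (A x y - u x y * D x y) \<ge> 0"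
    and xy: "x1 \<ge> X0" "y1 \<ge> 0"
  shows "\<sigma> * ((u x1 y1)\<^sup>2 - \<Omega> x1 y1) \<le> 0"
proof (rule ccontr)
  assume "\<not> ?thesis"
  then have pos1: "\<sigma> * ((u x1 y1)\<^sup>2 - \<Omega> x1 y1) > 0" by simp
  have x1: "x1 > X0" using init[of y1] pos1 xy by (cases "x1 = X0") auto
  obtain Mu where Mu: "Mu > 0" "\<And>x y. 0 \<le> x \<Longrightarrow> x \<le> x1 \<Longrightarrow> 0 \<le> y \<Longrightarrow> u x y \<le> Mu"
    using u_bounded[of x1] x1 X0 by auto
  \<comment> \<open>\<open>k\<close> is tuned to the penalty
    \<open>P = exp (k x) (1 + \<psi>^2)\<close> below. In von Mises variables
    \<open>P_x - u P_\<psi>\<psi> = exp (k x) (k (1 + \<psi>^2) - 2 u)\<close>, which is positive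
    since \<open>k > 2 u\<close>; the growth in \<open>\<psi>\<close> keeps the maximum at bounded
    height.\<close>
  define k where "k = 2 * Mu + 1"
  have k: "k > 0" using Mu by (simp add: k_def)
  define P where "P x y = exp (k * x) * (1 + (\<psi> x y)\<^sup>2)" for x y
  have Ppos: "P x y > 0" for x y
    unfolding P_def by (intro mult_pos_pos) (auto simp: add_pos_nonneg)
  define \<epsilon> where "\<epsilon> = \<sigma> * ((u x1 y1)\<^sup>2 - \<Omega> x1 y1) / (2 * P x1 y1)"
  have e: "\<epsilon> > 0" using pos1 Ppos[of x1 y1] by (simp add: \<epsilon>_def)
  define \<Phi> where "\<Phi> x y = \<sigma> * ((u x y)\<^sup>2 - \<Omega> x y) - \<epsilon> * P x y" for x y
  have "\<epsilon> * P x1 y1 = \<sigma> * ((u x1 y1)\<^sup>2 - \<Omega> x1 y1) / 2"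
    using Ppos[of x1 y1] by (simp add: \<epsilon>_def)
  then have Phi1: "\<Phi> x1 y1 > 0" using pos1 unfolding \<Phi>_def by linarith
  obtain M where M: "\<And>x y. X0 \<le> x \<Longrightarrow> x \<le> x1 \<Longrightarrow> y \<ge> 0 \<Longrightarrow> \<sigma> * ((u x y)\<^sup>2 - \<Omega> x y) \<le> M"
    using bdd[OF x1] by auto
  obtain Y0 where Y0: "Y0 \<ge> 0" "\<And>x y. 0 \<le> x \<Longrightarrow> x \<le> x1 \<Longrightarrow> Y0 \<le> y \<Longrightarrow> \<psi> x y > 1 + \<bar>M\<bar> / \<epsilon>"
    using psi_coercive[of x1 "1 + \<bar>M\<bar> / \<epsilon>"] by auto
  define Y where "Y = max Y0 y1"
  have Yneg: "\<Phi> x Y < 0" if "X0 \<le> x" "x \<le> x1" for x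
  proof -
    have p: "\<psi> x Y > 1 + \<bar>M\<bar> / \<epsilon>" using Y0 that X0 by (auto simp: Y_def)
    then have "\<psi> x Y > 1" using e by (smt (verit) divide_nonneg_pos)
    then have "\<psi> x Y \<le> (\<psi> x Y)\<^sup>2" by (simp add: self_le_power)
    then have "1 + (\<psi> x Y)\<^sup>2 > \<bar>M\<bar> / \<epsilon>" using p by linarith
    moreover have "1 + (\<psi> x Y)\<^sup>2 \<le> P x Y"
      unfolding P_def using k that X0 mult_right_mono[of 1 "exp (k * x)" "1 + (\<psi> x Y)\<^sup>2"] by auto
    ultimately have "\<bar>M\<bar> / \<epsilon> < P x Y" by linarith
    then have "\<bar>M\<bar> < \<epsilon> * P x Y" using e by (simp add: field_simps)
    moreover have "\<sigma> * ((u x Y)\<^sup>2 - \<Omega> x Y) \<le> M" using M[of x Y] that xy by (auto simp: Y_def)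
    ultimately show ?thesis unfolding \<Phi>_def by linarith
  qed
  define K where "K = {X0..x1} \<times> {0..Y}"
  have cK: "compact K" by (simp add: K_def compact_Times)
  have K0: "K \<noteq> {}" using x1 xy by (auto simp: K_def Y_def)
  have Ksub: "K \<subseteq> {0..} \<times> {0..}" "K \<subseteq> {X0..} \<times> {0..}" using X0 by (auto simp: K_def)
  have "continuous_on K (\<lambda>p. \<Phi> (fst p) (snd p))"
    unfolding \<Phi>_def P_def
    by (intro continuous_on_add continuous_on_diff continuous_on_mult continuous_on_power
        continuous_on_const continuous_on_exp continuous_on_fst continuous_on_id
        continuous_on_subset[OF continuous_u Ksub(1)] continuous_on_subset[OF cont Ksub(2)]
        continuous_on_subset[OF continuous_psi Ksub(1)])
  from continuous_attains_sup[OF cK K0 this]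
  obtain p where p: "p \<in> K" "\<And>q. q \<in> K \<Longrightarrow> \<Phi> (fst q) (snd q) \<le> \<Phi> (fst p) (snd p)"
    by blast
  obtain x y where pxy: "p = (x, y)" by (cases p)
  have xyK: "X0 \<le> x" "x \<le> x1" "0 \<le> y" "y \<le> Y" using p(1) by (auto simp: K_def pxy)
  have max: "\<Phi> s t \<le> \<Phi> x y" if "X0 \<le> s" "s \<le> x1" "0 \<le> t" "t \<le> Y" for s t
    using p(2)[of "(s, t)"] that by (auto simp: K_def pxy)
  have Phixy: "\<Phi> x y > 0" using max[of x1 y1] Phi1 xy by (auto simp: Y_def)
  have eP: "\<epsilon> * P x y > 0" for x y using e Ppos by simp
  have xX0: "x > X0"
    using init[of y] eP[of X0 y] Phixy xyK by (cases "x = X0") (auto simp: \<Phi>_def)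
  have y0: "y > 0"
    using wall[of x] eP[of x 0] Phixy xyK X0 by (cases "y = 0") (auto simp: \<Phi>_def)
  have yY: "y < Y" using Yneg[of x] Phixy xyK by (cases "y = Y") auto
  have x0: "x > 0" using xX0 X0 by simp
  have upos: "u x y > 0" using u_pos x0 y0 by simp
  have der: "((\<lambda>s. \<Omega> s t) has_real_derivative A x t - v x t * B x t) (at x)"
    "(\<Omega> x has_real_derivative u x t * B x t) (at t)"
    "(B x has_real_derivative u x t * D x t) (at t)" if "t > 0" for t
    using derivs x0 that unfolding mises_derivs_def by blast+
  have dut: "(u x has_real_derivative uy x t) (at t)" "(uy x has_real_derivative uyy x t) (at t)"
    "(\<psi> x has_real_derivative u x t) (at t)" "((\<lambda>s. u s t) has_real_derivative ux x t) (at x)"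
    if "t > 0" for t
    using deriv_u_y[of x t] deriv_uy[of x t] deriv_psi_y[of x t] deriv_u_x[of x t] x0 that
    by (auto intro!: has_real_derivative_at_of_halfline)
  define G where "G t = \<sigma> * (2 * u x t * uy x t - u x t * B x t) - \<epsilon> * (exp (k * x) * (2 * \<psi> x t * u x t))" for t
  define H where "H = \<sigma> * (2 * uy x y * uy x y + 2 * u x y * uyy x y - uy x y * B x y - u x y * (u x y * D x y))
    - \<epsilon> * (exp (k * x) * (2 * u x y * u x y + 2 * \<psi> x y * uy x y))"
  define J where "J = \<sigma> * (2 * u x y * ux x y - (A x y - v x y * B x y))
    - \<epsilon> * (k * exp (k * x) * (1 + (\<psi> x y)\<^sup>2) - exp (k * x) * (2 * \<psi> x y * v x y))"
  have dG: "(\<Phi> x has_real_derivative G t) (at t)" if "t > 0" for t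
    unfolding \<Phi>_def P_def G_def
    by (rule derivative_eq_intros dut der that refl | simp)+
  have dH: "(G has_real_derivative H) (at y)"
    unfolding G_def[abs_def] H_def
    by (rule derivative_eq_intros dut der y0 refl | simp add: algebra_simps)+
  have dJ: "((\<lambda>s. \<Phi> s y) has_real_derivative J) (at x)"
    unfolding \<Phi>_def P_def J_def
    by (rule derivative_eq_intros dut der y0 x0 less_imp_le deriv_psi_x refl | simp add: algebra_simps)+
  define d where "d = min y (Y - y)"
  have d: "d > 0" using y0 yY by (simp add: d_def)
  have loc: "\<Phi> x t \<le> \<Phi> x y" if "\<bar>y - t\<bar> < d" for t
    using that xyK by (intro max) (auto simp: d_def)
  have pos: "t > 0" if "\<bar>y - t\<bar> < d" for t using that by (auto simp: d_def)
  have G0: "G y = 0" and H0: "H \<le> 0"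
    using local_max_second_derivative[OF d dG dH loc] pos by auto
  \<comment> \<open>The maximum may sit on the final line \<open>x = x1\<close>, so only smaller
    \<open>x\<close> are compared; this yields a sign instead of \<open>J = 0\<close>.\<close>
  have J0: "J \<ge> 0"
  proof (rule ccontr)
    assume "\<not> J \<ge> 0"
    then obtain \<delta> where \<delta>: "\<delta> > 0" "\<And>h. h > 0 \<Longrightarrow> h < \<delta> \<Longrightarrow> \<Phi> x y < \<Phi> (x - h) y"
      using DERIV_neg_dec_left[OF dJ] by auto
    define h where "h = min \<delta> (x - X0) / 2"
    have "h > 0" "h < \<delta>" "X0 \<le> x - h" using \<delta>(1) xX0 by (auto simp: h_def min_def field_simps)
    then show False using \<delta>(2)[of h] max[of "x - h" y] xyK by auto
  qed
  define E where "E = \<epsilon> * exp (k * x)"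
  have E: "E > 0" using e by (simp add: E_def)
  \<comment> \<open>The first-order condition \<open>G y = 0\<close> divided by
    \<open>u > 0\<close>. It removes from \<open>H\<close> the terms with the factor
    \<open>uy\<close>, and from \<open>u J\<close>, once \<open>ux\<close> is eliminated, those with
    the factor \<open>v\<close>.\<close>
  have rel: "\<sigma> * (2 * uy x y - B x y) = E * (2 * \<psi> x y)"
  proof -
    have "G y = u x y * (\<sigma> * (2 * uy x y - B x y) - E * (2 * \<psi> x y))"
      by (simp add: G_def E_def algebra_simps)
    then show ?thesis using G0 upos by simp
  qed
  have H': "H = \<sigma> * (2 * u x y * uyy x y - u x y * (u x y * D x y)) - E * (2 * u x y * u x y)"
  proof -
    have "H = \<sigma> * (2 * u x y * uyy x y - u x y * (u x y * D x y)) - E * (2 * u x y * u x y)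
       + uy x y * (\<sigma> * (2 * uy x y - B x y) - E * (2 * \<psi> x y))"
      by (simp add: H_def E_def algebra_simps)
    then show ?thesis using rel by simp
  qed
  have J': "u x y * J = \<sigma> * (2 * u x y * uyy x y - u x y * A x y) - u x y * E * (k * (1 + (\<psi> x y)\<^sup>2))"
  proof -
    have "u x y * J = \<sigma> * (2 * u x y * (u x y * ux x y + v x y * uy x y) - u x y * A x y)
        - u x y * E * (k * (1 + (\<psi> x y)\<^sup>2)) - u x y * v x y * (\<sigma> * (2 * uy x y - B x y) - E * (2 * \<psi> x y))"
      by (simp add: J_def E_def algebra_simps)
    then show ?thesis using rel momentum[OF x0 y0] by simp
  qed
  \<comment> \<open>The momentum equation has replaced \<open>u ux\<close> by
    \<open>uyy - v uy\<close>, so \<open>uyy\<close> cancels and the von Mises operator, applied to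
    barrier and penalty, remains. The left side is nonnegative at the maximum, the right side
    negative.\<close>
  have "u x y * J - H = - u x y * (\<sigma> * (A x y - u x y * D x y)) - u x y * (E * (k * (1 + (\<psi> x y)\<^sup>2) - 2 * u x y))"
    unfolding H' J' by (simp add: algebra_simps)
  moreover have "u x y * J - H \<ge> 0" using J0 H0 upos by (smt (verit) mult_nonneg_nonneg)
  moreover have "\<sigma> * (A x y - u x y * D x y) \<ge> 0"
    using super[OF xX0 y0] Phixy eP[of x y] by (simp add: \<Phi>_def)
  moreover have "E * (k * (1 + (\<psi> x y)\<^sup>2) - 2 * u x y) > 0"
  proof (rule mult_pos_pos[OF E])
    have "k * 1 \<le> k * (1 + (\<psi> x y)\<^sup>2)" using k by (intro mult_left_mono) auto
    moreover have "2 * u x y < k" using Mu(2)[of x y] x0 xyK by (simp add: k_def)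
    ultimately show "0 < k * (1 + (\<psi> x y)\<^sup>2) - 2 * u x y" by linarith
  qed
  ultimately show False using upos
    by (smt (verit) mult_nonneg_nonneg mult_pos_pos minus_mult_left)
qed

lemma mises_derivs_const: "mises_derivs (\<lambda>_ _. C) (\<lambda>_ _. 0) (\<lambda>_ _. 0) (\<lambda>_ _. 0)"
  by (simp add: mises_derivs_def)

lemma mises_derivs_add:
  assumes "mises_derivs \<Omega> A B D" "mises_derivs \<Omega>' A' B' D'"
  shows "mises_derivs (\<lambda>x y. \<Omega> x y + K * \<Omega>' x y) (\<lambda>x y. A x y + K * A' x y)
    (\<lambda>x y. B x y + K * B' x y) (\<lambda>x y. D x y + K * D' x y)"
  unfolding mises_derivs_def
proof (intro allI impI conjI)
  fix x y :: real assume xy: "x > 0" "y > 0"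
  have 1: "((\<lambda>s. \<Omega> s y) has_real_derivative A x y - v x y * B x y) (at x)"
    "(\<Omega> x has_real_derivative u x y * B x y) (at y)"
    "(B x has_real_derivative u x y * D x y) (at y)"
    and 2: "((\<lambda>s. \<Omega>' s y) has_real_derivative A' x y - v x y * B' x y) (at x)"
    "(\<Omega>' x has_real_derivative u x y * B' x y) (at y)"
    "(B' x has_real_derivative u x y * D' x y) (at y)"
    using assms xy unfolding mises_derivs_def by blast+
  show "((\<lambda>s. \<Omega> s y + K * \<Omega>' s y) has_real_derivative A x y + K * A' x y - v x y * (B x y + K * B' x y)) (at x)"
    by (rule DERIV_cong[OF DERIV_add[OF 1(1) DERIV_cmult[OF 2(1)]]]) (simp add: algebra_simps)
  show "((\<lambda>t. \<Omega> x t + K * \<Omega>' x t) has_real_derivative u x y * (B x y + K * B' x y)) (at y)"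
    by (rule DERIV_cong[OF DERIV_add[OF 1(2) DERIV_cmult[OF 2(2)]]]) (simp add: algebra_simps)
  show "((\<lambda>t. B x t + K * B' x t) has_real_derivative u x y * (D x y + K * D' x y)) (at y)"
    by (rule DERIV_cong[OF DERIV_add[OF 1(3) DERIV_cmult[OF 2(3)]]]) (simp add: algebra_simps)
qed

section \<open>Self-similar functions of the stream function\<close>

definition \<eta> :: "real \<Rightarrow> real \<Rightarrow> real \<Rightarrow> real" where
  "\<eta> b x y = \<psi> x y / sqrt (x + b)"

lemma eta_nonneg: "b > 0 \<Longrightarrow> x \<ge> 0 \<Longrightarrow> y \<ge> 0 \<Longrightarrow> \<eta> b x y \<ge> 0"
  by (simp add: \<eta>_def psi_nonneg)

lemma eta_pos: "b > 0 \<Longrightarrow> x \<ge> 0 \<Longrightarrow> y > 0 \<Longrightarrow> \<eta> b x y > 0"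
  by (simp add: \<eta>_def psi_pos)

lemma eta_wall [simp]: "\<eta> b x 0 = 0"
  by (simp add: \<eta>_def)

text \<open>For \<open>W = (x + b) powr (-p) * h (\<psi> / sqrt (x + b))\<close> both
  \<open>W_x\<close> and \<open>W_\<psi>\<psi>\<close> carry the factor
  \<open>(x + b) powr (-p-1)\<close>. A parabolic inequality for \<open>W\<close> thus becomes the
  sign of \<open>- p h - e h1 / 2 - r h2\<close> at \<open>e = \<eta> b x y\<close>, with
  \<open>r = u x y\<close>.\<close>

lemma mises_derivs_selfsimilar:
  fixes h h1 h2 :: "real \<Rightarrow> real"
  assumes b: "b > 0"
    and h: "\<And>e. e > 0 \<Longrightarrow> (h has_real_derivative h1 e) (at e)"
    and h1: "\<And>e. e > 0 \<Longrightarrow> (h1 has_real_derivative h2 e) (at e)"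
  shows "mises_derivs (\<lambda>x y. (x + b) powr (-p) * h (\<eta> b x y))
    (\<lambda>x y. (x + b) powr (-p-1) * (- p * h (\<eta> b x y) - \<eta> b x y * h1 (\<eta> b x y) / 2))
    (\<lambda>x y. (x + b) powr (-p) / sqrt (x + b) * h1 (\<eta> b x y))
    (\<lambda>x y. (x + b) powr (-p-1) * h2 (\<eta> b x y))"
  unfolding mises_derivs_def
proof (intro allI impI conjI)
  fix x y :: real assume x: "x > 0" and y: "y > 0"
  have e: "\<eta> b x y > 0" using eta_pos b x y by simp
  have xb: "x + b > 0" using x b by simp
  have pw: "(x + b) powr (-p-1) = (x + b) powr (-p) / (x + b)"
    using xb by (simp add: powr_diff)
  have sq: "sqrt (x + b) * sqrt (x + b) = x + b" using xb by simp
  have dy: "(\<eta> b x has_real_derivative u x y / sqrt (x + b)) (at y)"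
    unfolding \<eta>_def[abs_def]
    using has_real_derivative_at_of_halfline[OF deriv_psi_y[of x y] y] x y by (auto intro!: DERIV_cdivide)
  have dx: "((\<lambda>s. \<eta> b s y) has_real_derivative - v x y / sqrt (x + b) - \<eta> b x y / (2 * (x + b))) (at x)"
  proof -
    have ds: "((\<lambda>s. sqrt (s + b)) has_real_derivative inverse (sqrt (x + b)) / 2) (at x)"
      using DERIV_chain2[OF DERIV_real_sqrt[OF xb] DERIV_add[OF DERIV_ident DERIV_const]] by simp
    have "((\<lambda>s. \<psi> s y / sqrt (s + b)) has_real_derivative
        ((- v x y) * sqrt (x + b) - \<psi> x y * (inverse (sqrt (x + b)) / 2)) / (sqrt (x + b) * sqrt (x + b))) (at x)"
      by (rule DERIV_divide[OF deriv_psi_x[OF x] ds]) (use xb y in auto)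
    moreover have "((- v x y) * sqrt (x + b) - \<psi> x y * (inverse (sqrt (x + b)) / 2)) / (sqrt (x + b) * sqrt (x + b))
       = - v x y / sqrt (x + b) - \<eta> b x y / (2 * (x + b))"
    proof -
      have "(- a * r - c * (inverse r / 2)) / (r * r) = - a / r - (c / r) / (2 * (r * r))" if "r > 0" for a c r :: real
        using that by (simp add: field_simps)
      from this[of "sqrt (x + b)" "v x y" "\<psi> x y"] show ?thesis using xb by (simp only: \<eta>_def sq real_sqrt_gt_0_iff)
    qed
    ultimately show ?thesis unfolding \<eta>_def[abs_def] by simp
  qed
  have dp: "((\<lambda>s. (s + b) powr (-p)) has_real_derivative - p * (x + b) powr (-p-1)) (at x)"
    using xb by (auto intro!: derivative_eq_intros)
  show "((\<lambda>s. (s + b) powr (-p) * h (\<eta> b s y)) has_real_derivative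
      (x + b) powr (-p-1) * (- p * h (\<eta> b x y) - \<eta> b x y * h1 (\<eta> b x y) / 2)
        - v x y * ((x + b) powr (-p) / sqrt (x + b) * h1 (\<eta> b x y))) (at x)"
    by (rule DERIV_cong[OF DERIV_mult[OF dp DERIV_chain2[OF h[OF e] dx]]])
      (use xb in \<open>simp add: pw ring_distribs diff_divide_distrib mult_ac\<close>)
  show "((\<lambda>t. (x + b) powr (-p) * h (\<eta> b x t)) has_real_derivative
      u x y * ((x + b) powr (-p) / sqrt (x + b) * h1 (\<eta> b x y))) (at y)"
    by (rule DERIV_cong[OF DERIV_cmult[OF DERIV_chain2[OF h[OF e] dy]]]) simp
  show "((\<lambda>t. (x + b) powr (-p) / sqrt (x + b) * h1 (\<eta> b x t)) has_real_derivative
      u x y * ((x + b) powr (-p-1) * h2 (\<eta> b x y))) (at y)"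
    by (rule DERIV_cong[OF DERIV_cmult[OF DERIV_chain2[OF h1[OF e] dy]]])
      (use xb in \<open>simp add: pw sq mult_ac\<close>)
qed

lemma continuous_selfsimilar:
  assumes b: "b > 0" and h: "continuous_on {0..} h"
  shows "continuous_on ({0..} \<times> {0..}) (\<lambda>p. (fst p + b) powr q * h (\<eta> b (fst p) (snd p)))"
proof -
  have "continuous_on ({0..} \<times> {0..}) (\<lambda>p. \<eta> b (fst p) (snd p))"
    unfolding \<eta>_def using b by (intro continuous_intros continuous_psi) (auto simp: add_nonneg_pos)
  then have "continuous_on ({0..} \<times> {0..}) (\<lambda>p. h (\<eta> b (fst p) (snd p)))"
    by (rule continuous_on_compose2[OF h]) (use b eta_nonneg in auto)
  then show ?thesis
    using b by (intro continuous_on_mult continuous_on_powr continuous_intros) (auto simp: add_nonneg_pos)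
qed

end

subsection \<open>Barrier functions\<close>

text \<open>The quadratic Taylor bound for \<open>exp (c e^2)\<close> controls \<open>e^4\<close>.
  With \<open>power_le_quartic\<close> it trades any polynomial factor up to degree 4 for a part of
  the Gaussian rate.\<close>

lemma quartic_le_gaussian:
  fixes c e :: real
  assumes "c > 0"
  shows "1 + e ^ 4 \<le> (1 + 2 / c\<^sup>2) * exp (c * e\<^sup>2)"
proof -
  have "1 + c * e\<^sup>2 + (c * e\<^sup>2)\<^sup>2 / 2 \<le> exp (c * e\<^sup>2)"
    using assms by (intro exp_lower_Taylor_quadratic) auto
  moreover have "(c * e\<^sup>2)\<^sup>2 = c\<^sup>2 * e ^ 4" by (simp add: power_mult_distrib)
  moreover have "c * e\<^sup>2 \<ge> 0" using assms by simp
  ultimately have "1 + c\<^sup>2 * e ^ 4 / 2 \<le> exp (c * e\<^sup>2)" by linarith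
  then have "(1 + 2 / c\<^sup>2) * (1 + c\<^sup>2 * e ^ 4 / 2) \<le> (1 + 2 / c\<^sup>2) * exp (c * e\<^sup>2)"
    using assms by (intro mult_left_mono) (auto simp: add_nonneg_nonneg)
  moreover have "(1 + 2 / c\<^sup>2) * (1 + c\<^sup>2 * e ^ 4 / 2) = 1 + e ^ 4 + 2 / c\<^sup>2 + c\<^sup>2 * e ^ 4 / 2"
    using assms by (simp add: field_simps)
  moreover have "2 / c\<^sup>2 + c\<^sup>2 * e ^ 4 / 2 \<ge> 0" by simp
  ultimately show ?thesis by linarith
qed

lemma power_le_quartic: "e \<ge> 0 \<Longrightarrow> k \<le> 4 \<Longrightarrow> e ^ k \<le> 1 + e ^ 4" for e :: real
proof -
  assume e: "e \<ge> 0" "k \<le> 4"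
  show ?thesis
  proof (cases "e \<le> 1")
    case True
    then have "e ^ k \<le> 1" using e by (simp add: power_le_one)
    then show ?thesis using e by (smt (verit) zero_le_power)
  next
    case False
    then have "e ^ k \<le> e ^ 4" using e by (intro power_increasing) auto
    then show ?thesis by simp
  qed
qed

lemma powr_le_one_plus: "e \<ge> 0 \<Longrightarrow> 0 < s \<Longrightarrow> s \<le> 1 \<Longrightarrow> e powr s \<le> 1 + e" for e s :: real
proof -
  assume e: "e \<ge> 0" "0 < s" "s \<le> 1"
  show ?thesis
  proof (cases "e \<le> 1")
    case True
    then show ?thesis using e powr_le1[of s e] by simp
  next
    case False
    then show ?thesis using e powr_mono[of s 1 e] by simp
  qed
qed

definition power_gauss :: "real \<Rightarrow> real \<Rightarrow> real \<Rightarrow> real" where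
  "power_gauss s c e = e powr s * exp (- c * e\<^sup>2)"

lemma deriv_power_gauss:
  assumes e: "e > 0"
  shows "(power_gauss s c has_real_derivative (s / e - 2 * c * e) * power_gauss s c e) (at e)"
    and "((\<lambda>e. (s / e - 2 * c * e) * power_gauss s c e) has_real_derivative
      ((s / e - 2 * c * e)\<^sup>2 - s / e\<^sup>2 - 2 * c) * power_gauss s c e) (at e)"
proof -
  have pw: "e powr (s - 1) = e powr s / e" using e by (simp add: powr_diff)
  have d1: "((\<lambda>e. e powr s) has_real_derivative s * e powr (s - 1)) (at e)"
    using e by (intro has_real_derivative_powr)
  have d2: "((\<lambda>e. exp (- c * e\<^sup>2)) has_real_derivative exp (- c * e\<^sup>2) * (- c * (2 * e))) (at e)"
    by (auto intro!: derivative_eq_intros)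
  show 1: "(power_gauss s c has_real_derivative (s / e - 2 * c * e) * power_gauss s c e) (at e)"
    unfolding power_gauss_def[abs_def]
    by (rule DERIV_cong[OF DERIV_mult[OF d1 d2]]) (simp add: pw algebra_simps)
  have d3: "((\<lambda>e. s / e - 2 * c * e) has_real_derivative - s / e\<^sup>2 - 2 * c) (at e)"
    using e by (auto intro!: derivative_eq_intros simp: power2_eq_square)
  show "((\<lambda>e. (s / e - 2 * c * e) * power_gauss s c e) has_real_derivative
      ((s / e - 2 * c * e)\<^sup>2 - s / e\<^sup>2 - 2 * c) * power_gauss s c e) (at e)"
    by (rule DERIV_cong[OF DERIV_mult[OF d3 1]]) (simp add: power2_eq_square algebra_simps)
qed

lemma continuous_power_gauss: "s > 0 \<Longrightarrow> continuous_on {0..} (power_gauss s c)"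
  unfolding power_gauss_def[abs_def]
  by (intro continuous_on_mult continuous_on_powr' continuous_intros) auto

text \<open>Close to the wall the diffusion degenerates like \<open>r \<ge> \<surd>(k e)\<close>; the concavity of a small power of \<open>e\<close>
  compensates for this, at the price of a small decay exponent.\<close>

lemma power_gauss_supersolution:
  fixes s c m k e r :: real
  assumes e: "e > 0" and s: "0 < s" "s \<le> 1/2" and m: "m > 0" and c: "0 < c" "8 * c * m \<le> 1"
    and k: "0 < k" "k \<le> 4" and sk: "2 * s \<le> c * (k / 4)\<^sup>2"
    and r: "0 \<le> r" "r \<le> m" and deg: "e \<le> 1 \<Longrightarrow> k * e \<le> r\<^sup>2"
  shows "- (s/2) * power_gauss s c e - e * ((s / e - 2 * c * e) * power_gauss s c e) / 2
    - r * (((s / e - 2 * c * e)\<^sup>2 - s / e\<^sup>2 - 2 * c) * power_gauss s c e) \<ge> 0"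
proof -
  have P: "power_gauss s c e \<ge> 0" by (simp add: power_gauss_def)
  have sq: "(s / e - 2 * c * e)\<^sup>2 - s / e\<^sup>2 - 2 * c = - (s * (1 - s) / e\<^sup>2) - 4 * c * s - 2 * c + 4 * c\<^sup>2 * e\<^sup>2"
    using e by (simp add: power2_eq_square field_simps)
  \<comment> \<open>\<open>N\<close> is the quotient by \<open>power_gauss\<close>. Its negative
    terms are \<open>- s\<close>, half of it from the decay in \<open>x\<close> and half from the
    drift, and the last one; \<open>s (1 - s) / e^2\<close> stems from the concavity of
    \<open>e powr s\<close>.\<close>
  define N where "N = - s + c * e\<^sup>2 + r * (s * (1 - s) / e\<^sup>2) + r * (4 * c * s + 2 * c) - r * (4 * c\<^sup>2 * e\<^sup>2)"
  have 1: "r * (4 * c\<^sup>2 * e\<^sup>2) \<le> c * e\<^sup>2 / 2"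
  proof -
    have "8 * c * r \<le> 8 * c * m" using r c by (intro mult_left_mono) auto
    with c have "8 * c * r \<le> 1" by linarith
    then have "(8 * c * r) * (c * e\<^sup>2 / 2) \<le> 1 * (c * e\<^sup>2 / 2)" using c by (intro mult_right_mono) auto
    then show ?thesis by (simp add: power2_eq_square mult_ac)
  qed
  have 2: "r * (4 * c * s + 2 * c) \<ge> 0" using r c s by simp
  have 3: "r * (s * (1 - s) / e\<^sup>2) \<ge> 0" using r s by simp
  \<comment> \<open>For \<open>2 s \<le> c e^2\<close> the drift alone pays for \<open>- s\<close>.
    Otherwise \<open>sk\<close> forces \<open>e < k / 4\<close>, the degeneracy bound yields
    \<open>r \<ge> 2 e^2\<close>, and the concavity term exceeds \<open>s\<close> because
    \<open>s \<le> 1/2\<close>.\<close>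
  have "N \<ge> 0"
  proof (cases "2 * s \<le> c * e\<^sup>2")
    case True
    then show ?thesis using 1 2 3 unfolding N_def by linarith
  next
    case False
    then have "c * e\<^sup>2 < c * (k / 4)\<^sup>2" using sk by linarith
    then have "e\<^sup>2 < (k / 4)\<^sup>2" using c by simp
    then have ek: "e < k / 4" using k power2_less_imp_less[of e "k / 4"] by simp
    then have e1: "e \<le> 1" using k by simp
    have "e ^ 4 \<le> e\<^sup>2" using e e1 by (intro power_decreasing) auto
    also have "\<dots> \<le> e * (k / 4)" using ek e by (simp add: power2_eq_square)
    finally have "(2 * e\<^sup>2)\<^sup>2 \<le> r\<^sup>2" using deg[OF e1] by (simp add: power_mult_distrib mult.commute[of k])
    then have re: "2 * e\<^sup>2 \<le> r" using r power2_le_imp_le[of "2 * e\<^sup>2" r] by simp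
    have "s * 1 \<le> s * (2 * (1 - s))" using s by (intro mult_left_mono) auto
    also have "\<dots> = 2 * e\<^sup>2 * (s * (1 - s) / e\<^sup>2)" using e by simp
    also have "\<dots> \<le> r * (s * (1 - s) / e\<^sup>2)" using re s by (intro mult_right_mono) auto
    finally have "s \<le> r * (s * (1 - s) / e\<^sup>2)" by simp
    moreover have "c * e\<^sup>2 \<ge> 0" using c by simp
    ultimately show ?thesis using 1 2 unfolding N_def by linarith
  qed
  moreover have "- (s/2) * power_gauss s c e - e * ((s / e - 2 * c * e) * power_gauss s c e) / 2
    - r * (((s / e - 2 * c * e)\<^sup>2 - s / e\<^sup>2 - 2 * c) * power_gauss s c e) = N * power_gauss s c e"
  proof -
    have h: "e * ((s / e - 2 * c * e) * power_gauss s c e) / 2 = (s / 2 - c * e\<^sup>2) * power_gauss s c e"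
      using e by (simp add: field_simps power2_eq_square)
    have "- (s/2) * p - (s / 2 - b) * p - r * ((- w - 4 * c * s - 2 * c + d) * p)
      = (- s + b + r * w + r * (4 * c * s + 2 * c) - r * d) * p" for p w b d
      by (simp add: field_simps)
    then show ?thesis unfolding h sq N_def .
  qed
  ultimately show ?thesis using P by simp
qed

section \<open>Barriers built on the Blasius profile\<close>

context blasius
begin

text \<open>With \<open>r = u\<close>, the profile is a supersolution where the solution is faster
  than the Blasius flow on the same streamline, and a subsolution where it is slower.\<close>

lemma F_diffusion_sign:
  assumes "e > 0"
  shows "- (e * dF e / 2) - r * ddF e = e * f2 (Z e) / f1 (Z e) * (r - f1 (Z e))"
  unfolding dF_def ddF_def using f1_Z_pos[OF assms] by (simp add: field_simps)

text \<open>\<open>e * f2 (Z e)\<close> is the \<open>x\<close>-shift mode \<open>e * F' e / 2\<close>.\<close>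

definition G1 :: "real \<Rightarrow> real" where "G1 e = e * f2 (Z e)"

definition dG1 :: "real \<Rightarrow> real" where "dG1 e = f2 (Z e) * (1 - e\<^sup>2 / (2 * f1 (Z e)))"

definition ddG1 :: "real \<Rightarrow> real" where
  "ddG1 e = f2 (Z e) * e / f1 (Z e) * (- 3/2 + e\<^sup>2 / (4 * f1 (Z e)) + e * f2 (Z e) / (2 * (f1 (Z e))\<^sup>2))"

lemma deriv_G1: "e > 0 \<Longrightarrow> (G1 has_real_derivative dG1 e) (at e)"
proof -
  assume e: "e > 0"
  note p = f1_Z_pos[OF e]
  show ?thesis unfolding G1_def[abs_def] dG1_def
    by (rule DERIV_cong[OF DERIV_mult[OF DERIV_ident deriv_f2_Z[OF e]]])
      (use p in \<open>simp add: field_simps power2_eq_square\<close>)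
qed

lemma deriv_dG1: "e > 0 \<Longrightarrow> (dG1 has_real_derivative ddG1 e) (at e)"
proof -
  assume e: "e > 0"
  note p = f1_Z_pos[OF e]
  have d: "((\<lambda>e. 1 - e\<^sup>2 / (2 * f1 (Z e))) has_real_derivative
     0 - ((2 * e) * (2 * f1 (Z e)) - e\<^sup>2 * (2 * (f2 (Z e) / f1 (Z e)))) / ((2 * f1 (Z e)) * (2 * f1 (Z e)))) (at e)"
    using p by (intro DERIV_diff DERIV_const DERIV_divide DERIV_cmult deriv_f1_Z e)
      (auto intro!: derivative_eq_intros)
  show ?thesis unfolding dG1_def[abs_def] ddG1_def
    by (rule DERIV_cong[OF DERIV_mult[OF deriv_f2_Z[OF e] d]])
      (use p in \<open>simp add: field_simps power2_eq_square\<close>)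
qed

lemma continuous_G1: "continuous_on {0..} G1"
  unfolding G1_def[abs_def] by (intro continuous_on_mult continuous_f2_Z continuous_on_id)

text \<open>Let \<open>a = f1 (Z e)\<close>. For \<open>r = a\<close> and decay exponent
  \<open>p\<close> the left side would be \<open>G1 e * (1 - p - q)\<close> with
  \<open>q = e f2 (Z e) / (2 a^2) \<le> 1/4\<close> by \<open>f_f2_le\<close>; so
  \<open>p = 1/2\<close> leaves at least 1/4. The hypothesis \<open>small\<close> lets the excess
  \<open>r - a\<close> spend 1/8 of it.\<close>

lemma G1_supersolution:
  assumes e: "e > 0" and r: "f1 (Z e) \<le> r"
    and small: "(r - f1 (Z e)) * (e\<^sup>2 - 5 * f1 (Z e)) \<le> (f1 (Z e))\<^sup>2 / 2"
  shows "- (1/2) * G1 e - e * dG1 e / 2 - r * ddG1 e \<ge> G1 e / 8"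
proof -
  define a where "a = f1 (Z e)"
  have a: "a > 0" using f1_Z_pos[OF e] by (simp add: a_def)
  define g where "g = f2 (Z e)"
  have g: "g > 0" using f2_Z_pos[of e] e by (simp add: g_def)
  define q where "q = e * g / (2 * a\<^sup>2)"
  have q: "q \<le> 1/4" using f_f2_le[of "Z e"] Z_nonneg[of e] e a by (simp add: q_def g_def a_def field_simps)
  define N where "N = 1/2 - q - (r - a) / a * (- 3/2 + e\<^sup>2 / (4 * a) + q)"
  have "- (1/2) * G1 e - e * dG1 e / 2 - r * ddG1 e
    = e * g * (-1 + e\<^sup>2 / (4 * a) - r / a * (- 3/2 + e\<^sup>2 / (4 * a) + q))"
    unfolding G1_def dG1_def ddG1_def a_def[symmetric] g_def[symmetric] q_def
    by (simp add: algebra_simps power2_eq_square add_divide_distrib diff_divide_distrib)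
  also have "\<dots> = e * g * N" unfolding N_def using a by (simp add: diff_divide_distrib algebra_simps)
  finally have eq: "- (1/2) * G1 e - e * dG1 e / 2 - r * ddG1 e = e * g * N" .
  have "(r - a) / a * (- 3/2 + e\<^sup>2 / (4 * a) + q) \<le> (r - a) / a * (- 5/4 + e\<^sup>2 / (4 * a))"
    using q r a by (intro mult_left_mono) (auto simp: a_def)
  also have "\<dots> = (r - a) * (e\<^sup>2 - 5 * a) / (4 * a\<^sup>2)"
    using a by (simp add: field_simps power2_eq_square)
  also have "\<dots> \<le> (a\<^sup>2 / 2) / (4 * a\<^sup>2)"
    using small a by (intro divide_right_mono) (auto simp: a_def)
  also have "\<dots> = 1/8" using a by simp
  finally have "N \<ge> 1/8" using q unfolding N_def by linarith
  then have "e * g * (1/8) \<le> e * g * N" using e g by (intro mult_left_mono) auto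
  then show ?thesis unfolding eq by (simp add: G1_def g_def)
qed

text \<open>Near the wall \<open>e^2 \<le> 5 f1 (Z e)\<close> and the left side is nonpositive.
  Elsewhere \<open>f1 (Z e)\<close> is at least some \<open>k > 0\<close>, so
  \<open>r - f1 (Z e)\<close> is at most \<open>(r^2 - F e) / k\<close>, and the Gaussian absorbs
  the factor \<open>e^2\<close>.\<close>

lemma small_excess_absorbed:
  assumes c: "c > 0" and s: "0 < s" "s \<le> 1"
  shows "\<exists>\<epsilon>>0. \<forall>e r. e > 0 \<longrightarrow> f1 (Z e) \<le> r \<longrightarrow> r\<^sup>2 - F e \<le> \<epsilon> * power_gauss s c e \<longrightarrow>
    (r - f1 (Z e)) * (e\<^sup>2 - 5 * f1 (Z e)) \<le> (f1 (Z e))\<^sup>2 / 2"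
proof -
  \<comment> \<open>If \<open>e^2 > 5 a\<close> and \<open>e \<le> 1\<close>, then
    \<open>50 f2 (Z 1) e \<le> 25 a^2 \<le> e^4 \<le> e^2\<close>, hence
    \<open>e \<ge> 50 f2 (Z 1)\<close>.\<close>
  define e0 where "e0 = min 1 (50 * f2 (Z 1))"
  have e0: "e0 > 0" using f2_Z_pos[of 1] by (simp add: e0_def)
  define k where "k = f1 (Z e0)"
  have k: "k > 0" using f1_Z_pos[OF e0] by (simp add: k_def)
  define S where "S = 1 + 2 / c\<^sup>2"
  have S: "S > 0" using c by (simp add: S_def add_pos_nonneg)
  define \<epsilon> where "\<epsilon> = k ^ 3 / (4 * S)"
  have eps: "\<epsilon> > 0" using k S by (simp add: \<epsilon>_def)
  have "(r - f1 (Z e)) * (e\<^sup>2 - 5 * f1 (Z e)) \<le> (f1 (Z e))\<^sup>2 / 2"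
    if e: "e > 0" and r: "f1 (Z e) \<le> r" and rF: "r\<^sup>2 - F e \<le> \<epsilon> * power_gauss s c e" for e r
  proof -
    define a where "a = f1 (Z e)"
    have a: "a > 0" using f1_Z_pos[OF e] by (simp add: a_def)
    show ?thesis
    proof (cases "e\<^sup>2 \<le> 5 * a")
      case True
      then have "(r - a) * (e\<^sup>2 - 5 * a) \<le> 0" using r by (simp add: a_def mult_nonneg_nonpos)
      then show ?thesis unfolding a_def by (smt (verit) zero_le_power2 divide_nonneg_nonneg)
    next
      case False
      have "e0 \<le> e"
      proof (cases "e \<le> 1")
        case True
        have "2 * f2 (Z 1) * e \<le> a\<^sup>2" using F_lower[of e 1] e True by (simp add: F_def a_def)
        moreover have "(5 * a)\<^sup>2 \<le> (e\<^sup>2)\<^sup>2" using False a by (intro power_mono) auto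
        ultimately have "50 * f2 (Z 1) * e \<le> e ^ 4" by (simp add: power_mult_distrib)
        also have "e ^ 4 \<le> e ^ 2" using e True by (intro power_decreasing) auto
        finally have "50 * f2 (Z 1) \<le> e" using e by (simp add: power2_eq_square)
        then show ?thesis by (simp add: e0_def)
      qed (simp add: e0_def)
      then have ka: "k \<le> a" unfolding k_def a_def using e0 Z_mono[of e0 e] Z_nonneg[of e0] by (intro f1_mono) auto
      have "(r - a) * k \<le> (r - a) * (r + a)" using r ka k a by (intro mult_left_mono) (auto simp: a_def)
      also have "\<dots> = r\<^sup>2 - F e" by (simp add: F_def a_def power2_eq_square algebra_simps)
      also have "\<dots> \<le> \<epsilon> * power_gauss s c e" by (rule rF)
      finally have ra: "(r - a) * k \<le> \<epsilon> * power_gauss s c e" .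
      have "(r - a) * (e\<^sup>2 - 5 * a) * k \<le> (r - a) * e\<^sup>2 * k"
        using r a k by (intro mult_right_mono mult_left_mono) (auto simp: a_def)
      also have "\<dots> = (r - a) * k * e\<^sup>2" by simp
      also have "\<dots> \<le> \<epsilon> * power_gauss s c e * e\<^sup>2" using ra by (intro mult_right_mono) auto
      also have "\<dots> \<le> \<epsilon> * (2 * S)"
      proof -
        have "power_gauss s c e * e\<^sup>2 \<le> 2 * S"
        proof -
          have "e powr s * e\<^sup>2 \<le> (1 + e) * e\<^sup>2" using powr_le_one_plus[of e s] e s by (intro mult_right_mono) auto
          also have "\<dots> = e ^ 2 + e ^ 3" by (simp add: power2_eq_square power3_eq_cube algebra_simps)
          also have "\<dots> \<le> 2 * (1 + e ^ 4)" using power_le_quartic[of e 2] power_le_quartic[of e 3] e by simp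
          also have "\<dots> \<le> 2 * (S * exp (c * e\<^sup>2))" using quartic_le_gaussian[OF c, of e] by (simp add: S_def)
          finally have "e powr s * e\<^sup>2 * exp (- c * e\<^sup>2) \<le> 2 * (S * exp (c * e\<^sup>2)) * exp (- c * e\<^sup>2)"
            by (intro mult_right_mono) auto
          then show ?thesis by (simp add: power_gauss_def mult_ac exp_minus)
        qed
        then show ?thesis using eps by (simp add: mult.assoc)
      qed
      also have "\<dots> = k\<^sup>2 / 2 * k" using S by (simp add: \<epsilon>_def power3_eq_cube power2_eq_square)
      finally have "(r - a) * (e\<^sup>2 - 5 * a) \<le> k\<^sup>2 / 2" using k by (simp del: times_divide_eq_left)
      also have "\<dots> \<le> a\<^sup>2 / 2" using ka k by (simp add: power_mono)
      finally show ?thesis by (simp add: a_def)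
    qed
  qed
  then show ?thesis using eps by blast
qed

lemma Z_le: "e \<ge> 0 \<Longrightarrow> Z e \<le> 1 + e / f1 1"
  using f_lower[of "Z e"] Z_nonneg[of e] f1_pos[of 1] by (simp add: field_simps)

lemma Z_ge: "e \<ge> 0 \<Longrightarrow> e \<le> Z e"
  using f_le_self[of "Z e"] Z_nonneg[of e] by simp

text \<open>\<open>F\<close> vanishes only linearly at 0 and stays away from 0 for
  \<open>e \<ge> 1\<close>, while \<open>Z\<close> grows at most linearly. Dividing an excess by
  \<open>F\<close> is therefore harmless; the weight \<open>1 + (Z e)^2\<close> makes the relative
  excess integrable along a vertical line.\<close>

lemma gauss_le_F:
  assumes c: "c > 0"
  shows "\<exists>C>0. \<forall>e\<ge>0. e * exp (- c * e\<^sup>2) * (1 + (Z e)\<^sup>2) \<le> C * F e"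
proof -
  define k where "k = 2 * f2 (Z 1)"
  have k: "k > 0" using f2_Z_pos[of 1] by (simp add: k_def)
  define q where "q = 1 + 1 / f1 1"
  have q: "q \<ge> 1" using f1_pos[of 1] by (simp add: q_def)
  define S where "S = 1 + 2 / c\<^sup>2"
  have S: "S > 0" using c by (simp add: S_def add_pos_nonneg)
  define C where "C = (1 + (Z 1)\<^sup>2) / k + 2 * q\<^sup>2 * S / k"
  have C12: "(1 + (Z 1)\<^sup>2) / k > 0" "2 * q\<^sup>2 * S / k > 0" using k q S by (auto simp: add_pos_nonneg)
  have Fk: "k \<le> F e" if "e \<ge> 1" for e
  proof -
    have "k \<le> F 1" using F_lower[of 1 1] by (simp add: k_def)
    also have "\<dots> \<le> F e" unfolding F_def using that Z_mono[of 1 e] Z_nonneg f1_Z_nonneg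
      by (intro power_mono f1_mono) auto
    finally show ?thesis .
  qed
  have "e * exp (- c * e\<^sup>2) * (1 + (Z e)\<^sup>2) \<le> C * F e" if e: "e \<ge> 0" for e
  proof (cases "e \<le> 1")
    case True
    have "e * exp (- c * e\<^sup>2) * (1 + (Z e)\<^sup>2) \<le> e * 1 * (1 + (Z 1)\<^sup>2)"
      using e c True Z_mono[of e 1] Z_nonneg[of e] by (intro mult_mono add_mono power_mono) auto
    also have "\<dots> = (1 + (Z 1)\<^sup>2) / k * (k * e)" using k by simp
    also have "\<dots> \<le> (1 + (Z 1)\<^sup>2) / k * F e"
      using F_lower[OF e True] C12 by (intro mult_left_mono) (auto simp: k_def)
    also have "\<dots> \<le> C * F e" using C12 F_nonneg unfolding C_def by (intro mult_right_mono) auto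
    finally show ?thesis .
  next
    case False
    have "Z e \<le> q * e" using Z_le[OF e] False by (simp add: q_def algebra_simps)
    then have "(Z e)\<^sup>2 \<le> q\<^sup>2 * e\<^sup>2" using Z_nonneg[OF e] power_mono[of "Z e" "q * e" 2] by (simp add: power_mult_distrib)
    moreover have "1 \<le> q\<^sup>2 * e\<^sup>2" using q False mult_mono[of 1 q 1 e] one_le_power[of "q * e" 2] by (simp add: power_mult_distrib)
    ultimately have "1 + (Z e)\<^sup>2 \<le> 2 * q\<^sup>2 * e\<^sup>2" by linarith
    then have "e * exp (- c * e\<^sup>2) * (1 + (Z e)\<^sup>2) \<le> e * exp (- c * e\<^sup>2) * (2 * q\<^sup>2 * e\<^sup>2)"
      using e by (intro mult_left_mono) auto
    also have "\<dots> = 2 * q\<^sup>2 * (e ^ 3 * exp (- c * e\<^sup>2))" by (simp add: power2_eq_square power3_eq_cube)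
    also have "\<dots> \<le> 2 * q\<^sup>2 * S"
    proof -
      have "e ^ 3 \<le> S * exp (c * e\<^sup>2)"
        using power_le_quartic[of e 3] quartic_le_gaussian[OF c, of e] e by (simp add: S_def)
      then have "e ^ 3 * exp (- c * e\<^sup>2) \<le> S" by (simp add: exp_minus field_simps)
      then show ?thesis by (intro mult_left_mono) auto
    qed
    also have "\<dots> = 2 * q\<^sup>2 * S / k * k" using k by simp
    also have "\<dots> \<le> 2 * q\<^sup>2 * S / k * F e" using Fk[of e] False C12 by (intro mult_left_mono) auto
    also have "\<dots> \<le> C * F e" using C12 F_nonneg unfolding C_def by (intro mult_right_mono) auto
    finally show ?thesis .
  qed
  then show ?thesis using C12 by (intro exI[of _ C]) (auto simp: C_def)
qed

text \<open>\<open>e exp (- c e\<^sup>2)\<close> has the slow Gaussian tail and \<open>G1\<close> absorbs its defect at bounded \<open>e\<close>.\<close>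

lemma combined_supersolution:
  assumes e: "e > 0" and c: "0 < c" "8 * c * m \<le> 1" and r: "f1 (Z e) \<le> r" "r \<le> m"
    and small: "(r - f1 (Z e)) * (e\<^sup>2 - 5 * f1 (Z e)) \<le> (f1 (Z e))\<^sup>2 / 2"
    and L: "L = 8 / f2 (Z (sqrt (2 / c)))"
  shows "- (1/2) * (power_gauss 1 c e + L * G1 e)
    - e * ((1 / e - 2 * c * e) * power_gauss 1 c e + L * dG1 e) / 2
    - r * (((1 / e - 2 * c * e)\<^sup>2 - 1 / e\<^sup>2 - 2 * c) * power_gauss 1 c e + L * ddG1 e) \<ge> 0"
proof -
  have r0: "r > 0" using f1_Z_pos[OF e] r by simp
  have L0: "L > 0" using L f2_Z_pos[of "sqrt (2 / c)"] c by simp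
  define P where "P = power_gauss 1 c e"
  have P: "P \<ge> 0" "P \<le> e" using e c by (auto simp: P_def power_gauss_def)
  have 1: "- (1/2) * G1 e - e * dG1 e / 2 - r * ddG1 e \<ge> G1 e / 8"
    by (rule G1_supersolution[OF e r(1) small])
  have 2: "- (1/2) * P - e * ((1 / e - 2 * c * e) * P) / 2 - r * (((1 / e - 2 * c * e)\<^sup>2 - 1 / e\<^sup>2 - 2 * c) * P)
    = (-1 + c * e\<^sup>2 + 6 * c * r - 4 * c\<^sup>2 * r * e\<^sup>2) * P"
    using e by (simp add: field_simps power2_eq_square)
  have "8 * c * r \<le> 8 * c * m" using r c by (intro mult_left_mono) auto
  with c have "8 * c * r \<le> 1" by linarith
  then have "(8 * c * r) * (c * e\<^sup>2 / 2) \<le> 1 * (c * e\<^sup>2 / 2)" using c by (intro mult_right_mono) auto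
  then have "4 * c\<^sup>2 * r * e\<^sup>2 \<le> c * e\<^sup>2 / 2" by (simp add: power2_eq_square mult_ac)
  moreover have "6 * c * r \<ge> 0" using c r0 by simp
  ultimately have "-1 + c * e\<^sup>2 / 2 \<le> -1 + c * e\<^sup>2 + 6 * c * r - 4 * c\<^sup>2 * r * e\<^sup>2" by linarith
  then have 3: "(-1 + c * e\<^sup>2 / 2) * P \<le> (-1 + c * e\<^sup>2 + 6 * c * r - 4 * c\<^sup>2 * r * e\<^sup>2) * P"
    using P by (intro mult_right_mono) auto
  have G: "G1 e \<ge> 0" using e f2_Z_pos[of e] by (simp add: G1_def)
  \<comment> \<open>Where \<open>c e^2 \<ge> 2\<close> the Gaussian part has the right sign by
    itself. Otherwise \<open>e \<le> sqrt (2 / c)\<close>, its defect is at most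
    \<open>P \<le> e\<close>, and \<open>L\<close> is chosen so that \<open>L G1 / 8 \<ge> e\<close>
    there, \<open>f2\<close> being decreasing.\<close>
  have 4: "L * (G1 e / 8) + (-1 + c * e\<^sup>2 / 2) * P \<ge> 0"
  proof (cases "1 \<le> c * e\<^sup>2 / 2")
    case True
    then have "(-1 + c * e\<^sup>2 / 2) * P \<ge> 0" using P by (intro mult_nonneg_nonneg) auto
    then show ?thesis using L0 G by (smt (verit) mult_nonneg_nonneg divide_nonneg_nonneg)
  next
    case False
    then have "e\<^sup>2 \<le> 2 / c" using c by (simp add: field_simps)
    then have "e \<le> sqrt (2 / c)" by (simp add: real_le_rsqrt)
    then have "f2 (Z (sqrt (2 / c))) \<le> f2 (Z e)" using e Z_mono[of e "sqrt (2 / c)"] Z_nonneg[of e] by (intro f2_antimono) auto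
    then have "1 \<le> L / 8 * f2 (Z e)" using f2_Z_pos[of "sqrt (2 / c)"] c by (simp add: L)
    then have "e * 1 \<le> e * (L / 8 * f2 (Z e))" using e by (intro mult_left_mono) auto
    then have "e \<le> L * (G1 e / 8)" by (simp add: G1_def mult_ac)
    moreover have "(-1) * P \<le> (-1 + c * e\<^sup>2 / 2) * P" using P c by (intro mult_right_mono) auto
    ultimately show ?thesis using P by linarith
  qed
  have "L * (- (1/2) * G1 e - e * dG1 e / 2 - r * ddG1 e) \<ge> L * (G1 e / 8)"
    using 1 L0 by (intro mult_left_mono) auto
  then have "L * (- (1/2) * G1 e - e * dG1 e / 2 - r * ddG1 e)
     + (- (1/2) * P - e * ((1 / e - 2 * c * e) * P) / 2 - r * (((1 / e - 2 * c * e)\<^sup>2 - 1 / e\<^sup>2 - 2 * c) * P)) \<ge> 0"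
    using 2 3 4 by linarith
  moreover have "L * (- (1/2) * G1 e - e * dG1 e / 2 - r * ddG1 e)
     + (- (1/2) * P - e * ((1 / e - 2 * c * e) * P) / 2 - r * (((1 / e - 2 * c * e)\<^sup>2 - 1 / e\<^sup>2 - 2 * c) * P))
    = - (1/2) * (P + L * G1 e) - e * ((1 / e - 2 * c * e) * P + L * dG1 e) / 2
    - r * (((1 / e - 2 * c * e)\<^sup>2 - 1 / e\<^sup>2 - 2 * c) * P + L * ddG1 e)"
  proof -
    have "L * (- (1/2) * g - e * d / 2 - r * d') + (- (1/2) * P - e * (a * P) / 2 - r * (b * P))
      = - (1/2) * (P + L * g) - e * (a * P + L * d) / 2 - r * (b * P + L * d')" for g d d' a b
      by (simp add: field_simps)
    then show ?thesis .
  qed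
  ultimately show ?thesis by (simp only: P_def)
qed

end

subsection \<open>Lower bound\<close>

text \<open>Completing the square absorbs \<open>C2 z\<close>, whatever its sign, for half of the
  rate and the factor \<open>exp (C2^2 / (2 C1))\<close>. The constant \<open>N'\<close> covers the
  range before the asymptotics set in.\<close>

lemma gaussian_bound_of_bigo:
  fixes g :: "real \<Rightarrow> real"
  assumes C1: "C1 > 0" and M: "\<And>z. z \<ge> 0 \<Longrightarrow> g z \<le> M"
    and g: "g \<in> O[at_top](\<lambda>z. exp (- C1 * z\<^sup>2 - C2 * z))"
  shows "\<exists>B>0. \<forall>z\<ge>0. g z \<le> B * exp (- (C1 / 2) * z\<^sup>2)"
proof -
  obtain K where K: "K > 0" "eventually (\<lambda>z. norm (g z) \<le> K * norm (exp (- C1 * z\<^sup>2 - C2 * z))) at_top"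
    using landau_o.bigE[OF g] by blast
  then obtain z0 where z0: "\<And>z. z \<ge> z0 \<Longrightarrow> \<bar>g z\<bar> \<le> K * exp (- C1 * z\<^sup>2 - C2 * z)"
    by (auto simp: eventually_at_top_linorder)
  define N where "N = K * exp (C2\<^sup>2 / (2 * C1))"
  define N' where "N' = \<bar>M\<bar> * exp (C1 / 2 * z0\<^sup>2)"
  have N: "N > 0" "N' \<ge> 0" using K by (auto simp: N_def N'_def)
  have "g z \<le> (N + N') * exp (- (C1 / 2) * z\<^sup>2)" if z: "z \<ge> 0" for z
  proof (cases "z \<ge> z0")
    case True
    have "0 \<le> (C1 * z + C2)\<^sup>2 / (2 * C1)" using C1 by simp
    also have "(C1 * z + C2)\<^sup>2 / (2 * C1) = C1 / 2 * z\<^sup>2 + C2 * z + C2\<^sup>2 / (2 * C1)"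
      using C1 by (simp add: power2_eq_square field_simps)
    finally have "exp (- C1 * z\<^sup>2 - C2 * z) \<le> exp (C2\<^sup>2 / (2 * C1) + - (C1 / 2) * z\<^sup>2)" by simp
    then have "K * exp (- C1 * z\<^sup>2 - C2 * z) \<le> N * exp (- (C1 / 2) * z\<^sup>2)"
      using K unfolding exp_add N_def by (simp add: mult.assoc)
    also have "\<dots> \<le> (N + N') * exp (- (C1 / 2) * z\<^sup>2)" using N by (intro mult_right_mono) auto
    finally show ?thesis using z0[OF True] by linarith
  next
    case False
    then have "z\<^sup>2 \<le> z0\<^sup>2" using z by (intro power_mono) auto
    then have "1 \<le> exp (C1 / 2 * z0\<^sup>2) * exp (- (C1 / 2) * z\<^sup>2)"
      using C1 by (simp add: exp_add[symmetric])
    then have "\<bar>M\<bar> * 1 \<le> \<bar>M\<bar> * (exp (C1 / 2 * z0\<^sup>2) * exp (- (C1 / 2) * z\<^sup>2))" by (intro mult_left_mono) auto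
    then have "g z \<le> N' * exp (- (C1 / 2) * z\<^sup>2)" using M[OF z] by (simp add: N'_def mult.assoc)
    also have "\<dots> \<le> (N + N') * exp (- (C1 / 2) * z\<^sup>2)" using N by (intro mult_right_mono) auto
    finally show ?thesis .
  qed
  then show ?thesis using N by (intro exI[of _ "N + N'"]) auto
qed

locale relaxation = blasius f f1 f2 + prandtl u0 u v ux uy uyy vy
  for f f1 f2 u0 u v ux uy uyy vy +
  fixes d1 d2 :: "real \<Rightarrow> real" and C1 C4 C5 :: real
  assumes datum: "oleinik_datum u0 d1 d2"
    and C1_pos: "C1 > 0"
    and C1_rate: "blasius_gauss_rate f1 f2 C1"
    and C4_pos: "C4 > 0" and C5_pos: "C5 > 0" and C5_gt: "C5 > C1"
    and decay: "\<forall>y\<ge>0. \<bar>u0 y - 1\<bar> \<le> C4 * exp (- C5 * y\<^sup>2)"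
begin

lemma profile_tails:
  "\<exists>B>0. \<exists>\<beta>>0. \<forall>z\<ge>0. f2 z \<le> B * exp (- \<beta> * z\<^sup>2) \<and> 1 - f1 z \<le> B * exp (- \<beta> * z\<^sup>2)"
proof -
  obtain C2 where C2: "(\<lambda>z. 1 - f1 z) \<in> \<Theta>[at_top](\<lambda>z. exp (- C1 * z\<^sup>2 - C2 * z) / z)"
    "f2 \<in> \<Theta>[at_top](\<lambda>z. exp (- C1 * z\<^sup>2 - C2 * z))"
    using C1_rate unfolding blasius_gauss_rate_def by auto
  have "(\<lambda>z. exp (- C1 * z\<^sup>2 - C2 * z) / z) \<in> O[at_top](\<lambda>z. exp (- C1 * z\<^sup>2 - C2 * z))"
  proof (rule bigoI[of _ 1])
    show "eventually (\<lambda>z. norm (exp (- C1 * z\<^sup>2 - C2 * z) / z) \<le> 1 * norm (exp (- C1 * z\<^sup>2 - C2 * z))) at_top"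
      using eventually_ge_at_top[of 1] by eventually_elim (simp add: divide_le_eq)
  qed
  then have 1: "(\<lambda>z. 1 - f1 z) \<in> O[at_top](\<lambda>z. exp (- C1 * z\<^sup>2 - C2 * z))"
    using C2(1) landau_o.big_trans bigthetaD1 by blast
  have 2: "f2 \<in> O[at_top](\<lambda>z. exp (- C1 * z\<^sup>2 - C2 * z))" using C2(2) by (rule bigthetaD1)
  have "\<exists>B>0. \<forall>z\<ge>0. 1 - f1 z \<le> B * exp (- (C1 / 2) * z\<^sup>2)"
    by (rule gaussian_bound_of_bigo[OF C1_pos _ 1, of 1]) (simp add: f1_nonneg)
  then obtain A where A: "A > 0" "\<And>z. z \<ge> 0 \<Longrightarrow> 1 - f1 z \<le> A * exp (- (C1 / 2) * z\<^sup>2)" by blast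
  have "\<exists>B>0. \<forall>z\<ge>0. f2 z \<le> B * exp (- (C1 / 2) * z\<^sup>2)"
    by (rule gaussian_bound_of_bigo[OF C1_pos _ 2, of "f2 0"]) (simp add: f2_antimono)
  then obtain B where B: "B > 0" "\<And>z. z \<ge> 0 \<Longrightarrow> f2 z \<le> B * exp (- (C1 / 2) * z\<^sup>2)" by blast
  have "f2 z \<le> (A + B) * exp (- (C1 / 2) * z\<^sup>2) \<and> 1 - f1 z \<le> (A + B) * exp (- (C1 / 2) * z\<^sup>2)"
    if z: "z \<ge> 0" for z
  proof -
    have "A * exp (- (C1 / 2) * z\<^sup>2) \<le> (A + B) * exp (- (C1 / 2) * z\<^sup>2)"
      "B * exp (- (C1 / 2) * z\<^sup>2) \<le> (A + B) * exp (- (C1 / 2) * z\<^sup>2)"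
      using A B by (auto intro!: mult_right_mono)
    then show ?thesis using A(2)[OF z] B(2)[OF z] by linarith
  qed
  moreover have "A + B > 0" "C1 / 2 > 0" using A B C1_pos by auto
  ultimately show ?thesis by blast
qed

text \<open>Constants solve the von Mises equation, so a bound for the datum persists
  downstream.\<close>

lemma u_global_bound: "\<exists>m\<ge>1. \<forall>x\<ge>0. \<forall>y\<ge>0. u x y \<le> m"
proof -
  obtain M where M: "M > 0" "\<And>y. y \<ge> 0 \<Longrightarrow> u 0 y \<le> M"
    using u_bounded[of 1] by auto
  define m where "m = max 1 M"
  have "u x y \<le> m" if xy: "x \<ge> 0" "y \<ge> 0" for x y
  proof -
    have "1 * ((u x y)\<^sup>2 - m\<^sup>2) \<le> 0"
    proof (rule comparison[OF order_refl mises_derivs_const _ _ _ _ _ xy])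
      fix X :: real assume "X > 0"
      then obtain N where N: "N > 0" "\<And>x y. 0 \<le> x \<Longrightarrow> x \<le> X \<Longrightarrow> 0 \<le> y \<Longrightarrow> u x y \<le> N"
        using u_bounded[of X] by auto
      have "1 * ((u x y)\<^sup>2 - m\<^sup>2) \<le> N\<^sup>2" if "0 \<le> x \<and> x \<le> X \<and> y \<ge> 0" for x y
      proof -
        have "(u x y)\<^sup>2 \<le> N\<^sup>2" using N(2)[of x y] u_nonneg[of x y] that by (intro power_mono) auto
        then have "(u x y)\<^sup>2 - m\<^sup>2 \<le> N\<^sup>2" using zero_le_power2[of m] by linarith
        then show ?thesis by simp
      qed
      then show "\<exists>M. \<forall>x y. 0 \<le> x \<and> x \<le> X \<and> y \<ge> 0 \<longrightarrow> 1 * ((u x y)\<^sup>2 - m\<^sup>2) \<le> M" by blast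
    next
      fix y :: real assume "y \<ge> 0"
      then show "1 * ((u 0 y)\<^sup>2 - m\<^sup>2) \<le> 0"
        using M(2)[of y] u_nonneg[of 0 y] by (simp add: m_def power_mono)
    qed auto
    then show ?thesis using power2_le_imp_le[of "u x y" m] by (simp add: m_def)
  qed
  then show ?thesis by (intro exI[of _ m]) (auto simp: m_def)
qed

text \<open>The instance \<open>p = 0\<close>; the exponents \<open>-0\<close> and
  \<open>-0-1\<close> stay unsimplified so that the terms match those of the general self-similar
  lemma.\<close>

lemma mises_derivs_F:
  assumes "b > 0"
  shows "mises_derivs (\<lambda>x y. (x + b) powr (-0) * F (\<eta> b x y))
    (\<lambda>x y. (x + b) powr (-0-1) * (- 0 * F (\<eta> b x y) - \<eta> b x y * dF (\<eta> b x y) / 2))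
    (\<lambda>x y. (x + b) powr (-0) / sqrt (x + b) * dF (\<eta> b x y))
    (\<lambda>x y. (x + b) powr (-0-1) * ddF (\<eta> b x y))"
  by (rule mises_derivs_selfsimilar[OF assms deriv_F deriv_dF])

lemma F_operator:
  assumes "b > 0" "x > 0" "y > 0"
  shows "(x + b) powr (-0-1) * (- 0 * F (\<eta> b x y) - \<eta> b x y * dF (\<eta> b x y) / 2) - r * ((x + b) powr (-0-1) * ddF (\<eta> b x y))
    = (x + b) powr (-1) * (\<eta> b x y * f2 (Z (\<eta> b x y)) / f1 (Z (\<eta> b x y)) * (r - f1 (Z (\<eta> b x y))))"
proof -
  have "p * (- 0 * a - d) - r * (p * g) = p * (- d - r * g)" for p a d g :: real
    by (simp add: algebra_simps)
  then show ?thesis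
    unfolding F_diffusion_sign[OF eta_pos[OF assms(1) less_imp_le[OF assms(2)] assms(3)], of r, symmetric]
    by (simp only: diff_0 minus_zero)
qed

lemma F_operator_factor_nonneg:
  assumes "b > 0" "x > 0" "y > 0"
  shows "(x + b) powr (-1) * (\<eta> b x y * f2 (Z (\<eta> b x y)) / f1 (Z (\<eta> b x y))) \<ge> 0"
  using eta_pos[OF assms(1) less_imp_le[OF assms(2)] assms(3)] f2_Z_pos[of "\<eta> b x y"] f1_Z_pos[of "\<eta> b x y"]
  by simp

lemma u0_deriv: "y \<ge> 0 \<Longrightarrow> (u0 has_real_derivative d1 y) (at y within {0..})"
  and d1_0: "d1 0 > 0"
  using datum unfolding oleinik_datum_def by auto

text \<open>Near 0 the positive slope \<open>d1 0\<close> gives the bound, on the remaining compact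
  interval the positive minimum of \<open>u0\<close>.\<close>

lemma u0_linear_lower: "\<exists>k>0. \<forall>y. 0 \<le> y \<and> y \<le> Y \<longrightarrow> k * y \<le> u0 y"
proof -
  have "u0 0 = 0" using u_initial[of 0] by simp
  then have "((\<lambda>y. u0 y / y) \<longlongrightarrow> d1 0) (at 0 within {0..})"
    using u0_deriv[of 0] unfolding has_field_derivative_iff by simp
  then have "eventually (\<lambda>y. u0 y / y > d1 0 / 2) (at 0 within {0..})"
    using d1_0 by (intro order_tendstoD(1)) auto
  then obtain \<delta> where \<delta>: "\<delta> > 0" "\<And>y. y \<ge> 0 \<Longrightarrow> y \<noteq> 0 \<Longrightarrow> \<bar>y\<bar> < \<delta> \<Longrightarrow> u0 y / y > d1 0 / 2"
    unfolding eventually_at by (auto simp: dist_real_def)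
  have near: "d1 0 / 2 * y \<le> u0 y" if "0 \<le> y" "y < \<delta>" for y
    using \<delta>(2)[of y] that \<open>u0 0 = 0\<close> by (cases "y = 0") (auto simp: field_simps)
  show ?thesis
  proof (cases "\<delta> \<le> Y")
    case False
    then show ?thesis using near d1_0 by (intro exI[of _ "d1 0 / 2"]) auto
  next
    case True
    have "continuous_on {\<delta>..Y} u0"
      using continuous_on_subset[OF halfline_continuous_on[OF u0_deriv], of "{\<delta>..Y}"] \<delta> by auto
    then obtain w where w: "w \<in> {\<delta>..Y}" "\<And>y. y \<in> {\<delta>..Y} \<Longrightarrow> u0 w \<le> u0 y"
      using continuous_attains_inf[of "{\<delta>..Y}" u0] True by auto
    have w0: "u0 w > 0" using u_pos[of 0 w] u_initial[of w] w \<delta> by auto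
    define k where "k = min (d1 0 / 2) (u0 w / Y)"
    have Y: "Y > 0" using True \<delta> by simp
    have "k * y \<le> u0 y" if y: "0 \<le> y \<and> y \<le> Y" for y
    proof (cases "y < \<delta>")
      case T: True
      have "k * y \<le> d1 0 / 2 * y" using y unfolding k_def by (intro mult_right_mono min.cobounded1) auto
      then show ?thesis using near[of y] y T by linarith
    next
      case False
      have "k * y \<le> u0 w / Y * Y" using y w0 Y unfolding k_def by (intro mult_mono min.cobounded2) auto
      also have "\<dots> = u0 w" using Y by simp
      also have "\<dots> \<le> u0 y" using w(2)[of y] False y by auto
      finally show ?thesis .
    qed
    then show ?thesis using w0 Y d1_0 by (intro exI[of _ k]) (auto simp: k_def)
  qed
qed

text \<open>The only place where \<open>C5 > C1\<close> enters.\<close>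

lemma datum_tail: "\<exists>Y\<ge>2. \<forall>y\<ge>Y. 2 * C4 * exp (- C5 * y\<^sup>2) \<le> 1 - f1 y"
proof -
  obtain C2 where C2: "(\<lambda>z. 1 - f1 z) \<in> \<Theta>[at_top](\<lambda>z. exp (- C1 * z\<^sup>2 - C2 * z) / z)"
    using C1_rate unfolding blasius_gauss_rate_def by auto
  then have "(\<lambda>z. exp (- C1 * z\<^sup>2 - C2 * z) / z) \<in> O[at_top](\<lambda>z. 1 - f1 z)"
    using bigthetaD1 bigtheta_sym by blast
  then obtain K where K: "K > 0" "eventually (\<lambda>z. norm (exp (- C1 * z\<^sup>2 - C2 * z) / z) \<le> K * norm (1 - f1 z)) at_top"
    using landau_o.bigE by blast
  then obtain z0 where z0: "\<And>z. z \<ge> z0 \<Longrightarrow> norm (exp (- C1 * z\<^sup>2 - C2 * z) / z) \<le> K * norm (1 - f1 z)"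
    by (auto simp: eventually_at_top_linorder)
  define w where "w = C5 - C1"
  have w: "w > 0" using C5_gt by (simp add: w_def)
  \<comment> \<open>For \<open>y \<ge> L / w\<close> the gain \<open>(C5 - C1) y^2\<close> pays for
    the linear term \<open>C2 y\<close>, for the factor \<open>y \<le> exp y\<close> that clears the
    denominator, and for \<open>2 C4 K \<le> exp (2 C4 K y)\<close>.\<close>
  define L where "L = \<bar>C2\<bar> + 1 + 2 * C4 * K"
  define Y where "Y = max 2 (max z0 (L / w))"
  have "2 * C4 * exp (- C5 * y\<^sup>2) \<le> 1 - f1 y" if y: "y \<ge> Y" for y
  proof -
    have y1: "y \<ge> 2" "y \<ge> z0" "y \<ge> L / w" using y by (auto simp: Y_def)
    have K2: "2 * C4 * K \<le> exp (2 * C4 * K * y)"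
    proof -
      have "2 * C4 * K \<le> 2 * C4 * K * y" using y1 C4_pos K(1) mult_left_mono[of 1 y "2 * C4 * K"] by auto
      also have "\<dots> \<le> exp (2 * C4 * K * y)" using exp_ge_add_one_self[of "2 * C4 * K * y"] by linarith
      finally show ?thesis .
    qed
    have yexp: "y \<le> exp y" using exp_ge_add_one_self[of y] by linarith
    have "L * y \<le> w * y * y" using y1 w by (intro mult_right_mono) (auto simp: field_simps)
    moreover have "C2 * y \<le> \<bar>C2\<bar> * y" using y1 by (intro mult_right_mono) auto
    ultimately have ex: "2 * C4 * K * y + y - C5 * y\<^sup>2 \<le> - C1 * y\<^sup>2 - C2 * y"
      by (simp add: L_def w_def power2_eq_square algebra_simps)
    have "2 * C4 * K * y * exp (- C5 * y\<^sup>2) \<le> exp (2 * C4 * K * y) * exp y * exp (- C5 * y\<^sup>2)"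
      using K2 yexp y1 C4_pos K(1) by (intro mult_right_mono mult_mono) auto
    also have "\<dots> = exp (2 * C4 * K * y + y - C5 * y\<^sup>2)" by (simp add: exp_add exp_diff exp_minus divide_inverse)
    also have "\<dots> \<le> exp (- C1 * y\<^sup>2 - C2 * y)" using ex by simp
    also have "\<dots> \<le> K * (1 - f1 y) * y"
      using z0[OF y1(2)] y1 f1_less_1[of y] by (simp add: field_simps)
    finally have "2 * C4 * exp (- C5 * y\<^sup>2) * (K * y) \<le> (1 - f1 y) * (K * y)" by (simp add: mult_ac)
    then show ?thesis using K(1) y1 by simp
  qed
  then show ?thesis by (intro exI[of _ Y]) (auto simp: Y_def)
qed

text \<open>A large shift \<open>a\<close> flattens the Blasius profile. Near the wall it then lies
  below the linear growth of \<open>u0\<close>; far out, the deficit of the profile dominates that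
  of the datum by \<open>datum_tail\<close>.\<close>

lemma initial_lower: "\<exists>a\<ge>1. \<forall>y\<ge>0. F (\<eta> a 0 y) \<le> (u 0 y)\<^sup>2"
proof -
  obtain m where m: "m \<ge> 1" "\<And>x y. x \<ge> 0 \<Longrightarrow> y \<ge> 0 \<Longrightarrow> u x y \<le> m" using u_global_bound by auto
  obtain Y where Y: "Y \<ge> 2" "\<And>y. y \<ge> Y \<Longrightarrow> 2 * C4 * exp (- C5 * y\<^sup>2) \<le> 1 - f1 y" using datum_tail by auto
  obtain k where k: "k > 0" "\<And>y. 0 \<le> y \<Longrightarrow> y \<le> Y \<Longrightarrow> k * y \<le> u0 y" using u0_linear_lower[of Y] by auto
  obtain M where M: "M > 0" "\<And>y. y \<ge> 0 \<Longrightarrow> \<bar>uy 0 y\<bar> \<le> M" using u_bounded[of 1] by auto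
  define q where "q = f1 1"
  have q: "q > 0" using f1_pos[of 1] by (simp add: q_def)
  have f20: "f2 0 > 0" using f2_pos by simp
  \<comment> \<open>The summand 1 yields \<open>a \<ge> 1\<close>. The second yields
    \<open>Z \<le> 1 + y / 2\<close>, as \<open>\<psi> \<le> m y\<close>; the third yields
    \<open>2 f2 0 M y^2 / r \<le> k^2 y^2\<close>.\<close>
  define r where "r = 1 + 2 * m / q + 2 * f2 0 * M / k\<^sup>2"
  have r: "r \<ge> 1" "r \<ge> 2 * m / q" "r \<ge> 2 * f2 0 * M / k\<^sup>2" using m q f20 M k
    by (auto simp: r_def add_nonneg_nonneg)
  define a where "a = r\<^sup>2"
  have sa: "sqrt a = r" using r by (simp add: a_def)
  have eta: "\<eta> a 0 y = \<psi> 0 y / r" for y by (simp add: \<eta>_def sa)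
  have psi_quad: "\<psi> 0 y \<le> M * y\<^sup>2" if y: "y \<ge> 0" for y
  proof -
    have ul: "u 0 t \<le> M * t" if "t \<ge> 0" for t
    proof (cases "t = 0")
      case False
      then have t0: "0 < t" using that by simp
      obtain z where "0 < z" "z < t" "u 0 t - u 0 0 = (t - 0) * uy 0 z"
        by (rule halfline_MVT[OF deriv_u_y[OF order_refl] order_refl t0])
      then show ?thesis using M(2)[of z] mult_left_mono[of "uy 0 z" M t] that by (auto simp: mult.commute)
    qed simp
    show ?thesis
    proof (cases "y = 0")
      case False
      then have y0: "0 < y" using y by simp
      obtain z where z: "0 < z" "z < y" "\<psi> 0 y - \<psi> 0 0 = (y - 0) * u 0 z"
        by (rule halfline_MVT[OF deriv_psi_y[OF order_refl] order_refl y0])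
      have "M * z \<le> M * y" using z M(1) by (intro mult_left_mono) auto
      then have "u 0 z \<le> M * y" using ul[of z] z by linarith
      then show ?thesis using z y mult_left_mono[of "u 0 z" "M * y" y] by (auto simp: power2_eq_square mult_ac)
    qed simp
  qed
  have "F (\<eta> a 0 y) \<le> (u 0 y)\<^sup>2" if y: "y \<ge> 0" for y
  proof (cases "y \<le> Y")
    case True
    have e0: "\<psi> 0 y / r \<ge> 0" using psi_nonneg[of 0 y] y r by simp
    have "F (\<eta> a 0 y) \<le> 2 * f2 0 * (\<psi> 0 y / r)" unfolding eta by (rule F_upper[OF e0])
    also have "\<dots> \<le> 2 * f2 0 * (M * y\<^sup>2 / r)"
      using psi_quad[OF y] r f20 by (intro mult_left_mono divide_right_mono) auto
    also have "\<dots> = (2 * f2 0 * M) / r * y\<^sup>2" by simp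
    also have "\<dots> \<le> k\<^sup>2 * y\<^sup>2"
    proof (rule mult_right_mono)
      show "2 * f2 0 * M / r \<le> k\<^sup>2" using r k by (simp add: field_simps)
    qed simp
    also have "\<dots> = (k * y)\<^sup>2" by (simp add: power_mult_distrib)
    also have "\<dots> \<le> (u 0 y)\<^sup>2" using k(2)[OF y True] k(1) y u_initial[OF y] by (intro power_mono) auto
    finally show ?thesis .
  next
    case False
    have "\<psi> 0 y \<le> m * y" using psi_diff_le[of 0 0 y m] m y by auto
    then have "\<psi> 0 y / r \<le> m * y / r" using r by (intro divide_right_mono) auto
    also have "\<dots> \<le> q * (y / 2)"
    proof -
      have "m / r \<le> q / 2" using r q m by (simp add: field_simps)
      then have "m / r * y \<le> q / 2 * y" using y by (intro mult_right_mono) auto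
      then show ?thesis by simp
    qed
    finally have "\<eta> a 0 y \<le> y / 2 * q" by (simp add: eta mult.commute)
    then have "\<eta> a 0 y / q \<le> y / 2" by (simp only: pos_divide_le_eq[OF q])
    moreover have e0: "\<eta> a 0 y \<ge> 0" using psi_nonneg[of 0 y] y r by (simp add: eta)
    \<comment> \<open>\<open>1 + y / 2 \<le> y\<close> is where \<open>Y \<ge> 2\<close>
      enters.\<close>
    ultimately have "Z (\<eta> a 0 y) \<le> y" using Z_le[OF e0, folded q_def] False Y(1) by linarith
    then have fy: "f1 (Z (\<eta> a 0 y)) \<le> f1 y" using Z_nonneg[OF e0] by (intro f1_mono)
    \<comment> \<open>\<open>F = f1^2 \<le> f1\<close> on one side and
      \<open>u0^2 \<ge> 1 - 2 |u0 - 1|\<close> on the other: this accounts for the factor 2 in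
      \<open>datum_tail\<close>.\<close>
    have "F (\<eta> a 0 y) \<le> f1 y"
      unfolding F_def power2_eq_square
      using fy f1_Z_nonneg[OF e0] f1_Z_less_1[OF e0] mult_mono[of "f1 (Z (\<eta> a 0 y))" 1 "f1 (Z (\<eta> a 0 y))" "f1 y"] by auto
    also have "\<dots> \<le> 1 - 2 * C4 * exp (- C5 * y\<^sup>2)" using Y(2)[of y] False by simp
    also have "\<dots> \<le> 1 - 2 * \<bar>u0 y - 1\<bar>" using decay y by simp
    also have "\<dots> \<le> 1 + 2 * (u0 y - 1)"
    proof -
      have "1 - 2 * \<bar>t\<bar> \<le> 1 + 2 * t" for t :: real by linarith
      then show ?thesis .
    qed
    also have "\<dots> \<le> (u0 y)\<^sup>2"
      using zero_le_power2[of "u0 y - 1"] by (simp add: power2_eq_square algebra_simps)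
    finally show ?thesis using u_initial[OF y] by simp
  qed
  moreover have "a \<ge> 1" using r by (simp add: a_def one_le_power)
  ultimately show ?thesis by (intro exI[of _ a]) auto
qed

text \<open>Comparison with sign \<open>-1\<close>: a violation means \<open>u < f1 (Z ...)\<close>,
  which is where \<open>F\<close> is a subsolution by \<open>F_diffusion_sign\<close>.\<close>

lemma mises_lower: "\<exists>a\<ge>1. \<forall>x\<ge>0. \<forall>y\<ge>0. F (\<eta> a x y) \<le> (u x y)\<^sup>2"
proof -
  obtain a where a: "a \<ge> 1" "\<And>y. y \<ge> 0 \<Longrightarrow> F (\<eta> a 0 y) \<le> (u 0 y)\<^sup>2" using initial_lower by auto
  have a0: "a > 0" using a by simp
  have one: "(x + a) powr (-0) * w = w" if "x \<ge> 0" for x w using that a0 by simp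
  have "F (\<eta> a x y) \<le> (u x y)\<^sup>2" if xy: "x \<ge> 0" "y \<ge> 0" for x y
  proof -
    have "-1 * ((u x y)\<^sup>2 - (x + a) powr (-0) * F (\<eta> a x y)) \<le> 0"
    proof (rule comparison[OF order_refl mises_derivs_F[OF a0] _ _ _ _ _ xy])
      show "continuous_on ({0..} \<times> {0..}) (\<lambda>p. (fst p + a) powr (-0) * F (\<eta> a (fst p) (snd p)))"
        by (rule continuous_selfsimilar[OF a0 continuous_F])
      fix X :: real
      have "-1 * ((u x y)\<^sup>2 - (x + a) powr (-0) * F (\<eta> a x y)) \<le> 1" if "0 \<le> x \<and> x \<le> X \<and> y \<ge> 0" for x y
      proof -
        have x: "0 \<le> x" and y: "0 \<le> y" using that by auto
        have "F (\<eta> a x y) - (u x y)\<^sup>2 \<le> 1"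
          using F_less_1[OF eta_nonneg[OF a0 x y]] zero_le_power2[of "u x y"] by linarith
        then show ?thesis unfolding one[OF x] by simp
      qed
      then show "\<exists>M. \<forall>x y. 0 \<le> x \<and> x \<le> X \<and> y \<ge> 0 \<longrightarrow> -1 * ((u x y)\<^sup>2 - (x + a) powr (-0) * F (\<eta> a x y)) \<le> M" by blast
    next
      fix y :: real assume "y \<ge> 0"
      then show "-1 * ((u 0 y)\<^sup>2 - (0 + a) powr (-0) * F (\<eta> a 0 y)) \<le> 0" using a(2)[of y] a0 by simp
    next
      fix x y :: real assume x: "x > 0" and y: "y > 0" and pos: "-1 * ((u x y)\<^sup>2 - (x + a) powr (-0) * F (\<eta> a x y)) > 0"
      have "(u x y)\<^sup>2 < (f1 (Z (\<eta> a x y)))\<^sup>2" using pos unfolding one[OF less_imp_le[OF x]] by (simp add: F_def)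
      then have "u x y < f1 (Z (\<eta> a x y))"
        using power2_less_imp_less f1_Z_nonneg[OF eta_nonneg[OF a0, of x y]] x y by simp
      then show "-1 * ((x + a) powr (-0-1) * (- 0 * F (\<eta> a x y) - \<eta> a x y * dF (\<eta> a x y) / 2)
          - u x y * ((x + a) powr (-0-1) * ddF (\<eta> a x y))) \<ge> 0"
        unfolding F_operator[OF a0 x y]
        using mult_nonneg_nonpos[OF F_operator_factor_nonneg[OF a0 x y], of "u x y - f1 (Z (\<eta> a x y))"]
        by (simp only: mult.assoc) simp
    qed simp
    then show ?thesis unfolding one[OF xy(1)] by simp
  qed
  then show ?thesis using a by auto
qed

section \<open>Comparison of streamlines\<close>

lemma deriv_eta_y:
  "b > 0 \<Longrightarrow> x \<ge> 0 \<Longrightarrow> y > 0 \<Longrightarrow> (\<eta> b x has_real_derivative u x y / sqrt (x + b)) (at y)"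
  unfolding \<eta>_def[abs_def]
  by (intro DERIV_cdivide has_real_derivative_at_of_halfline[OF deriv_psi_y]) auto

lemma continuous_eta_y: "b > 0 \<Longrightarrow> x \<ge> 0 \<Longrightarrow> continuous_on {0..} (\<eta> b x)"
  unfolding \<eta>_def[abs_def]
  by (intro continuous_on_divide halfline_continuous_on[OF deriv_psi_y] continuous_on_const) auto

text \<open>The height at which the Blasius flow with shift \<open>b\<close> carries the stream
  function value \<open>\<psi> x y\<close>.\<close>

definition T :: "real \<Rightarrow> real \<Rightarrow> real \<Rightarrow> real" where
  "T b x y = sqrt (x + b) * Z (\<eta> b x y)"

lemma deriv_T:
  assumes "b > 0" "x \<ge> 0" "y > 0"
  shows "(T b x has_real_derivative u x y / f1 (Z (\<eta> b x y))) (at y)"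
  unfolding T_def[abs_def]
  by (rule DERIV_cong[OF DERIV_cmult[OF DERIV_chain2[OF deriv_Z[OF eta_pos[OF assms]] deriv_eta_y[OF assms]]]])
    (use assms in \<open>simp add: divide_inverse\<close>)

lemma continuous_T: "b > 0 \<Longrightarrow> x \<ge> 0 \<Longrightarrow> continuous_on {0..} (T b x)"
  unfolding T_def[abs_def]
  by (intro continuous_on_mult continuous_on_const continuous_on_compose2[OF continuous_Z continuous_eta_y]) auto

text \<open>\<open>u \<ge> f1 (Z ...)\<close> makes the derivative \<open>u / f1 (Z ...)\<close> of
  \<open>T a x\<close> at least 1, so the streamline lies higher in the Blasius flow:
  \<open>T a x y \<ge> y\<close>. Monotonicity of \<open>f1\<close> and \<open>f\<close> then gives
  both claims; the second one later converts decay in \<open>\<eta>\<close> into decay in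
  \<open>y\<close>.\<close>

lemma physical_lower:
  "\<exists>a\<ge>1. \<forall>x\<ge>0. \<forall>y\<ge>0. f1 (y / sqrt (x + a)) \<le> u x y \<and> f (y / sqrt (x + a)) \<le> \<eta> 1 x y"
proof -
  obtain a where a: "a \<ge> 1" "\<And>x y. x \<ge> 0 \<Longrightarrow> y \<ge> 0 \<Longrightarrow> F (\<eta> a x y) \<le> (u x y)\<^sup>2" using mises_lower by auto
  have a0: "a > 0" using a by simp
  have "f1 (y / sqrt (x + a)) \<le> u x y \<and> f (y / sqrt (x + a)) \<le> \<eta> 1 x y" if x: "x \<ge> 0" and y: "y \<ge> 0" for x y
  proof -
    have uf: "f1 (Z (\<eta> a x t)) \<le> u x t" if "t \<ge> 0" for t
      using a(2)[OF x that] u_nonneg[OF x that] power2_le_imp_le[of "f1 (Z (\<eta> a x t))"] by (simp add: F_def)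
    have "T a x 0 - 0 \<le> T a x y - y"
    proof (rule DERIV_nonneg_imp_increasing_open[OF y])
      fix t assume t: "0 < t" "t < y"
      have "((\<lambda>t. T a x t - t) has_real_derivative u x t / f1 (Z (\<eta> a x t)) - 1) (at t)"
        by (intro DERIV_diff deriv_T DERIV_ident a0 x t)
      moreover have "u x t / f1 (Z (\<eta> a x t)) - 1 \<ge> 0"
        using uf[of t] f1_Z_pos[OF eta_pos[OF a0 x t(1)]] t by (simp add: field_simps)
      ultimately show "\<exists>d. ((\<lambda>t. T a x t - t) has_real_derivative d) (at t) \<and> 0 \<le> d" by blast
    next
      show "continuous_on {0..y} (\<lambda>t. T a x t - t)"
        by (intro continuous_on_diff continuous_on_id continuous_on_subset[OF continuous_T[OF a0 x]]) auto
    qed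
    then have "y \<le> sqrt (x + a) * Z (\<eta> a x y)" by (simp add: T_def)
    then have Zy: "y / sqrt (x + a) \<le> Z (\<eta> a x y)" using a0 x by (simp add: field_simps)
    have e0: "\<eta> a x y \<ge> 0" using eta_nonneg a0 x y by simp
    have y0: "y / sqrt (x + a) \<ge> 0" using y x a0 by simp
    have "f (y / sqrt (x + a)) \<le> \<eta> a x y" using f_mono[OF y0 Zy] f_Z[OF e0] by simp
    also have "\<dots> \<le> \<eta> 1 x y" unfolding \<eta>_def using psi_nonneg[OF x y] a x by (intro divide_left_mono) auto
    finally show ?thesis using f1_mono[OF y0 Zy] uf[OF y] by simp
  qed
  then show ?thesis using a by auto
qed


subsection \<open>Upper bound in von Mises variables\<close>

lemma upper_comparison:
  fixes h h1 h2 :: "real \<Rightarrow> real"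
  assumes X0: "X0 \<ge> 0" and K: "K \<ge> 0"
    and h: "\<And>e. e > 0 \<Longrightarrow> (h has_real_derivative h1 e) (at e)"
    and h1: "\<And>e. e > 0 \<Longrightarrow> (h1 has_real_derivative h2 e) (at e)"
    and cont: "continuous_on {0..} h" and nonneg: "\<And>e. e \<ge> 0 \<Longrightarrow> h e \<ge> 0"
    and init: "\<And>y. y \<ge> 0 \<Longrightarrow> (u X0 y)\<^sup>2 \<le> F (\<eta> 1 X0 y) + K * ((X0 + 1) powr (-p) * h (\<eta> 1 X0 y))"
    and super: "\<And>x y. x > X0 \<Longrightarrow> y > 0 \<Longrightarrow> f1 (Z (\<eta> 1 x y)) \<le> u x y \<Longrightarrow>
       - p * h (\<eta> 1 x y) - \<eta> 1 x y * h1 (\<eta> 1 x y) / 2 - u x y * h2 (\<eta> 1 x y) \<ge> 0"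
    and xy: "x \<ge> X0" "y \<ge> 0"
  shows "(u x y)\<^sup>2 \<le> F (\<eta> 1 x y) + K * ((x + 1) powr (-p) * h (\<eta> 1 x y))"
proof -
  obtain m where m: "m \<ge> 1" "\<And>x y. x \<ge> 0 \<Longrightarrow> y \<ge> 0 \<Longrightarrow> u x y \<le> m" using u_global_bound by auto
  have one: "(x + 1) powr (-0) * w = w" if "x \<ge> 0" for x w :: real using that by simp
  define \<Omega> where "\<Omega> x y = (x + 1) powr (-0) * F (\<eta> 1 x y) + K * ((x + 1) powr (-p) * h (\<eta> 1 x y))" for x y
  have \<Omega>: "\<Omega> x y = F (\<eta> 1 x y) + K * ((x + 1) powr (-p) * h (\<eta> 1 x y))" if "x \<ge> 0" for x y
    unfolding \<Omega>_def one[OF that] ..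
  have \<Omega>0: "\<Omega> x y \<ge> F (\<eta> 1 x y)" if "x \<ge> 0" "y \<ge> 0" for x y
    using \<Omega>[OF that(1)] K nonneg[OF eta_nonneg[of 1 x y]] that by simp
  have derivs: "mises_derivs \<Omega>
    (\<lambda>x y. (x + 1) powr (-0-1) * (- 0 * F (\<eta> 1 x y) - \<eta> 1 x y * dF (\<eta> 1 x y) / 2)
      + K * ((x + 1) powr (-p-1) * (- p * h (\<eta> 1 x y) - \<eta> 1 x y * h1 (\<eta> 1 x y) / 2)))
    (\<lambda>x y. (x + 1) powr (-0) / sqrt (x + 1) * dF (\<eta> 1 x y) + K * ((x + 1) powr (-p) / sqrt (x + 1) * h1 (\<eta> 1 x y)))
    (\<lambda>x y. (x + 1) powr (-0-1) * ddF (\<eta> 1 x y) + K * ((x + 1) powr (-p-1) * h2 (\<eta> 1 x y)))"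
    unfolding \<Omega>_def[abs_def]
    by (rule mises_derivs_add[OF mises_derivs_F[OF zero_less_one] mises_derivs_selfsimilar[OF zero_less_one h h1]])
  have "1 * ((u x y)\<^sup>2 - \<Omega> x y) \<le> 0"
  proof (rule comparison[OF X0 derivs _ _ _ _ _ xy])
    show "continuous_on ({X0..} \<times> {0..}) (\<lambda>q. \<Omega> (fst q) (snd q))"
      unfolding \<Omega>_def
      by (intro continuous_on_add continuous_on_mult_left
          continuous_on_subset[OF continuous_selfsimilar[OF zero_less_one continuous_F]]
          continuous_on_subset[OF continuous_selfsimilar[OF zero_less_one cont]])
        (use X0 in auto)
    fix X :: real
    have "1 * ((u x y)\<^sup>2 - \<Omega> x y) \<le> m\<^sup>2" if "X0 \<le> x \<and> x \<le> X \<and> y \<ge> 0" for x y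
    proof -
      have p: "x \<ge> 0" "y \<ge> 0" using that X0 by auto
      have "(u x y)\<^sup>2 \<le> m\<^sup>2" using m(2)[OF p] u_nonneg[OF p] by (intro power_mono) auto
      then have "(u x y)\<^sup>2 - \<Omega> x y \<le> m\<^sup>2" using \<Omega>0[OF p] F_nonneg[of "\<eta> 1 x y"] by linarith
      then show ?thesis by simp
    qed
    then show "\<exists>M. \<forall>x y. X0 \<le> x \<and> x \<le> X \<and> y \<ge> 0 \<longrightarrow> 1 * ((u x y)\<^sup>2 - \<Omega> x y) \<le> M" by blast
  next
    fix y :: real assume "y \<ge> 0"
    then show "1 * ((u X0 y)\<^sup>2 - \<Omega> X0 y) \<le> 0" using init[of y] \<Omega>[OF X0, of y] by simp
  next
    fix x :: real assume "x \<ge> X0"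
    then show "1 * (- \<Omega> x 0) \<le> 0" using \<Omega>0[of x 0] X0 by simp
  next
    fix x y assume x: "x > X0" and y: "y > 0" and pos: "1 * ((u x y)\<^sup>2 - \<Omega> x y) > 0"
    have x0: "x > 0" using x X0 by simp
    have "(f1 (Z (\<eta> 1 x y)))\<^sup>2 \<le> (u x y)\<^sup>2" using pos \<Omega>0[of x y] x0 y by (simp add: F_def)
    then have fu: "f1 (Z (\<eta> 1 x y)) \<le> u x y" using u_nonneg[of x y] x0 y power2_le_imp_le by simp
    let ?e = "\<eta> 1 x y"
    have "(x + 1) powr (-1) * (?e * f2 (Z ?e) / f1 (Z ?e) * (u x y - f1 (Z ?e))) \<ge> 0"
      using mult_nonneg_nonneg[OF F_operator_factor_nonneg[OF zero_less_one x0 y], of "u x y - f1 (Z ?e)"] fu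
      by (simp only: mult.assoc)
    then have 1: "(x + 1) powr (-0-1) * (- 0 * F ?e - ?e * dF ?e / 2) - u x y * ((x + 1) powr (-0-1) * ddF ?e) \<ge> 0"
      unfolding F_operator[OF zero_less_one x0 y] .
    have 2: "(x + 1) powr (-p-1) * (- p * h ?e - ?e * h1 ?e / 2 - u x y * h2 ?e) \<ge> 0"
      using super[OF x y fu] by simp
    have "1 * ((A + K * (w * a)) - r * (D + K * (w * d))) = (A - r * D) + K * (w * (a - r * d))"
      for A w a r D d :: real by (simp add: algebra_simps)
    then show "1 * ((x + 1) powr (-0-1) * (- 0 * F ?e - ?e * dF ?e / 2) + K * ((x + 1) powr (-p-1) * (- p * h ?e - ?e * h1 ?e / 2))
       - u x y * ((x + 1) powr (-0-1) * ddF ?e + K * ((x + 1) powr (-p-1) * h2 ?e))) \<ge> 0"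
      using 1 mult_nonneg_nonneg[OF K 2] by (simp only:)
  qed
  then show ?thesis using \<Omega>[of x y] X0 xy by simp
qed

lemma excess_decays_slowly:
  "\<exists>m c s K. m \<ge> 1 \<and> c > 0 \<and> 8 * c * m \<le> 1 \<and> 0 < s \<and> s \<le> 1/2 \<and> K > 0 \<and>
    (\<forall>x\<ge>0. \<forall>y\<ge>0. u x y \<le> m \<and>
      (u x y)\<^sup>2 \<le> F (\<eta> 1 x y) + K * ((x + 1) powr (- (s/2)) * power_gauss s c (\<eta> 1 x y)))"
proof -
  obtain m where m: "m \<ge> 1" "\<And>x y. x \<ge> 0 \<Longrightarrow> y \<ge> 0 \<Longrightarrow> u x y \<le> m" using u_global_bound by auto
  obtain B \<beta> where B: "B > 0" "\<beta> > 0" "\<And>z. z \<ge> 0 \<Longrightarrow> 1 - f1 z \<le> B * exp (- \<beta> * z\<^sup>2)"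
    using profile_tails by auto
  obtain M where M: "M > 0" "\<And>y. y \<ge> 0 \<Longrightarrow> \<bar>uy 0 y\<bar> \<le> M" using u_bounded[of 1] by auto
  \<comment> \<open>Three demands: \<open>8 c m \<le> 1\<close> for the barrier,
    \<open>c e^2 \<le> C5 y^2\<close> for the datum (as \<open>e \<le> m y\<close>), and
    \<open>c \<le> \<beta>\<close> for the profile tail (as \<open>e \<le> Z e\<close>).\<close>
  define c where "c = min (1 / (8 * m)) (min (C5 / m\<^sup>2) \<beta>)"
  have c: "c > 0" using m C5_pos B by (simp add: c_def)
  have cm: "c \<le> 1 / (8 * m)" "c \<le> C5 / m\<^sup>2" "c \<le> \<beta>" unfolding c_def by auto
  have c8: "8 * c * m \<le> 1" using cm(1) m by (simp add: field_simps)
  define k where "k = min 4 (2 * f2 (Z 1))"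
  have k: "0 < k" "k \<le> 4" "k \<le> 2 * f2 (Z 1)" using f2_Z_pos[of 1] by (auto simp: k_def)
  define s where "s = min (1/2) (c * (k / 4)\<^sup>2 / 2)"
  have s: "0 < s" "s \<le> 1/2" and sk: "2 * s \<le> c * (k / 4)\<^sup>2" using c k by (auto simp: s_def)
  \<comment> \<open>One summand each for the datum tail, the profile tail and the layer
    \<open>e \<le> 1\<close>, where \<open>exp c\<close> undoes the Gaussian.\<close>
  define K where "K = (m + 1) * C4 + 2 * B + 2 * M * exp c"
  have K0: "K > 0" using m C4_pos B M by (simp add: K_def add_pos_pos)
  have init: "(u 0 y)\<^sup>2 \<le> F (\<eta> 1 0 y) + K * ((0 + 1) powr (- (s/2)) * power_gauss s c (\<eta> 1 0 y))" if y: "y \<ge> 0" for y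
  proof -
    define e where "e = \<eta> 1 0 y"
    have e: "e \<ge> 0" using eta_nonneg[of 1 0 y] y by (simp add: e_def)
    have ep: "\<psi> 0 y = e" by (simp add: e_def \<eta>_def)
    have "(u 0 y)\<^sup>2 - F e \<le> K * power_gauss s c e"
    proof (cases "e \<le> 1")
      case True
      have "(u 0 y)\<^sup>2 - F e \<le> 2 * M * e" using u_square_le_psi[of 0 y M] M(2) y F_nonneg[of e] ep by (fastforce simp: abs_le_iff)
      also have "\<dots> \<le> 2 * M * e powr s"
        using powr_mono'[of s 1 e] e True s M(1) by (intro mult_left_mono) auto
      also have "\<dots> \<le> 2 * M * exp c * power_gauss s c e"
      proof -
        have "e\<^sup>2 \<le> 1" using e True by (simp add: power_le_one)
        then have "1 \<le> exp c * exp (- c * e\<^sup>2)" using c by (simp add: exp_add[symmetric])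
        then have "2 * M * e powr s * 1 \<le> 2 * M * e powr s * (exp c * exp (- c * e\<^sup>2))" using M by (intro mult_left_mono) auto
        then show ?thesis by (simp add: power_gauss_def mult_ac)
      qed
      also have "\<dots> \<le> K * power_gauss s c e"
        using m C4_pos B by (intro mult_right_mono) (auto simp: K_def power_gauss_def)
      finally show ?thesis .
    next
      case False
      have "e \<le> m * y" using psi_diff_le[of 0 0 y m] m y ep by auto
      then have "e\<^sup>2 \<le> m\<^sup>2 * y\<^sup>2" using e power_mono[of e "m * y" 2] by (simp add: power_mult_distrib)
      then have "C5 / m\<^sup>2 * e\<^sup>2 \<le> C5 / m\<^sup>2 * (m\<^sup>2 * y\<^sup>2)" using C5_pos by (intro mult_left_mono) auto
      also have "\<dots> = C5 * y\<^sup>2" using m by simp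
      finally have "c * e\<^sup>2 \<le> C5 * y\<^sup>2" using mult_right_mono[OF cm(2), of "e\<^sup>2"] by simp
      then have "C4 * exp (- C5 * y\<^sup>2) \<le> C4 * exp (- c * e\<^sup>2)" using C4_pos by simp
      then have "\<bar>u 0 y - 1\<bar> \<le> C4 * exp (- c * e\<^sup>2)" using decay y u_initial[OF y] by fastforce
      then have "(m + 1) * \<bar>u 0 y - 1\<bar> \<le> (m + 1) * (C4 * exp (- c * e\<^sup>2))" using m by (intro mult_left_mono) auto
      moreover have "(u 0 y)\<^sup>2 - 1 \<le> (m + 1) * \<bar>u 0 y - 1\<bar>"
      proof -
        have "(u 0 y)\<^sup>2 - 1 = (u 0 y + 1) * (u 0 y - 1)" by (simp add: power2_eq_square algebra_simps)
        also have "\<dots> \<le> (u 0 y + 1) * \<bar>u 0 y - 1\<bar>" using u_nonneg[of 0 y] y by (intro mult_left_mono) auto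
        also have "\<dots> \<le> (m + 1) * \<bar>u 0 y - 1\<bar>" using m(2)[of 0 y] y by (intro mult_right_mono) auto
        finally show ?thesis .
      qed
      ultimately have 1: "(u 0 y)\<^sup>2 - 1 \<le> (m + 1) * (C4 * exp (- c * e\<^sup>2))" by linarith
      have 2: "1 - F e \<le> 2 * B * exp (- c * e\<^sup>2)"
      proof -
        define a where "a = f1 (Z e)"
        have "2 * a \<le> 1 + a\<^sup>2" using zero_le_power2[of "a - 1"] by (simp add: power2_eq_square algebra_simps)
        then have "1 - F e \<le> 2 * (1 - a)" by (simp add: F_def a_def)
        also have "\<dots> \<le> 2 * (B * exp (- \<beta> * (Z e)\<^sup>2))" using B(3)[OF Z_nonneg[OF e]] by (simp add: a_def)
        also have "\<dots> \<le> 2 * (B * exp (- c * e\<^sup>2))"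
        proof -
          have "e\<^sup>2 \<le> (Z e)\<^sup>2" using Z_ge[OF e] e by (intro power_mono) auto
          then have "c * e\<^sup>2 \<le> \<beta> * (Z e)\<^sup>2" using cm(3) c by (intro mult_mono) auto
          then show ?thesis using B by simp
        qed
        finally show ?thesis by simp
      qed
      have "(u 0 y)\<^sup>2 - F e \<le> ((m + 1) * C4 + 2 * B) * exp (- c * e\<^sup>2)"
        using 1 2 by (simp add: algebra_simps)
      also have "\<dots> \<le> K * power_gauss s c e" unfolding power_gauss_def
      proof (intro mult_mono)
        show "(m + 1) * C4 + 2 * B \<le> K" using M by (simp add: K_def)
        have "1 \<le> e powr s" using False s by (simp add: ge_one_powr_ge_zero)
        then show "exp (- c * e\<^sup>2) \<le> e powr s * exp (- c * e\<^sup>2)" by simp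
      qed (use K0 in auto)
      finally show ?thesis .
    qed
    then show ?thesis by (simp add: e_def)
  qed
  have "(u x y)\<^sup>2 \<le> F (\<eta> 1 x y) + K * ((x + 1) powr (- (s/2)) * power_gauss s c (\<eta> 1 x y))"
    if xy: "x \<ge> 0" "y \<ge> 0" for x y
  proof (rule upper_comparison[OF order_refl less_imp_le[OF K0] deriv_power_gauss(1) deriv_power_gauss(2)
        continuous_power_gauss[OF s(1)] _ init _ xy])
    show "power_gauss s c e \<ge> 0" for e by (simp add: power_gauss_def)
    fix x y :: real assume x: "x > 0" and y: "y > 0" and fu: "f1 (Z (\<eta> 1 x y)) \<le> u x y"
    let ?e = "\<eta> 1 x y"
    have e: "?e > 0" using eta_pos[of 1 x y] x y by simp
    have "0 \<le> u x y" "u x y \<le> m" using u_nonneg[of x y] m(2)[of x y] x y by auto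
    moreover have "k * ?e \<le> (u x y)\<^sup>2" if "?e \<le> 1"
    proof -
      have "k * ?e \<le> 2 * f2 (Z 1) * ?e" using k e by (intro mult_right_mono) auto
      also have "\<dots> \<le> F ?e" using F_lower[of ?e 1] e that by simp
      also have "\<dots> \<le> (u x y)\<^sup>2" unfolding F_def using fu f1_Z_nonneg[of ?e] e by (intro power_mono) auto
      finally show ?thesis .
    qed
    ultimately show "- (s/2) * power_gauss s c ?e - ?e * ((s / ?e - 2 * c * ?e) * power_gauss s c ?e) / 2
      - u x y * (((s / ?e - 2 * c * ?e)\<^sup>2 - s / ?e\<^sup>2 - 2 * c) * power_gauss s c ?e) \<ge> 0"
      using m by (intro power_gauss_supersolution[OF e s _ c c8 k(1,2) sk]) auto
  qed
  then show ?thesis using m c c8 s K0 by blast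
qed

text \<open>Beyond some \<open>X0\<close> the first barrier is below
  \<open>\<epsilon> * power_gauss s c\<close>, so the smallness required by
  \<open>combined_supersolution\<close> holds from there on. The comparison is restarted at
  \<open>X0\<close> with exponent 1/2.\<close>

lemma excess_decays_like_sqrt:
  "\<exists>X0\<ge>0. \<exists>K>0. \<exists>c>0. \<forall>x\<ge>X0. \<forall>y\<ge>0.
      (u x y)\<^sup>2 \<le> F (\<eta> 1 x y) + K / sqrt (x + 1) * (\<eta> 1 x y * exp (- c * (\<eta> 1 x y)\<^sup>2))"
proof -
  obtain m c s K1 where m: "m \<ge> 1" and c: "c > 0" "8 * c * m \<le> 1" and s: "0 < s" "s \<le> 1/2" and K1: "K1 > 0"
    and um: "\<And>x y. x \<ge> 0 \<Longrightarrow> y \<ge> 0 \<Longrightarrow> u x y \<le> m"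
    and st1: "\<And>x y. x \<ge> 0 \<Longrightarrow> y \<ge> 0 \<Longrightarrow> (u x y)\<^sup>2 \<le> F (\<eta> 1 x y) + K1 * ((x + 1) powr (- (s/2)) * power_gauss s c (\<eta> 1 x y))"
    using excess_decays_slowly by blast
  obtain B \<beta> where B: "B > 0" "\<beta> > 0" "\<And>z. z \<ge> 0 \<Longrightarrow> f2 z \<le> B * exp (- \<beta> * z\<^sup>2)"
    using profile_tails by auto
  obtain \<epsilon> where \<epsilon>: "\<epsilon> > 0" "\<And>e r. e > 0 \<Longrightarrow> f1 (Z e) \<le> r \<Longrightarrow> r\<^sup>2 - F e \<le> \<epsilon> * power_gauss s c e \<Longrightarrow>
    (r - f1 (Z e)) * (e\<^sup>2 - 5 * f1 (Z e)) \<le> (f1 (Z e))\<^sup>2 / 2"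
    using small_excess_absorbed[OF c(1) s(1)] s by auto
  have "((\<lambda>x::real. (x + 1) powr (- (s/2))) \<longlongrightarrow> 0) at_top"
    using s by (intro tendsto_neg_powr filterlim_tendsto_add_at_top[OF tendsto_const filterlim_ident, of 1, simplified add.commute]) auto
  then have "((\<lambda>x::real. K1 * (x + 1) powr (- (s/2))) \<longlongrightarrow> K1 * 0) at_top" by (intro tendsto_mult tendsto_const)
  then have "eventually (\<lambda>x::real. K1 * (x + 1) powr (- (s/2)) < \<epsilon>) at_top"
    using \<epsilon>(1) by (intro order_tendstoD(2)) auto
  then obtain X1 where X1: "\<And>x::real. x \<ge> X1 \<Longrightarrow> K1 * (x + 1) powr (- (s/2)) < \<epsilon>"
    by (auto simp: eventually_at_top_linorder)
  define X0 where "X0 = max X1 0"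
  have X0: "X0 \<ge> 0" "\<And>x. x \<ge> X0 \<Longrightarrow> K1 * (x + 1) powr (- (s/2)) \<le> \<epsilon>" using X1 by (auto simp: X0_def less_imp_le)
  obtain M where M: "M > 0" "\<And>y. y \<ge> 0 \<Longrightarrow> \<bar>uy X0 y\<bar> \<le> M" using u_bounded[of "X0 + 1"] X0 by auto
  define L where "L = 8 / f2 (Z (sqrt (2 / c)))"
  have L: "L > 0" using f2_Z_pos[of "sqrt (2 / c)"] c by (simp add: L_def)
  define h where "h e = power_gauss 1 c e + L * G1 e" for e
  \<comment> \<open>The last factor cancels the weight \<open>(X0 + 1) powr (- (1/2))\<close> at the
    restart; the \<open>sqrt (X0 + 1)\<close> inside comes from
    \<open>\<psi> = e * sqrt (X0 + 1)\<close>.\<close>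
  define K where "K = (K1 + 2 * M * sqrt (X0 + 1) * exp c) * sqrt (X0 + 1)"
  have sq: "sqrt (X0 + 1) > 0" using X0 by simp
  have K: "K > 0" using K1 M sq unfolding K_def by (intro mult_pos_pos add_pos_pos) auto
  have G1pos: "G1 e \<ge> 0" if "e \<ge> 0" for e using that f2_Z_pos[of e] by (simp add: G1_def)
  have pw: "(x + 1) powr (- (1/2)) = 1 / sqrt (x + 1)" if "x \<ge> 0" for x :: real
    using that powr_half_sqrt[of "x + 1"] by (simp only: powr_minus_divide)
  have init: "(u X0 y)\<^sup>2 \<le> F (\<eta> 1 X0 y) + K * ((X0 + 1) powr (- (1/2)) * h (\<eta> 1 X0 y))" if y: "y \<ge> 0" for y
  proof -
    define e where "e = \<eta> 1 X0 y"
    have e: "e \<ge> 0" using eta_nonneg[of 1 X0 y] y X0 by (simp add: e_def)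
    have ep: "\<psi> X0 y = e * sqrt (X0 + 1)" using sq by (simp add: e_def \<eta>_def)
    have "(u X0 y)\<^sup>2 - F e \<le> (K1 + 2 * M * sqrt (X0 + 1) * exp c) * power_gauss 1 c e"
    proof (cases "e \<le> 1")
      case True
      \<comment> \<open>Near the wall the first barrier behaves like \<open>e powr s\<close>, which
        no multiple of \<open>e\<close> dominates; the bound on \<open>uy\<close> at
        \<open>X0\<close> replaces it.\<close>
      have "(u X0 y)\<^sup>2 \<le> 2 * M * \<psi> X0 y" using u_square_le_psi[of X0 y M] M(2) y X0 by (simp add: abs_le_iff)
      then have "(u X0 y)\<^sup>2 - F e \<le> 2 * M * sqrt (X0 + 1) * e * 1" using F_nonneg[of e] ep by (simp add: mult_ac)
      also have "\<dots> \<le> 2 * M * sqrt (X0 + 1) * e * (exp c * exp (- c * e\<^sup>2))"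
      proof (intro mult_left_mono)
        have "e\<^sup>2 \<le> 1" using e True by (simp add: power_le_one)
        then show "1 \<le> exp c * exp (- c * e\<^sup>2)" using c by (simp add: exp_add[symmetric])
      qed (use M sq e in auto)
      also have "\<dots> = (2 * M * sqrt (X0 + 1) * exp c) * power_gauss 1 c e" using e by (simp add: power_gauss_def)
      also have "\<dots> \<le> (K1 + 2 * M * sqrt (X0 + 1) * exp c) * power_gauss 1 c e"
        using K1 by (intro mult_right_mono) (auto simp: power_gauss_def)
      finally show ?thesis .
    next
      case False
      have "(u X0 y)\<^sup>2 - F e \<le> K1 * ((X0 + 1) powr (- (s/2)) * power_gauss s c e)"
        using st1[OF X0(1) y] by (simp add: e_def)
      also have "\<dots> \<le> K1 * (1 * power_gauss 1 c e)"
      proof (intro mult_left_mono mult_mono)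
        show "(X0 + 1) powr (- (s/2)) \<le> 1" using X0 s powr_mono[of "- (s/2)" 0 "X0 + 1"] by simp
        show "power_gauss s c e \<le> power_gauss 1 c e"
          unfolding power_gauss_def using False s powr_mono[of s 1 e] by (intro mult_right_mono) auto
      qed (use K1 in \<open>auto simp: power_gauss_def\<close>)
      also have "\<dots> \<le> (K1 + 2 * M * sqrt (X0 + 1) * exp c) * power_gauss 1 c e"
        using M sq by (simp only: mult_1) (intro mult_right_mono, auto simp: power_gauss_def)
      finally show ?thesis .
    qed
    also have "\<dots> \<le> (K1 + 2 * M * sqrt (X0 + 1) * exp c) * h e"
      using K1 M sq L G1pos[OF e] by (intro mult_left_mono) (auto simp: h_def add_nonneg_nonneg)
    also have "\<dots> = K * ((X0 + 1) powr (- (1/2)) * h e)" unfolding pw[OF X0(1)] K_def using sq by simp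
    finally show ?thesis by (simp add: e_def)
  qed
  define c' where "c' = min c \<beta>"
  have c': "c' > 0" "c' \<le> c" "c' \<le> \<beta>" using c B by (auto simp: c'_def)
  have hle: "h e \<le> (1 + L * B) * (e * exp (- c' * e\<^sup>2))" if e: "e \<ge> 0" for e
  proof -
    have "c' * e\<^sup>2 \<le> c * e\<^sup>2" using c' by (intro mult_right_mono) auto
    then have 1: "power_gauss 1 c e \<le> e * exp (- c' * e\<^sup>2)" using e by (simp add: power_gauss_def mult_left_mono)
    have "e\<^sup>2 \<le> (Z e)\<^sup>2" using Z_ge[OF e] e by (intro power_mono) auto
    then have "c' * e\<^sup>2 \<le> \<beta> * (Z e)\<^sup>2" using c' by (intro mult_mono) auto
    then have "B * exp (- \<beta> * (Z e)\<^sup>2) \<le> B * exp (- c' * e\<^sup>2)" using B by simp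
    then have "f2 (Z e) \<le> B * exp (- c' * e\<^sup>2)" using B(3)[OF Z_nonneg[OF e]] by linarith
    then have "G1 e \<le> e * (B * exp (- c' * e\<^sup>2))" using e by (simp add: G1_def mult_left_mono)
    then have "L * G1 e \<le> L * (e * (B * exp (- c' * e\<^sup>2)))" using L by (intro mult_left_mono) auto
    then show ?thesis using 1 by (simp add: h_def algebra_simps)
  qed
  have "(u x y)\<^sup>2 \<le> F (\<eta> 1 x y) + (K * (1 + L * B)) / sqrt (x + 1) * (\<eta> 1 x y * exp (- c' * (\<eta> 1 x y)\<^sup>2))"
    if x: "x \<ge> X0" and y: "y \<ge> 0" for x y
  proof -
    have "(u x y)\<^sup>2 \<le> F (\<eta> 1 x y) + K * ((x + 1) powr (- (1/2)) * h (\<eta> 1 x y))"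
    proof (rule upper_comparison[where ?X0.0 = X0 and p = "1/2" and ?h1.0 = "\<lambda>e. (1 / e - 2 * c * e) * power_gauss 1 c e + L * dG1 e"
          and ?h2.0 = "\<lambda>e. ((1 / e - 2 * c * e)\<^sup>2 - 1 / e\<^sup>2 - 2 * c) * power_gauss 1 c e + L * ddG1 e"])
      show "(h has_real_derivative (1 / e - 2 * c * e) * power_gauss 1 c e + L * dG1 e) (at e)" if "e > 0" for e
        unfolding h_def[abs_def] using that by (intro DERIV_add DERIV_cmult deriv_power_gauss deriv_G1)
      show "((\<lambda>e. (1 / e - 2 * c * e) * power_gauss 1 c e + L * dG1 e) has_real_derivative
         ((1 / e - 2 * c * e)\<^sup>2 - 1 / e\<^sup>2 - 2 * c) * power_gauss 1 c e + L * ddG1 e) (at e)" if "e > 0" for e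
        using that by (intro DERIV_add DERIV_cmult deriv_power_gauss deriv_dG1)
      show "continuous_on {0..} h"
        unfolding h_def[abs_def] by (intro continuous_on_add continuous_on_mult_left continuous_power_gauss continuous_G1) simp
      show "h e \<ge> 0" if "e \<ge> 0" for e using L G1pos[OF that] by (simp add: h_def power_gauss_def)
      fix x y :: real assume x: "x > X0" and y: "y > 0" and fu: "f1 (Z (\<eta> 1 x y)) \<le> u x y"
      have x0: "x \<ge> 0" using x X0 by simp
      let ?e = "\<eta> 1 x y"
      have e: "?e > 0" using eta_pos[of 1 x y] x0 y by simp
      have "(u x y)\<^sup>2 - F ?e \<le> K1 * (x + 1) powr (- (s/2)) * power_gauss s c ?e"
        using st1[OF x0, of y] y by simp
      also have "\<dots> \<le> \<epsilon> * power_gauss s c ?e"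
        using X0(2)[of x] x by (intro mult_right_mono) (auto simp: power_gauss_def)
      finally have "(u x y - f1 (Z ?e)) * (?e\<^sup>2 - 5 * f1 (Z ?e)) \<le> (f1 (Z ?e))\<^sup>2 / 2" by (rule \<epsilon>(2)[OF e fu])
      from combined_supersolution[OF e c fu _ this L_def] um[OF x0, of y] y
      show "- (1/2) * h ?e - ?e * ((1 / ?e - 2 * c * ?e) * power_gauss 1 c ?e + L * dG1 ?e) / 2
       - u x y * (((1 / ?e - 2 * c * ?e)\<^sup>2 - 1 / ?e\<^sup>2 - 2 * c) * power_gauss 1 c ?e + L * ddG1 ?e) \<ge> 0"
        unfolding h_def by simp
    qed (use X0 K init x y in auto)
    also have "K * ((x + 1) powr (- (1/2)) * h (\<eta> 1 x y))
       \<le> K * ((x + 1) powr (- (1/2)) * ((1 + L * B) * (\<eta> 1 x y * exp (- c' * (\<eta> 1 x y)\<^sup>2))))"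
      using K hle[OF eta_nonneg[of 1 x y]] x X0 y by (intro mult_left_mono) auto
    finally show ?thesis using pw[of x] x X0 by simp
  qed
  moreover have "K * (1 + L * B) > 0" using K L B by (simp add: add_pos_pos)
  ultimately show ?thesis using X0(1) c'(1) by blast
qed


subsection \<open>Return to the physical plane\<close>

text \<open>\<open>\<eta> 1 x y\<close> is at least \<open>f (y / sqrt (x + a))\<close>, which grows
  linearly. Passing from \<open>x + a\<close> to \<open>x + 1\<close> costs a factor
  \<open>a\<close> in the rate, and the constant \<open>exp (c q^2)\<close> covers the range
  \<open>w \<le> 2\<close>.\<close>

lemma eta_gaussian:
  assumes c: "c > 0"
  shows "\<exists>C>0. \<exists>c'>0. \<forall>x\<ge>0. \<forall>y\<ge>0. exp (- c * (\<eta> 1 x y)\<^sup>2) \<le> C * exp (- c' * y\<^sup>2 / (x + 1))"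
proof -
  obtain a where a: "a \<ge> 1" "\<And>x y. x \<ge> 0 \<Longrightarrow> y \<ge> 0 \<Longrightarrow> f (y / sqrt (x + a)) \<le> \<eta> 1 x y"
    using physical_lower by auto
  define q where "q = f1 1"
  have q: "q > 0" using f1_pos[of 1] by (simp add: q_def)
  define c' where "c' = c * q\<^sup>2 / (4 * a)"
  have c': "c' > 0" using c q a by (simp add: c'_def)
  have "exp (- c * (\<eta> 1 x y)\<^sup>2) \<le> exp (c * q\<^sup>2) * exp (- c' * y\<^sup>2 / (x + 1))" if x: "x \<ge> 0" and y: "y \<ge> 0" for x y
  proof -
    define w where "w = y / sqrt (x + a)"
    have w: "w \<ge> 0" using x y a by (simp add: w_def)
    have ew: "q * (w - 1) \<le> \<eta> 1 x y" using f_lower[OF w] a(2)[OF x y] by (simp add: w_def q_def)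
    have "q\<^sup>2 * w\<^sup>2 / 4 - q\<^sup>2 \<le> (\<eta> 1 x y)\<^sup>2"
    proof (cases "w \<le> 2")
      case True
      then have "w\<^sup>2 \<le> 2\<^sup>2" using w by (intro power_mono) auto
      then have "q\<^sup>2 * w\<^sup>2 \<le> q\<^sup>2 * 4" by (intro mult_left_mono) auto
      then show ?thesis using zero_le_power2[of "\<eta> 1 x y"] by linarith
    next
      case False
      have "q * (w / 2) \<le> q * (w - 1)" using False q by (intro mult_left_mono) auto
      then have "q * (w / 2) \<le> \<eta> 1 x y" using ew by linarith
      then have "(q * (w / 2))\<^sup>2 \<le> (\<eta> 1 x y)\<^sup>2" using q w by (intro power_mono mult_nonneg_nonneg) auto
      then have "q\<^sup>2 * w\<^sup>2 / 4 \<le> (\<eta> 1 x y)\<^sup>2" by (simp add: power_mult_distrib power_divide)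
      then show ?thesis using zero_le_power2[of q] by linarith
    qed
    moreover have "y\<^sup>2 / (x + 1) / a \<le> w\<^sup>2"
    proof -
      have w2: "w\<^sup>2 = y\<^sup>2 / (x + a)" using x a by (simp add: w_def power_divide)
      have "x * 1 \<le> x * a" using a x by (intro mult_left_mono) auto
      then have "x + a \<le> (x + 1) * a" by (simp add: algebra_simps)
      then have "y\<^sup>2 / ((x + 1) * a) \<le> y\<^sup>2 / (x + a)" using x a by (intro divide_left_mono) auto
      then show ?thesis unfolding w2 by simp
    qed
    then have "q\<^sup>2 / 4 * (y\<^sup>2 / (x + 1) / a) \<le> q\<^sup>2 / 4 * w\<^sup>2" by (intro mult_left_mono) auto
    moreover have "q\<^sup>2 / 4 * w\<^sup>2 = q\<^sup>2 * w\<^sup>2 / 4" by simp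
    ultimately have "q\<^sup>2 / 4 * (y\<^sup>2 / (x + 1) / a) - q\<^sup>2 \<le> (\<eta> 1 x y)\<^sup>2" by linarith
    then have "c * (q\<^sup>2 / 4 * (y\<^sup>2 / (x + 1) / a) - q\<^sup>2) \<le> c * (\<eta> 1 x y)\<^sup>2" using c by (intro mult_left_mono) auto
    moreover have "c * (q\<^sup>2 / 4 * (y\<^sup>2 / (x + 1) / a) - q\<^sup>2) = c' * y\<^sup>2 / (x + 1) - c * q\<^sup>2"
      by (simp add: c'_def right_diff_distrib mult_ac)
    ultimately have "- c * (\<eta> 1 x y)\<^sup>2 \<le> c * q\<^sup>2 + - c' * y\<^sup>2 / (x + 1)" by simp
    then show ?thesis unfolding exp_add[symmetric] by simp
  qed
  then show ?thesis using c' exp_gt_zero by blast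
qed

lemma profile_gaussian:
  "\<exists>C>0. \<exists>c>0. \<forall>x\<ge>0. \<forall>y\<ge>0. f2 (y / sqrt (x + 1)) \<le> C * exp (- c * y\<^sup>2 / (x + 1))
    \<and> 1 - f1 (y / sqrt (x + 1)) \<le> C * exp (- c * y\<^sup>2 / (x + 1))"
proof -
  obtain B \<beta> where B: "B > 0" "\<beta> > 0" "\<And>z. z \<ge> 0 \<Longrightarrow> f2 z \<le> B * exp (- \<beta> * z\<^sup>2) \<and> 1 - f1 z \<le> B * exp (- \<beta> * z\<^sup>2)"
    using profile_tails by blast
  have "f2 (y / sqrt (x + 1)) \<le> B * exp (- \<beta> * y\<^sup>2 / (x + 1)) \<and> 1 - f1 (y / sqrt (x + 1)) \<le> B * exp (- \<beta> * y\<^sup>2 / (x + 1))"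
    if "x \<ge> 0" "y \<ge> 0" for x y
    using B(3)[of "y / sqrt (x + 1)"] that by (simp add: power_divide)
  then show ?thesis using B by blast
qed

text \<open>The excess is measured relative to \<open>f1 (Z ...)\<close> because streamlines are
  compared through the quotient \<open>u / f1\<close>. Half of the Gaussian rate buys the division
  by \<open>F\<close> and the weight \<open>1 + Z^2\<close>; the other half is kept.\<close>

lemma pointwise_upper:
  "\<exists>X0\<ge>0. \<exists>C>0. \<exists>c>0. \<forall>x\<ge>X0. \<forall>y>0.
     u x y \<le> f1 (Z (\<eta> 1 x y)) * (1 + C / (sqrt (x + 1) * (1 + (Z (\<eta> 1 x y))\<^sup>2)) * exp (- c * (\<eta> 1 x y)\<^sup>2))"
proof -
  obtain X0 K c where X0: "X0 \<ge> 0" and K: "K > 0" and c: "c > 0"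
    and st2: "\<And>x y. x \<ge> X0 \<Longrightarrow> y \<ge> 0 \<Longrightarrow>
      (u x y)\<^sup>2 \<le> F (\<eta> 1 x y) + K / sqrt (x + 1) * (\<eta> 1 x y * exp (- c * (\<eta> 1 x y)\<^sup>2))"
    using excess_decays_like_sqrt by blast
  obtain C0 where C0: "C0 > 0" "\<And>e. e \<ge> 0 \<Longrightarrow> e * exp (- (c/2) * e\<^sup>2) * (1 + (Z e)\<^sup>2) \<le> C0 * F e"
    using gauss_le_F[of "c/2"] c by auto
  have "u x y \<le> f1 (Z (\<eta> 1 x y)) * (1 + (K * C0 / 2) / (sqrt (x + 1) * (1 + (Z (\<eta> 1 x y))\<^sup>2)) * exp (- (c/2) * (\<eta> 1 x y)\<^sup>2))"
    if x: "x \<ge> X0" and y: "y > 0" for x y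
  proof -
    define e where "e = \<eta> 1 x y"
    have x0: "x \<ge> 0" using x X0 by simp
    have e: "e > 0" using eta_pos[of 1 x y] x0 y by (simp add: e_def)
    define a where "a = f1 (Z e)"
    have a: "a > 0" using f1_Z_pos[OF e] by (simp add: a_def)
    define s where "s = sqrt (x + 1)"
    have s: "s > 0" using x0 by (simp add: s_def)
    define r where "r = 1 + (Z e)\<^sup>2"
    have r: "r > 0" by (simp add: r_def add_pos_nonneg)
    define E where "E = exp (- (c/2) * e\<^sup>2)"
    have E: "E > 0" by (simp add: E_def)
    have EE: "exp (- c * e\<^sup>2) = E * E" unfolding E_def exp_add[symmetric] by simp
    define \<tau> where "\<tau> = (K * C0 / 2) / (s * r) * E"
    have \<tau>: "\<tau> \<ge> 0" using K C0 s r E by (simp add: \<tau>_def)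
    have "e * E * r \<le> C0 * a\<^sup>2" using C0(2)[of e] e by (simp add: E_def r_def F_def a_def)
    then have "e * E \<le> C0 * a\<^sup>2 / r" using r by (simp add: pos_le_divide_eq)
    then have "K / s * E * (e * E) \<le> K / s * E * (C0 * a\<^sup>2 / r)" using K s E by (intro mult_left_mono) auto
    also have "\<dots> = 2 * a\<^sup>2 * \<tau>" using s r by (simp add: \<tau>_def field_simps)
    finally have g: "K / s * (e * (E * E)) \<le> 2 * a\<^sup>2 * \<tau>" by (simp add: mult_ac)
    have "(u x y)\<^sup>2 \<le> a\<^sup>2 + K / s * (e * (E * E))"
      using st2[OF x, of y] y EE by (simp add: e_def F_def a_def s_def)
    also have "\<dots> \<le> a\<^sup>2 + 2 * a\<^sup>2 * \<tau>" using g by simp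
    also have "\<dots> \<le> a\<^sup>2 + 2 * a\<^sup>2 * \<tau> + (a * \<tau>)\<^sup>2" by simp
    also have "\<dots> = (a * (1 + \<tau>))\<^sup>2" by (simp add: power2_eq_square algebra_simps)
    finally have "(u x y)\<^sup>2 \<le> (a * (1 + \<tau>))\<^sup>2" .
    then have "u x y \<le> a * (1 + \<tau>)" by (rule power2_le_imp_le) (use a \<tau> in simp)
    then show ?thesis unfolding a_def \<tau>_def E_def r_def s_def e_def .
  qed
  moreover have "K * C0 / 2 > 0" "c / 2 > 0" using K C0 c by auto
  ultimately show ?thesis using X0 by blast
qed

text \<open>With \<open>q = Z (\<eta> 1 x y)\<close> and \<open>s = sqrt (x + 1)\<close>,
  the assumption makes \<open>y - s q + C arctan q\<close> nondecreasing in \<open>y\<close>.\<close>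

lemma Z_eta_upper:
  assumes C: "C > 0" and x: "x \<ge> 0" and y: "y \<ge> 0"
    and bd: "\<And>t. t > 0 \<Longrightarrow> u x t \<le> f1 (Z (\<eta> 1 x t)) * (1 + C / (sqrt (x + 1) * (1 + (Z (\<eta> 1 x t))\<^sup>2)))"
  shows "Z (\<eta> 1 x y) \<le> y / sqrt (x + 1) + 2 * C / sqrt (x + 1)"
proof -
  define s where "s = sqrt (x + 1)"
  have s: "s > 0" using x by (simp add: s_def)
  define q where "q t = Z (\<eta> 1 x t)" for t
  have "0 - s * q 0 + C * arctan (q 0) \<le> y - s * q y + C * arctan (q y)"
  proof (rule DERIV_nonneg_imp_increasing_open[OF y])
    fix t assume t: "0 < t" "t < y"
    have e: "\<eta> 1 x t > 0" using eta_pos[of 1 x t] x t by simp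
    define a where "a = f1 (Z (\<eta> 1 x t))"
    have a: "a > 0" using f1_Z_pos[OF e] by (simp add: a_def)
    define d where "d = inverse a * (u x t / s)"
    have dq: "(q has_real_derivative d) (at t)"
      unfolding q_def[abs_def] d_def a_def s_def
      by (rule DERIV_chain2[OF deriv_Z[OF e] deriv_eta_y]) (use x t in auto)
    have da: "((\<lambda>t. arctan (q t)) has_real_derivative inverse (1 + (q t)\<^sup>2) * d) (at t)"
      by (rule DERIV_chain2[OF DERIV_arctan dq])
    have D: "((\<lambda>t. t - s * q t + C * arctan (q t)) has_real_derivative 1 - s * d + C * (inverse (1 + (q t)\<^sup>2) * d)) (at t)"
      by (intro DERIV_add DERIV_diff DERIV_ident DERIV_cmult dq da)
    define \<tau> where "\<tau> = C / (s * (1 + (q t)\<^sup>2))"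
    have q1: "1 + (q t)\<^sup>2 > 0" by (simp add: add_pos_nonneg)
    have \<tau>: "\<tau> > 0" using C s q1 by (simp add: \<tau>_def)
    have sd: "s * d = u x t / a" using s a by (simp add: d_def field_simps)
    have "u x t \<le> a * (1 + \<tau>)" using bd[OF t(1)] by (simp add: a_def \<tau>_def s_def q_def)
    then have sd1: "s * d \<le> 1 + \<tau>" unfolding sd using a by (simp add: divide_le_eq mult.commute)
    have sd0: "s * d \<ge> 0" unfolding sd using u_nonneg[of x t] x t a by simp
    \<comment> \<open>The derivative in question is \<open>1 - s d (1 - \<tau>)\<close>, the arctan
      term contributing \<open>s d \<tau>\<close>. Hence
      \<open>(1 + \<tau>) (1 - \<tau>) \<le> 1\<close> suffices, and for \<open>\<tau> > 1\<close>
      the sign does.\<close>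
    have "s * d * (1 - \<tau>) \<le> 1"
    proof (cases "\<tau> \<le> 1")
      case True
      have "s * d * (1 - \<tau>) \<le> (1 + \<tau>) * (1 - \<tau>)" using sd1 True by (intro mult_right_mono) auto
      also have "\<dots> = 1 - \<tau> * \<tau>" by (simp add: algebra_simps)
      also have "\<dots> \<le> 1" by simp
      finally show ?thesis .
    next
      case False
      then have "s * d * (1 - \<tau>) \<le> 0" using sd0 by (intro mult_nonneg_nonpos) auto
      then show ?thesis by simp
    qed
    moreover have "C * (inverse (1 + (q t)\<^sup>2) * d) = s * d * \<tau>"
      using s q1 by (simp add: \<tau>_def divide_inverse)
    moreover have "s * d * (1 - \<tau>) = s * d - s * d * \<tau>" by (simp add: right_diff_distrib)
    ultimately have "1 - s * d + C * (inverse (1 + (q t)\<^sup>2) * d) \<ge> 0" by linarith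
    then show "\<exists>z. ((\<lambda>t. t - s * q t + C * arctan (q t)) has_real_derivative z) (at t) \<and> 0 \<le> z"
      using D by blast
  next
    have "continuous_on {0..y} q" unfolding q_def[abs_def]
      by (rule continuous_on_compose2[OF continuous_Z continuous_on_subset[OF continuous_eta_y[OF zero_less_one x]]]) auto
    then show "continuous_on {0..y} (\<lambda>t. t - s * q t + C * arctan (q t))"
      by (intro continuous_on_add continuous_on_diff continuous_on_mult continuous_on_arctan continuous_on_id continuous_on_const)
  qed
  then have "s * q y \<le> y + C * arctan (q y)" by (simp add: q_def)
  \<comment> \<open>Since \<open>arctan\<close> is bounded, the displacement \<open>s q - y\<close>
    is bounded independently of \<open>x\<close> and \<open>y\<close>.\<close>
  also have "C * arctan (q y) \<le> C * 2" using arctan_ubound[of "q y"] pi_half_less_two C by (intro mult_left_mono) auto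
  finally have "s * q y \<le> y + 2 * C" by simp
  then have "q y \<le> (y + 2 * C) / s" using s by (simp add: pos_le_divide_eq mult.commute)
  then show ?thesis by (simp add: q_def s_def add_divide_distrib)
qed

text \<open>With \<open>z = y / sqrt (x + 1)\<close> and \<open>q = Z (\<eta> 1 x y)\<close>, the
  excess over \<open>f1 q\<close> is controlled by \<open>pointwise_upper\<close>. For
  \<open>q > z\<close> the rest \<open>f1 q - f1 z\<close> is at most \<open>(q - z) * f2 z\<close>,
  where \<open>q - z \<le> 2 C / sqrt (x + 1)\<close> by \<open>Z_eta_upper\<close>.\<close>

lemma upper_late:
  "\<exists>X0\<ge>0. \<exists>C>0. \<exists>c>0. \<forall>x\<ge>X0. \<forall>y\<ge>0.
     u x y - f1 (y / sqrt (x + 1)) \<le> C / sqrt (x + 1) * exp (- c * y\<^sup>2 / (x + 1))"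
proof -
  obtain X0 C c where X0: "X0 \<ge> 0" and C: "C > 0" and c: "c > 0"
    and pw: "\<And>x y. x \<ge> X0 \<Longrightarrow> y > 0 \<Longrightarrow>
     u x y \<le> f1 (Z (\<eta> 1 x y)) * (1 + C / (sqrt (x + 1) * (1 + (Z (\<eta> 1 x y))\<^sup>2)) * exp (- c * (\<eta> 1 x y)\<^sup>2))"
    using pointwise_upper by blast
  obtain C2 c2 where C2: "C2 > 0" "c2 > 0"
    "\<And>x y. x \<ge> 0 \<Longrightarrow> y \<ge> 0 \<Longrightarrow> exp (- c * (\<eta> 1 x y)\<^sup>2) \<le> C2 * exp (- c2 * y\<^sup>2 / (x + 1))"
    using eta_gaussian[OF c] by blast
  obtain C3 c3 where C3: "C3 > 0" "c3 > 0"
    "\<And>x y. x \<ge> 0 \<Longrightarrow> y \<ge> 0 \<Longrightarrow> f2 (y / sqrt (x + 1)) \<le> C3 * exp (- c3 * y\<^sup>2 / (x + 1))"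
    using profile_gaussian by blast
  define c' where "c' = min c2 c3"
  have c': "c' > 0" "c' \<le> c2" "c' \<le> c3" using C2 C3 by (auto simp: c'_def)
  define C' where "C' = C * C2 + 2 * C * C3"
  have C': "C' > 0" using C C2 C3 by (simp add: C'_def add_pos_pos)
  have "u x y - f1 (y / sqrt (x + 1)) \<le> C' / sqrt (x + 1) * exp (- c' * y\<^sup>2 / (x + 1))"
    if x: "x \<ge> X0" and y: "y \<ge> 0" for x y
  proof (cases "y = 0")
    case True
    then show ?thesis using x X0 C' by simp
  next
    case False
    have x0: "x \<ge> 0" using x X0 by simp
    define s where "s = sqrt (x + 1)"
    have s: "s > 0" using x0 by (simp add: s_def)
    define z where "z = y / s"
    have z: "z \<ge> 0" using y s by (simp add: z_def)
    define q where "q = Z (\<eta> 1 x y)"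
    have q: "q \<ge> 0" unfolding q_def using Z_nonneg[OF eta_nonneg[of 1 x y]] x0 y by simp
    define E where "E = exp (- c' * y\<^sup>2 / (x + 1))"
    have mono: "exp (- k * y\<^sup>2 / (x + 1)) \<le> E" if "c' \<le> k" for k
    proof -
      have "c' * (y\<^sup>2 / (x + 1)) \<le> k * (y\<^sup>2 / (x + 1))" using that x0 by (intro mult_right_mono) auto
      then show ?thesis by (simp add: E_def)
    qed
    have ub: "u x t \<le> f1 (Z (\<eta> 1 x t)) * (1 + C / (sqrt (x + 1) * (1 + (Z (\<eta> 1 x t))\<^sup>2)))" if t: "t > 0" for t
    proof -
      have e: "\<eta> 1 x t \<ge> 0" using eta_nonneg[of 1 x t] x0 t by simp
      have "C / (sqrt (x + 1) * (1 + (Z (\<eta> 1 x t))\<^sup>2)) * exp (- c * (\<eta> 1 x t)\<^sup>2) \<le> C / (sqrt (x + 1) * (1 + (Z (\<eta> 1 x t))\<^sup>2)) * 1"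
        using C c x0 by (intro mult_left_mono) (auto simp: add_nonneg_nonneg)
      then have "f1 (Z (\<eta> 1 x t)) * (1 + C / (sqrt (x + 1) * (1 + (Z (\<eta> 1 x t))\<^sup>2)) * exp (- c * (\<eta> 1 x t)\<^sup>2))
         \<le> f1 (Z (\<eta> 1 x t)) * (1 + C / (sqrt (x + 1) * (1 + (Z (\<eta> 1 x t))\<^sup>2)))"
        using f1_Z_nonneg[OF e] by (intro mult_left_mono) auto
      then show ?thesis using pw[OF x t] by linarith
    qed
    have qz: "q \<le> z + 2 * C / s" using Z_eta_upper[OF C x0 y ub] by (simp add: q_def z_def s_def)
    have E0: "E > 0" by (simp add: E_def)
    have f2z: "f2 z \<le> C3 * E"
    proof -
      have "f2 z \<le> C3 * exp (- c3 * y\<^sup>2 / (x + 1))" using C3(3)[OF x0 y] by (simp add: z_def s_def)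
      also have "\<dots> \<le> C3 * E" using mono[OF c'(3)] C3 by simp
      finally show ?thesis .
    qed
    have 1: "f1 q - f1 z \<le> C3 * E * (2 * C / s)"
    proof (cases "q \<le> z")
      case True
      then have "f1 q - f1 z \<le> 0" using f1_mono[OF q True] by simp
      also have "0 \<le> C3 * E * (2 * C / s)" using C3 E0 C s by simp
      finally show ?thesis .
    next
      case F: False
      then have zq: "z < q" by simp
      obtain w where w: "z < w" "w < q" "f1 q - f1 z = (q - z) * f2 w"
        by (rule halfline_MVT[OF deriv_f1 z zq])
      have "(q - z) * f2 w \<le> (2 * C / s) * f2 z"
        using w z qz C s f2_antimono[of z w] f2_pos[of w] by (intro mult_mono) auto
      also have "\<dots> \<le> (2 * C / s) * (C3 * E)" using f2z C s by (intro mult_left_mono) auto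
      finally show ?thesis using w by (simp add: mult_ac)
    qed
    define \<tau> where "\<tau> = C / (s * (1 + q\<^sup>2)) * exp (- c * (\<eta> 1 x y)\<^sup>2)"
    have \<tau>: "\<tau> \<le> C / s * (C2 * E)"
      unfolding \<tau>_def
    proof (intro mult_mono)
      show "C / (s * (1 + q\<^sup>2)) \<le> C / s" using C s by (intro divide_left_mono) (auto intro!: mult_pos_pos simp: add_pos_nonneg)
      have "C2 * exp (- c2 * y\<^sup>2 / (x + 1)) \<le> C2 * E" using mono[OF c'(2)] C2 by simp
      then show "exp (- c * (\<eta> 1 x y)\<^sup>2) \<le> C2 * E" using C2(3)[OF x0 y] by linarith
    qed (use C s in auto)
    have \<tau>0: "\<tau> \<ge> 0" using C s by (simp add: \<tau>_def add_nonneg_nonneg)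
    have "u x y \<le> f1 q * (1 + \<tau>)" using pw[OF x, of y] y False by (simp add: q_def s_def \<tau>_def)
    also have "\<dots> \<le> f1 q + \<tau>"
      using f1_less_1[OF q] \<tau>0 mult_right_mono[of "f1 q" 1 \<tau>] by (simp add: distrib_left)
    finally have "u x y - f1 z \<le> C / s * (C2 * E) + C3 * E * (2 * C / s)" using 1 \<tau> by linarith
    also have "\<dots> = C' / s * E" by (simp add: C'_def add_divide_distrib algebra_simps)
    finally show ?thesis by (simp add: z_def s_def E_def)
  qed
  then show ?thesis using X0 C' c' by blast
qed

text \<open>For bounded \<open>x\<close> the factor \<open>1 / sqrt (x + 1)\<close> is bounded
  below, so only decay in \<open>y\<close> has to be shown. The first barrier gives it,
  \<open>u\<close> and the profile each being compared with 1.\<close>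

lemma upper_early:
  assumes X0: "X0 \<ge> 0"
  shows "\<exists>C>0. \<exists>c>0. \<forall>x y. 0 \<le> x \<and> x \<le> X0 \<and> y \<ge> 0 \<longrightarrow>
     u x y - f1 (y / sqrt (x + 1)) \<le> C / sqrt (x + 1) * exp (- c * y\<^sup>2 / (x + 1))"
proof -
  obtain m c s K where c: "c > 0" and s: "0 < s" "s \<le> 1/2" and K: "K > 0"
    and st1: "\<And>x y. x \<ge> 0 \<Longrightarrow> y \<ge> 0 \<Longrightarrow> u x y \<le> (m::real) \<and>
      (u x y)\<^sup>2 \<le> F (\<eta> 1 x y) + K * ((x + 1) powr (- (s/2)) * power_gauss s c (\<eta> 1 x y))"
    using excess_decays_slowly by metis
  have c2: "c / 2 > 0" using c by simp
  obtain C2 c2 where C2: "C2 > 0" "c2 > 0"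
    "\<And>x y. x \<ge> 0 \<Longrightarrow> y \<ge> 0 \<Longrightarrow> exp (- (c/2) * (\<eta> 1 x y)\<^sup>2) \<le> C2 * exp (- c2 * y\<^sup>2 / (x + 1))"
    using eta_gaussian[OF c2] by blast
  obtain C3 c3 where C3: "C3 > 0" "c3 > 0"
    "\<And>x y. x \<ge> 0 \<Longrightarrow> y \<ge> 0 \<Longrightarrow> 1 - f1 (y / sqrt (x + 1)) \<le> C3 * exp (- c3 * y\<^sup>2 / (x + 1))"
    using profile_gaussian by blast
  define S where "S = 1 + 2 / (c/2)\<^sup>2"
  have S: "S > 0" using c by (simp add: S_def add_pos_nonneg)
  define c' where "c' = min c2 c3"
  have c': "c' > 0" "c' \<le> c2" "c' \<le> c3" using C2 C3 by (auto simp: c'_def)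
  define C' where "C' = (K * (2 * S) * C2 + C3) * sqrt (X0 + 1)"
  have C': "C' > 0" using K S C2 C3 X0 by (simp add: C'_def add_pos_pos)
  have "u x y - f1 (y / sqrt (x + 1)) \<le> C' / sqrt (x + 1) * exp (- c' * y\<^sup>2 / (x + 1))"
    if xy: "0 \<le> x \<and> x \<le> X0 \<and> y \<ge> 0" for x y
  proof -
    have x: "x \<ge> 0" "x \<le> X0" and y: "y \<ge> 0" using xy by auto
    define e where "e = \<eta> 1 x y"
    have e: "e \<ge> 0" using eta_nonneg[of 1 x y] x y by (simp add: e_def)
    define E where "E = exp (- c' * y\<^sup>2 / (x + 1))"
    have E0: "E > 0" by (simp add: E_def)
    have mono: "exp (- k * y\<^sup>2 / (x + 1)) \<le> E" if "c' \<le> k" for k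
    proof -
      have "c' * (y\<^sup>2 / (x + 1)) \<le> k * (y\<^sup>2 / (x + 1))" using that x by (intro mult_right_mono) auto
      then show ?thesis by (simp add: E_def)
    qed
    have pg: "power_gauss s c e \<le> 2 * S * exp (- (c/2) * e\<^sup>2)"
    proof -
      have "e powr s \<le> 1 + e" using powr_le_one_plus[OF e s(1)] s by simp
      also have "\<dots> \<le> 2 * (1 + e ^ 4)" using power_le_quartic[OF e, of 1, simplified] zero_le_power[OF e, of 4] unfolding distrib_left by linarith
      also have "\<dots> \<le> 2 * (S * exp ((c/2) * e\<^sup>2))" using quartic_le_gaussian[OF c2, of e] by (simp add: S_def)
      finally have "e powr s * exp (- c * e\<^sup>2) \<le> 2 * (S * exp ((c/2) * e\<^sup>2)) * exp (- c * e\<^sup>2)"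
        by (intro mult_right_mono) auto
      also have "\<dots> = 2 * S * (exp ((c/2) * e\<^sup>2) * exp (- c * e\<^sup>2))" by simp
      also have "\<dots> = 2 * S * exp (- (c/2) * e\<^sup>2)" unfolding exp_add[symmetric] by (simp add: algebra_simps)
      finally show ?thesis by (simp add: power_gauss_def)
    qed
    have "(u x y)\<^sup>2 \<le> F e + K * ((x + 1) powr (- (s/2)) * power_gauss s c e)" using st1[OF x(1) y] by (simp add: e_def)
    also have "\<dots> \<le> 1 + K * (1 * (2 * S * (C2 * E)))"
    proof (intro add_mono mult_left_mono mult_mono)
      show "F e \<le> 1" using F_less_1[OF e] by simp
      show "(x + 1) powr (- (s/2)) \<le> 1" using x s powr_mono[of "- (s/2)" 0 "x + 1"] by simp
      have "C2 * exp (- c2 * y\<^sup>2 / (x + 1)) \<le> C2 * E" using mono[OF c'(2)] C2 by simp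
      then have "exp (- (c/2) * e\<^sup>2) \<le> C2 * E" using C2(3)[OF x(1) y] unfolding e_def by linarith
      then have "2 * S * exp (- (c/2) * e\<^sup>2) \<le> 2 * S * (C2 * E)" using S by (intro mult_left_mono) auto
      then show "power_gauss s c e \<le> 2 * S * (C2 * E)" using pg by linarith
    qed (use K in \<open>auto simp: power_gauss_def\<close>)
    finally have u2: "(u x y)\<^sup>2 \<le> 1 + K * (2 * S) * C2 * E" by (simp add: mult_ac)
    have KE: "K * (2 * S) * C2 * E \<ge> 0" using K S C2 E0 by simp
    have "u x y - 1 \<le> K * (2 * S) * C2 * E"
    proof (cases "u x y \<le> 1")
      case True
      then show ?thesis using KE by linarith
    next
      case False
      then have "u x y * 1 \<le> u x y * u x y" by (intro mult_left_mono) auto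
      then show ?thesis using u2 by (simp add: power2_eq_square)
    qed
    moreover have "1 - f1 (y / sqrt (x + 1)) \<le> C3 * E"
    proof -
      have "C3 * exp (- c3 * y\<^sup>2 / (x + 1)) \<le> C3 * E" using mono[OF c'(3)] C3 by simp
      then show ?thesis using C3(3)[OF x(1) y] by linarith
    qed
    ultimately have "u x y - f1 (y / sqrt (x + 1)) \<le> (K * (2 * S) * C2 + C3) * E * 1" by (simp add: distrib_right)
    also have "\<dots> \<le> (K * (2 * S) * C2 + C3) * E * (sqrt (X0 + 1) / sqrt (x + 1))"
    proof (intro mult_left_mono)
      show "1 \<le> sqrt (X0 + 1) / sqrt (x + 1)" using x by simp
    qed (use K S C2 C3 E0 in auto)
    finally show ?thesis by (simp add: C'_def E_def mult_ac)
  qed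
  then show ?thesis using C' c' by blast
qed

lemma lower_bound:
  "\<exists>C>0. \<exists>c>0. \<forall>x\<ge>0. \<forall>y\<ge>0.
     f1 (y / sqrt (x + 1)) - u x y \<le> C / sqrt (x + 1) * exp (- c * y\<^sup>2 / (x + 1))"
proof -
  obtain a where a: "a \<ge> 1" "\<And>x y. x \<ge> 0 \<Longrightarrow> y \<ge> 0 \<Longrightarrow> f1 (y / sqrt (x + a)) \<le> u x y"
    using physical_lower by auto
  obtain B \<beta> where B: "B > 0" "\<beta> > 0" "\<And>z. z \<ge> 0 \<Longrightarrow> f2 z \<le> B * exp (- \<beta> * z\<^sup>2)"
    using profile_tails by blast
  \<comment> \<open>As \<open>z^2 \<le> a z'^2\<close>, the tail of \<open>f2\<close> at
    \<open>z'\<close> is at most \<open>B exp (- 2 c z^2)\<close>; one half of the exponent absorbs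
    the factor \<open>z\<close>, the other is the final rate.\<close>
  define c where "c = \<beta> / (2 * a)"
  have c: "c > 0" using B a by (simp add: c_def)
  define S where "S = 1 + 2 / c\<^sup>2"
  have S: "S > 0" using c by (simp add: S_def add_pos_nonneg)
  define C where "C = a * S * B"
  have C: "C > 0" using a S B by (simp add: C_def)
  have "f1 (y / sqrt (x + 1)) - u x y \<le> C / sqrt (x + 1) * exp (- c * y\<^sup>2 / (x + 1))" if x: "x \<ge> 0" and y: "y \<ge> 0" for x y
  proof -
    define s where "s = sqrt (x + 1)"
    have s1: "s \<ge> 1" using x by (simp add: s_def)
    have s2: "s\<^sup>2 = x + 1" using x by (simp add: s_def)
    define r where "r = sqrt (x + a)"
    have r: "r \<ge> s" "r > 0" using x a by (auto simp: r_def s_def)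
    have r2: "r\<^sup>2 = x + a" using x a by (simp add: r_def)
    define z where "z = y / s"
    define z' where "z' = y / r"
    have z': "0 \<le> z'" using y r by (simp add: z'_def)
    have zz': "z' \<le> z" unfolding z_def z'_def using y r s1 by (intro divide_left_mono) auto
    have z: "0 \<le> z" using z' zz' by simp
    have za: "z\<^sup>2 \<le> a * z'\<^sup>2"
    proof -
      have "x * 1 \<le> x * a" using a x by (intro mult_left_mono) auto
      then have ar: "r\<^sup>2 \<le> a * s\<^sup>2" unfolding r2 s2 by (simp add: algebra_simps)
      have "z\<^sup>2 = y\<^sup>2 / s\<^sup>2" by (simp add: z_def power_divide)
      also have "\<dots> = y\<^sup>2 * a / (a * s\<^sup>2)" using a by simp
      also have "\<dots> \<le> y\<^sup>2 * a / r\<^sup>2" using ar r a s1 by (intro divide_left_mono) auto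
      also have "\<dots> = a * z'\<^sup>2" by (simp add: z'_def power_divide)
      finally show ?thesis .
    qed
    \<comment> \<open>\<open>z - z' = z (r - s) / r\<close>, and
      \<open>(r - s) (r + s) = a - 1\<close> makes \<open>(r - s) / r\<close> at most
      \<open>a / s\<close>.\<close>
    have diff: "z - z' \<le> a * z / s"
    proof -
      have "(r - s) * s \<le> (r - s) * (r + s)" using r s1 by (intro mult_left_mono) auto
      also have "\<dots> = a - 1" using r2 s2 by (simp add: power2_eq_square algebra_simps)
      also have "\<dots> \<le> a * 1" by simp
      also have "\<dots> \<le> a * r" using a(1) r s1 by (intro mult_left_mono) auto
      finally have "(r - s) * s \<le> a * r" .
      then have "y * ((r - s) * s) \<le> y * (a * r)" using y by (intro mult_left_mono) auto
      then have "y * ((r - s) * s) / (s * s * r) \<le> y * (a * r) / (s * s * r)" using r s1 by (intro divide_right_mono) auto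
      moreover have "y * ((r - s) * s) / (s * s * r) = z - z'" using r s1 by (simp add: z_def z'_def field_simps)
      moreover have "y * (a * r) / (s * s * r) = a * z / s" using r s1 by (simp add: z_def field_simps)
      ultimately show ?thesis by linarith
    qed
    have f2z': "f2 z' \<le> B * (exp (- c * z\<^sup>2) * exp (- c * z\<^sup>2))"
    proof -
      have "2 * c * z\<^sup>2 \<le> 2 * c * (a * z'\<^sup>2)" using za c by (intro mult_left_mono) auto
      also have "\<dots> = \<beta> * z'\<^sup>2" using a by (simp add: c_def)
      finally have "exp (- \<beta> * z'\<^sup>2) \<le> exp (- c * z\<^sup>2 + - c * z\<^sup>2)" by simp
      then have "B * exp (- \<beta> * z'\<^sup>2) \<le> B * (exp (- c * z\<^sup>2) * exp (- c * z\<^sup>2))" unfolding exp_add using B by simp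
      then show ?thesis using B(3)[OF z'] by linarith
    qed
    have zS: "z * exp (- c * z\<^sup>2) \<le> S"
    proof -
      have "z \<le> S * exp (c * z\<^sup>2)" using power_le_quartic[OF z, of 1] quartic_le_gaussian[OF c, of z] by (simp add: S_def)
      then have "z * exp (- c * z\<^sup>2) \<le> S * exp (c * z\<^sup>2) * exp (- c * z\<^sup>2)" by (intro mult_right_mono) auto
      also have "\<dots> = S" by (simp add: mult.assoc flip: exp_add)
      finally show ?thesis .
    qed
    have "f1 z - f1 z' \<le> C / s * exp (- c * z\<^sup>2)"
    proof (cases "z' = z")
      case True
      then show ?thesis using C s1 by simp
    next
      case False
      then have lt: "z' < z" using zz' by simp
      obtain w where w: "z' < w" "w < z" "f1 z - f1 z' = (z - z') * f2 w"
        by (rule halfline_MVT[OF deriv_f1 z' lt])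
      have "(z - z') * f2 w \<le> (a * z / s) * (B * (exp (- c * z\<^sup>2) * exp (- c * z\<^sup>2)))"
        using diff f2z' f2_antimono[of z' w] f2_pos[of w] w z' z a s1 by (intro mult_mono) auto
      also have "\<dots> = (a * B / s * exp (- c * z\<^sup>2)) * (z * exp (- c * z\<^sup>2))" by simp
      also have "\<dots> \<le> (a * B / s * exp (- c * z\<^sup>2)) * S" using zS a B s1 by (intro mult_left_mono) auto
      finally show ?thesis using w by (simp add: C_def mult_ac)
    qed
    moreover have "- c * z\<^sup>2 = - c * y\<^sup>2 / (x + 1)" using s2 by (simp add: z_def power_divide)
    moreover have "f1 z' \<le> u x y" using a(2)[OF x y] by (simp add: z'_def r_def)
    ultimately have "f1 z - u x y \<le> C / s * exp (- c * y\<^sup>2 / (x + 1))" by simp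
    then show ?thesis by (simp add: z_def s_def)
  qed
  then show ?thesis using C c by blast
qed

lemma relaxation_estimate:
  "\<exists>C>0. \<exists>c>0. \<forall>x\<ge>0. \<forall>y\<ge>0.
     \<bar>u x y - f1 (y / sqrt (x + 1))\<bar> \<le> C / sqrt (x + 1) * exp (- c * y\<^sup>2 / (x + 1))"
proof -
  obtain X0 Ca ca where X0: "X0 \<ge> 0" and a: "Ca > 0" "ca > 0"
    "\<And>x y. x \<ge> X0 \<Longrightarrow> y \<ge> 0 \<Longrightarrow> u x y - f1 (y / sqrt (x + 1)) \<le> Ca / sqrt (x + 1) * exp (- ca * y\<^sup>2 / (x + 1))"
    using upper_late by blast
  obtain Cb cb where b: "Cb > 0" "cb > 0"
    "\<And>x y. 0 \<le> x \<Longrightarrow> x \<le> X0 \<Longrightarrow> y \<ge> 0 \<Longrightarrow> u x y - f1 (y / sqrt (x + 1)) \<le> Cb / sqrt (x + 1) * exp (- cb * y\<^sup>2 / (x + 1))"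
    using upper_early[OF X0] by blast
  obtain Cd cd where d: "Cd > 0" "cd > 0"
    "\<And>x y. x \<ge> 0 \<Longrightarrow> y \<ge> 0 \<Longrightarrow> f1 (y / sqrt (x + 1)) - u x y \<le> Cd / sqrt (x + 1) * exp (- cd * y\<^sup>2 / (x + 1))"
    using lower_bound by blast
  define C where "C = Ca + Cb + Cd"
  define c where "c = min ca (min cb cd)"
  have c: "c > 0" "c \<le> ca" "c \<le> cb" "c \<le> cd" using a b d by (auto simp: c_def)
  have C: "C > 0" "Ca \<le> C" "Cb \<le> C" "Cd \<le> C" using a b d by (auto simp: C_def)
  have "\<bar>u x y - f1 (y / sqrt (x + 1))\<bar> \<le> C / sqrt (x + 1) * exp (- c * y\<^sup>2 / (x + 1))"
    if x: "x \<ge> 0" and y: "y \<ge> 0" for x y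
  proof -
    have weaken: "K / sqrt (x + 1) * exp (- k * y\<^sup>2 / (x + 1)) \<le> C / sqrt (x + 1) * exp (- c * y\<^sup>2 / (x + 1))"
      if "K \<le> C" "c \<le> k" for K k
    proof (intro mult_mono divide_right_mono)
      have "c * (y\<^sup>2 / (x + 1)) \<le> k * (y\<^sup>2 / (x + 1))" using that x by (intro mult_right_mono) auto
      then show "exp (- k * y\<^sup>2 / (x + 1)) \<le> exp (- c * y\<^sup>2 / (x + 1))" by simp
    qed (use that x C in auto)
    have "u x y - f1 (y / sqrt (x + 1)) \<le> C / sqrt (x + 1) * exp (- c * y\<^sup>2 / (x + 1))"
    proof (cases "x \<le> X0")
      case True
      show ?thesis using b(3)[OF x True y] weaken[OF C(3) c(3)] by linarith
    next
      case False
      show ?thesis using a(3)[of x y] False y weaken[OF C(2) c(2)] by linarith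
    qed
    moreover have "f1 (y / sqrt (x + 1)) - u x y \<le> C / sqrt (x + 1) * exp (- c * y\<^sup>2 / (x + 1))"
      using d(3)[OF x y] weaken[OF C(4) c(4)] by linarith
    ultimately show ?thesis by linarith
  qed
  then show ?thesis using C(1) c(1) by blast
qed

end

theorem theorem1p3:
  fixes u0 d1 d2 :: "real \<Rightarrow> real"
    and u v ux uy uyy vy :: "real \<Rightarrow> real \<Rightarrow> real"
    and f f1 f2 :: "real \<Rightarrow> real"
    and C1 C4 C5 :: real
  assumes datum: "oleinik_datum u0 d1 d2"
    and sol: "oleinik_solution u0 u v ux uy uyy vy"
    and blasius: "blasius_profile f f1 f2"
    and C1_pos: "C1 > 0"
    and C1_rate: "blasius_gauss_rate f1 f2 C1"
    and C4_pos: "C4 > 0" and C5_pos: "C5 > 0" and C5_gt: "C5 > C1"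
    and decay: "\<forall>y\<ge>0. \<bar>u0 y - 1\<bar> \<le> C4 * exp (- C5 * y\<^sup>2)"
  shows "\<exists>C>0. \<exists>c>0. \<forall>x\<ge>0. \<forall>y\<ge>0.
           \<bar>u x y - f1 (y / sqrt (x + 1))\<bar>
             \<le> C / sqrt (x + 1) * ln (x + exp 1) * exp (- c * y\<^sup>2 / (x + 1))"
proof -
  interpret relaxation f f1 f2 u0 u v ux uy uyy vy d1 d2 C1 C4 C5
    by unfold_locales (fact assms)+
  obtain C c where C: "C > 0" "c > 0" "\<And>x y. x \<ge> 0 \<Longrightarrow> y \<ge> 0 \<Longrightarrow>
     \<bar>u x y - f1 (y / sqrt (x + 1))\<bar> \<le> C / sqrt (x + 1) * exp (- c * y\<^sup>2 / (x + 1))"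
    using relaxation_estimate by blast
  have "\<bar>u x y - f1 (y / sqrt (x + 1))\<bar> \<le> C / sqrt (x + 1) * ln (x + exp 1) * exp (- c * y\<^sup>2 / (x + 1))"
    if x: "x \<ge> 0" and y: "y \<ge> 0" for x y
  proof -
    \<comment> \<open>The logarithm is at least 1 for \<open>x \<ge> 0\<close>, so the estimate
      without it implies the claim.\<close>
    have "ln (exp 1) \<le> ln (x + exp 1)" using x by (subst ln_le_cancel_iff) (auto simp: add_nonneg_pos)
    then have "C / sqrt (x + 1) * 1 \<le> C / sqrt (x + 1) * ln (x + exp 1)" using C x by (intro mult_left_mono) auto
    then have "C / sqrt (x + 1) * exp (- c * y\<^sup>2 / (x + 1)) \<le> C / sqrt (x + 1) * ln (x + exp 1) * exp (- c * y\<^sup>2 / (x + 1))"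
      by (intro mult_right_mono) auto
    then show ?thesis using C(3)[OF x y] by linarith
  qed
  then show ?thesis using C by blast
qed

end
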